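(* Consider the linear structural error-in-variables model $y_i=\beta\xi_i+\alpha+\delta_i$, $x_i=\xi_i+\varepsilon_i$, $i\ge1$, with real-valued slope $\beta$ and intercept $\alpha$. If (A), (B) and (C) of the context are satisfied, then for $j=1$ and $2$, as $n\to\infty$, $$\sqrt n\,\ell_\xi(n)(\widehat\beta_{jn}-\beta)\xrightarrow{\mathcal D}N(0,c_j)\qquad\text{and}\qquad\sqrt n\,(\widehat\alpha_{jn}-\alpha)\xrightarrow{\mathcal D}N(0,d_j),$$ where $\ell_\xi(n)$ is the (typically unknown) slowly varying function at infinity described in the context, which converges to infinity when $\mathrm{Var}\,\xi=\infty$ and equals a positive constant when $\mathrm{Var}\,\xi<\infty$, while $c_j$ and $d_j$ are positive constants.
   Context: Assumptions. (A) $\{(\delta,\varepsilon),(\delta_i,\varepsilon_i),i\ge1\}$ is a sequence of i.i.d. random vectors with mean zero, $E\delta^4<\infty$, $E\varepsilon^4<\infty$, and positive definite covariance matrix $\Gamma=\begin{pmatrix}\lambda\theta&\mu\\ \mu&\theta\end{pmatrix}$, i.e. $\mathrm{Var}\,\delta=\lambda\theta$, $\mathrm{Var}\,\varepsilon=\theta$, $\mathrm{cov}(\delta,\varepsilon)=\mu$. (B) $\{\xi,\xi_i,i\ge1\}$ are i.i.d. random variables in the domain of attraction of the normal law (DAN), i.e. there are constants $a_n$ and $b_n$, $b_n>0$, for which $(\sum_{i=1}^n\xi_i-a_n)b_n^{-1}\xrightarrow{\mathcal D}N(0,1)$ as $n\to\infty$. (C) $(\delta,\varepsilon)$ and $\xi$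 are independent; in the structural model the explanatory variables $\xi_i$ are independent of the error terms $(\delta_i,\varepsilon_i)$. The function $\ell_\xi$: under (B) it is known that one can take $a_n=nE\xi$ and $b_n=n^{1/2}\ell_\xi(n)$, where $\ell_\xi(n)$ is a slowly varying function at infinity ($\ell_\xi(az)/\ell_\xi(z)\to1$ as $z\to\infty$ for any $a>0$) defined by the distribution of $\xi$; moreover $\ell_\xi(n)=\sqrt{\mathrm{Var}\,\xi}>0$ if $\mathrm{Var}\,\xi<\infty$, and $\ell_\xi(n)\nearrow\infty$ as $n\to\infty$ if $\mathrm{Var}\,\xi=\infty$. Notation. For real-valued variables $u_i,v_i$, $1\le i\le n$: $\overline u=\frac1n\sum_{i=1}^nu_i$, $s_{i,uv}=(u_i-c\,\overline u)(v_i-c\,\overline v)$, $S_{uv}=\frac1n\sum_{i=1}^ns_{i,uv}$, where $c=0$ if $\alpha$ is known to be zero and $c=1$ if $\alpha$ is unknown. The case $j=1$ is used when $\lambda\theta$ and $\mu$ are known and $\theta$ is unknown: $\widehat\beta_{1n}=\dfrac{S_{yy}-\lambda\theta}{S_{xy}-\mu}$ and $\widehat\alpha_{1n}=\overline y-\overline x\,\widehat\beta_{1n}$, if $S_{xy}-\mu\ne0$ and $S_{yy}-\lambda\theta>0$. The case $j=2$ is used when $\theta$ and $\mu$ are known and $\lambda\theta$ is unknown: $\widehat\beta_{2n}=\dfrac{S_{xy}-\mu}{S_{xx}-\theta}$ and $\widehat\alpha_{2n}=\overline y-\overline x\,\widehat\beta_{2n}$, if $S_{xx}-\theta>0$.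
   Formalization: For j=1 the slope β is assumed nonzero: at β=0, S_yy−λθ is asymptotically centred at 0, so the estimator is undefined with non-vanishing probability and the stated convergence fails; j=2 holds for every real β. *)

theory Defs
  imports "HOL-Probability.Probability"
begin

definition iid_copies ::
  "'a measure \<Rightarrow> 'b measure \<Rightarrow> ('a \<Rightarrow> 'b) \<Rightarrow> (nat \<Rightarrow> 'a \<Rightarrow> 'b) \<Rightarrow> bool" where
  "iid_copies M N X0 X \<longleftrightarrow>
     X0 \<in> measurable M N \<and>
     prob_space.indep_vars M (\<lambda>_. N) X {1..} \<and>
     (\<forall>i\<ge>1. distr M N (X i) = distr M N X0)"

text \<open>As \<open>prob_space.indep_var\<close>, but for random variables with values in different types.\<close>

definition indep_rvs ::
  "'a measure \<Rightarrow> 'b measure \<Rightarrow> ('a \<Rightarrow> 'b) \<Rightarrow> 'c measure \<Rightarrow> ('a \<Rightarrow> 'c) \<Rightarrow> bool" where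
  "indep_rvs M S X T Y \<longleftrightarrow>
     X \<in> measurable M S \<and> Y \<in> measurable M T \<and>
     prob_space.indep_set M {X -` A \<inter> space M |A. A \<in> sets S} {Y -` B \<inter> space M |B. B \<in> sets T}"

definition covariance :: "'a measure \<Rightarrow> ('a \<Rightarrow> real) \<Rightarrow> ('a \<Rightarrow> real) \<Rightarrow> real" where
  "covariance M U V =
     prob_space.expectation M
       (\<lambda>\<omega>. (U \<omega> - prob_space.expectation M U) * (V \<omega> - prob_space.expectation M V))"

text \<open>Convergence in distribution to the centred normal law with variance (not standard
  deviation) \<open>v\<close>; used for \<open>v > 0\<close> only.\<close>

definition tends_to_normal :: "'a measure \<Rightarrow> (nat \<Rightarrow> 'a \<Rightarrow> real) \<Rightarrow> real \<Rightarrow> bool" where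
  "tends_to_normal M Z v \<longleftrightarrow>
     weak_conv_m (\<lambda>n. distr M borel (Z n)) (density lborel (normal_density 0 (sqrt v)))"

definition pos_definite :: "real^'n^'n \<Rightarrow> bool" where
  "pos_definite A \<longleftrightarrow> transpose A = A \<and> (\<forall>v. v \<noteq> 0 \<longrightarrow> v \<bullet> (A *v v) > 0)"

text \<open>Here \<open>X 1, X 2, \<dots>\<close> are independent copies of the variable under consideration.\<close>

definition DAN :: "'a measure \<Rightarrow> (nat \<Rightarrow> 'a \<Rightarrow> real) \<Rightarrow> bool" where
  "DAN M X \<longleftrightarrow>
     (\<exists>a b. (\<forall>n. b n > 0) \<and> tends_to_normal M (\<lambda>n \<omega>. ((\<Sum>i=1..n. X i \<omega>) - a n) / b n) 1)"

definition slowly_varying :: "(real \<Rightarrow> real) \<Rightarrow> bool" where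
  "slowly_varying l \<longleftrightarrow> (\<forall>a>0. ((\<lambda>z. l (a * z) / l z) \<longlongrightarrow> 1) at_top)"

text \<open>\<open>DAN_norming M X0 X l\<close>: the constants \<open>n * E X0\<close> and \<open>sqrt n * l n\<close> are admissible centring
  and norming constants for the partial sums of the copies \<open>X\<close> of \<open>X0\<close>, where \<open>l\<close> is slowly
  varying, equal to the standard deviation of \<open>X0\<close> if that is finite, and nondecreasing and
  unbounded otherwise. Integrability of \<open>X0\<close>, which holds automatically in the domain of
  attraction of the normal law, is included so that the Bochner integral really is the mean.\<close>

definition DAN_norming ::
  "'a measure \<Rightarrow> ('a \<Rightarrow> real) \<Rightarrow> (nat \<Rightarrow> 'a \<Rightarrow> real) \<Rightarrow> (real \<Rightarrow> real) \<Rightarrow> bool" where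
  "DAN_norming M X0 X l \<longleftrightarrow>
     slowly_varying l \<and> (\<forall>n::nat. n \<ge> 1 \<longrightarrow> l (real n) > 0) \<and>
     integrable M X0 \<and>
     tends_to_normal M
       (\<lambda>n \<omega>. ((\<Sum>i=1..n. X i \<omega>) - real n * prob_space.expectation M X0)
                / (sqrt (real n) * l (real n))) 1 \<and>
     (if integrable M (\<lambda>\<omega>. (X0 \<omega>)\<^sup>2)
      then \<forall>n::nat. n \<ge> 1 \<longrightarrow> l (real n) = sqrt (prob_space.variance M X0)
      else (\<forall>m n::nat. 1 \<le> m \<and> m \<le> n \<longrightarrow> l (real m) \<le> l (real n)) \<and>
           filterlim (\<lambda>n::nat. l (real n)) at_top sequentially)"

definition smean :: "(nat \<Rightarrow> real) \<Rightarrow> nat \<Rightarrow> real" where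
  "smean u n = (\<Sum>i=1..n. u i) / real n"

definition S :: "real \<Rightarrow> (nat \<Rightarrow> real) \<Rightarrow> (nat \<Rightarrow> real) \<Rightarrow> nat \<Rightarrow> real" where
  "S c u v n = (\<Sum>i=1..n. (u i - c * smean u n) * (v i - c * smean v n)) / real n"

text \<open>The slope estimators are partial functions of the data; outside their domains they take an
  unspecified value. In the first one \<open>var_d\<close> is the variance of the error in \<open>y\<close>, in the
  second one \<open>var_e\<close> is the variance of the error in \<open>x\<close>; \<open>m\<close> is the covariance of the errors.\<close>

definition beta_hat1 ::
  "real \<Rightarrow> real \<Rightarrow> real \<Rightarrow> (nat \<Rightarrow> real) \<Rightarrow> (nat \<Rightarrow> real) \<Rightarrow> nat \<Rightarrow> real" where
  "beta_hat1 c var_d m x y n =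
     (if S c x y n - m \<noteq> 0 \<and> S c y y n - var_d > 0
      then (S c y y n - var_d) / (S c x y n - m) else undefined)"

definition beta_hat2 ::
  "real \<Rightarrow> real \<Rightarrow> real \<Rightarrow> (nat \<Rightarrow> real) \<Rightarrow> (nat \<Rightarrow> real) \<Rightarrow> nat \<Rightarrow> real" where
  "beta_hat2 c var_e m x y n =
     (if S c x x n - var_e > 0
      then (S c x y n - m) / (S c x x n - var_e) else undefined)"

definition alpha_hat1 ::
  "real \<Rightarrow> real \<Rightarrow> real \<Rightarrow> (nat \<Rightarrow> real) \<Rightarrow> (nat \<Rightarrow> real) \<Rightarrow> nat \<Rightarrow> real" where
  "alpha_hat1 c var_d m x y n = smean y n - smean x n * beta_hat1 c var_d m x y n"

definition alpha_hat2 ::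
  "real \<Rightarrow> real \<Rightarrow> real \<Rightarrow> (nat \<Rightarrow> real) \<Rightarrow> (nat \<Rightarrow> real) \<Rightarrow> nat \<Rightarrow> real" where
  "alpha_hat2 c var_e m x y n = smean y n - smean x n * beta_hat2 c var_e m x y n"

end

theory Submission imports Defs begin

text \<open>
  Write \<open>\<eta> i = \<delta> i - \<beta> \<epsilon> i\<close> for the residuals and \<open>m\<close> for the mean of \<open>\<xi>\<close>. Both slope estimators are
  quotients of the same form: with \<open>w = y\<close>, respectively \<open>w = x\<close>, and \<open>p\<close> the error in \<open>w\<close>, the numerator
  is \<open>S w y - E p \<delta>\<close> and the denominator \<open>S w x - E p \<epsilon>\<close>. Hence the error of the estimator is
  \<open>(S w \<eta> - E p \<eta>) / (S w x - E p \<epsilon>)\<close>. If \<open>a\<close> is the coefficient of \<open>\<xi>\<close> in \<open>w\<close>, then the denominator,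
  divided by \<open>l\<^sup>2\<close>, tends in probability to a multiple \<open>a K\<close> with \<open>K > 0\<close>, and the numerator is, up to a
  negligible term, the mean of the independent scores \<open>a (\<xi> i - c m) \<eta> i + (p i \<eta> i - E p \<eta>)\<close>. For the
  intercept, its error equals the mean of the \<open>\<eta> i\<close> minus the mean of the \<open>x i\<close> times the error of the slope.
  So everything reduces to the joint behaviour of the normed sums of scores and of residuals (theorem
  \<open>quotient_estimator_limits\<close>).

  If \<open>\<xi>\<close> has finite variance, then \<open>l\<close> is constant and the classical central limit theorem applies to
  linear combinations of scores and residuals. Their variances are positive because \<open>\<xi> - m\<close> is centred and
  independent of the errors, so that its product with \<open>\<eta>\<close> is uncorrelated with everything else.

  If \<open>\<xi>\<close> has infinite variance, then \<open>l\<close> tends to infinity, and only two facts about \<open>\<xi>\<close> are needed, with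
  \<open>b n = sqrt n * l n\<close>: the sum of the \<open>(\<xi> i)\<^sup>2\<close>, divided by \<open>(b n)\<^sup>2\<close>, tends to 1 in probability, and the sum of
  the \<open>\<xi> i \<eta> i\<close>, divided by \<open>b n\<close>, is asymptotically normal. The other parts of the scores are of order \<open>sqrt n\<close>
  and vanish after division by \<open>b n\<close>; the slope converges so fast that it does not affect the intercept.

  Both facts follow from the limit of \<open>n (1 - E exp (- s \<xi>\<^sup>2 / (b n)\<^sup>2))\<close>, which is \<open>s\<close> (theorem
  \<open>normal_attraction_laplace_limit\<close>). To get it from the central limit theorem assumed for \<open>\<xi>\<close>, let \<open>\<phi>\<close> be the
  characteristic function of \<open>\<xi>\<close>. The assumption says that \<open>|\<phi> (t / b n)|\<close> to the power \<open>n\<close> tends to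
  \<open>exp (- t\<^sup>2 / 2)\<close>. Because the variance is infinite, the imaginary part of \<open>\<phi>\<close> is negligible near 0, and
  therefore \<open>n (1 - Re (\<phi> (t / b n)))\<close> tends to \<open>t\<^sup>2 / 2\<close>. Tightness together with
  \<open>1 - cos (2 y) \<le> 4 (1 - cos y)\<close> bounds these functions of \<open>t\<close> by a multiple of \<open>1 + t\<^sup>2\<close>. As
  \<open>exp (- s y\<^sup>2)\<close> is a Gaussian average of \<open>cos (t y)\<close>, integrating \<open>t\<close> against a normal law gives the claim.
\<close>

section \<open>Convergence and boundedness in probability\<close>

text \<open>The event on which a random quantity misbehaves is covered by a measurable set of small
  measure. With this formulation stochastic \<open>o(1)\<close> and \<open>O(1)\<close> statements can be manipulated
  pointwise off an exceptional set, without measurability side conditions.\<close>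

definition off_small_set :: "'a measure \<Rightarrow> real \<Rightarrow> ('a \<Rightarrow> bool) \<Rightarrow> bool" where
  "off_small_set M e P \<longleftrightarrow> (\<exists>A\<in>sets M. measure M A < e \<and> (\<forall>\<omega>\<in>space M - A. P \<omega>))"

definition whp :: "'a measure \<Rightarrow> (nat \<Rightarrow> 'a \<Rightarrow> bool) \<Rightarrow> bool" where
  "whp M P \<longleftrightarrow> (\<forall>e>0. \<forall>\<^sub>F n in sequentially. off_small_set M e (P n))"

definition prob_null :: "'a measure \<Rightarrow> (nat \<Rightarrow> 'a \<Rightarrow> real) \<Rightarrow> bool" where
  "prob_null M X \<longleftrightarrow> (\<forall>r>0. whp M (\<lambda>n \<omega>. \<bar>X n \<omega>\<bar> < r))"

text \<open>Tightness of the sequence, up to finitely many of its members.\<close>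

definition prob_bounded :: "'a measure \<Rightarrow> (nat \<Rightarrow> 'a \<Rightarrow> real) \<Rightarrow> bool" where
  "prob_bounded M X \<longleftrightarrow>
     (\<forall>e>0. \<exists>K. \<forall>\<^sub>F n in sequentially. off_small_set M e (\<lambda>\<omega>. \<bar>X n \<omega>\<bar> \<le> K))"

lemma off_small_set_mono:
  assumes "off_small_set M e P" "\<And>\<omega>. \<omega> \<in> space M \<Longrightarrow> P \<omega> \<Longrightarrow> Q \<omega>"
  shows "off_small_set M e Q"
  using assms unfolding off_small_set_def by blast

lemma off_small_set_UNIV:
  assumes "\<And>\<omega>. \<omega> \<in> space M \<Longrightarrow> P \<omega>" "e > 0"
  shows "off_small_set M e P"
  using assms unfolding off_small_set_def by (intro bexI[of _ "{}"]) auto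

lemma whp_mono:
  assumes "whp M P" and "\<forall>\<^sub>F n in sequentially. \<forall>\<omega>\<in>space M. P n \<omega> \<longrightarrow> Q n \<omega>"
  shows "whp M Q"
  unfolding whp_def
proof (intro allI impI)
  fix e :: real assume "e > 0"
  then have "\<forall>\<^sub>F n in sequentially. off_small_set M e (P n)"
    using assms(1) unfolding whp_def by blast
  with assms(2) show "\<forall>\<^sub>F n in sequentially. off_small_set M e (Q n)"
    by eventually_elim (erule off_small_set_mono, blast)
qed

context prob_space
begin

lemma off_small_set_conj:
  assumes "off_small_set M (e / 2) P" "off_small_set M (e / 2) Q"
  shows "off_small_set M e (\<lambda>\<omega>. P \<omega> \<and> Q \<omega>)"
proof -
  obtain A B where "A \<in> events" "prob A < e / 2" "\<forall>\<omega>\<in>space M - A. P \<omega>"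
    "B \<in> events" "prob B < e / 2" "\<forall>\<omega>\<in>space M - B. Q \<omega>"
    using assms unfolding off_small_set_def by blast
  then show ?thesis
    using measure_Un_le[of A M B] unfolding off_small_set_def by (intro bexI[of _ "A \<union> B"]) auto
qed

lemma off_small_set_Markov:
  assumes "integrable M Y" "\<And>\<omega>. \<omega> \<in> space M \<Longrightarrow> 0 \<le> Y \<omega>" "r > 0" "expectation Y < e * r"
  shows "off_small_set M e (\<lambda>\<omega>. \<bar>Y \<omega>\<bar> < r)"
proof -
  have [measurable]: "Y \<in> borel_measurable M" using assms(1) by (rule borel_measurable_integrable)
  have "prob {\<omega>\<in>space M. r \<le> Y \<omega>} \<le> expectation Y / r"
    using assms by (intro integral_Markov_inequality_measure[where A="{}"]) auto
  also have "\<dots> < e" using assms(3,4) by (simp add: pos_divide_less_eq)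
  finally show ?thesis
    unfolding off_small_set_def
    using assms(2) by (intro bexI[of _ "{\<omega>\<in>space M. r \<le> Y \<omega>}"]) auto
qed

lemma whp_conj:
  assumes "whp M P" "whp M Q"
  shows "whp M (\<lambda>n \<omega>. P n \<omega> \<and> Q n \<omega>)"
  unfolding whp_def
proof (intro allI impI)
  fix e :: real assume "e > 0"
  then have "e / 2 > 0" by simp
  then have "\<forall>\<^sub>F n in sequentially. off_small_set M (e / 2) (P n)"
    "\<forall>\<^sub>F n in sequentially. off_small_set M (e / 2) (Q n)"
    using assms unfolding whp_def by blast+
  then show "\<forall>\<^sub>F n in sequentially. off_small_set M e (\<lambda>\<omega>. P n \<omega> \<and> Q n \<omega>)"
    by eventually_elim (rule off_small_set_conj)
qed

lemma prob_null_dominated_whp: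
  assumes "prob_null M X" and "whp M (\<lambda>n \<omega>. \<bar>Y n \<omega>\<bar> \<le> \<bar>X n \<omega>\<bar>)"
  shows "prob_null M Y"
  unfolding prob_null_def
proof (intro allI impI)
  fix r :: real assume "r > 0"
  then have "whp M (\<lambda>n \<omega>. \<bar>X n \<omega>\<bar> < r)" using assms(1) by (simp add: prob_null_def)
  from whp_conj[OF this assms(2)] show "whp M (\<lambda>n \<omega>. \<bar>Y n \<omega>\<bar> < r)"
    by (rule whp_mono) auto
qed

lemma prob_null_dominated:
  assumes "prob_null M X" and "\<forall>\<^sub>F n in sequentially. \<forall>\<omega>\<in>space M. \<bar>Y n \<omega>\<bar> \<le> \<bar>X n \<omega>\<bar>"
  shows "prob_null M Y"
proof (rule prob_null_dominated_whp[OF assms(1)])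
  have "whp M (\<lambda>n \<omega>. True)" unfolding whp_def by (auto intro!: always_eventually off_small_set_UNIV)
  then show "whp M (\<lambda>n \<omega>. \<bar>Y n \<omega>\<bar> \<le> \<bar>X n \<omega>\<bar>)" by (rule whp_mono) (use assms(2) in simp)
qed

lemma prob_null_cong_eventually:
  assumes "prob_null M X" and "\<And>n \<omega>. n \<ge> 1 \<Longrightarrow> \<omega> \<in> space M \<Longrightarrow> Y n \<omega> = X n \<omega>"
  shows "prob_null M Y"
  by (rule prob_null_dominated[OF assms(1)]) (use assms(2) in \<open>auto intro!: eventually_sequentiallyI[of 1]\<close>)

lemma prob_null_add:
  assumes "prob_null M X" "prob_null M Y"
  shows "prob_null M (\<lambda>n \<omega>. X n \<omega> + Y n \<omega>)"
  unfolding prob_null_def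
proof (intro allI impI)
  fix r :: real assume "r > 0"
  then have "whp M (\<lambda>n \<omega>. \<bar>X n \<omega>\<bar> < r/2)" "whp M (\<lambda>n \<omega>. \<bar>Y n \<omega>\<bar> < r/2)"
    using assms half_gt_zero unfolding prob_null_def by blast+
  from whp_conj[OF this] show "whp M (\<lambda>n \<omega>. \<bar>X n \<omega> + Y n \<omega>\<bar> < r)"
    by (rule whp_mono) (auto intro!: always_eventually)
qed

lemma prob_null_minus: "prob_null M X \<Longrightarrow> prob_null M (\<lambda>n \<omega>. - X n \<omega>)"
  by (simp add: prob_null_def)

lemma prob_null_diff:
  "prob_null M X \<Longrightarrow> prob_null M Y \<Longrightarrow> prob_null M (\<lambda>n \<omega>. X n \<omega> - Y n \<omega>)"
  using prob_null_add[of X "\<lambda>n \<omega>. - Y n \<omega>"] prob_null_minus[of Y] by simp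

lemma prob_null_const:
  assumes "f \<longlonglongrightarrow> 0"
  shows "prob_null M (\<lambda>n \<omega>. f n)"
  unfolding prob_null_def whp_def
proof (intro allI impI)
  fix r e :: real assume "r > 0" "e > 0"
  from \<open>r > 0\<close> have "\<forall>\<^sub>F n in sequentially. \<bar>f n\<bar> < r"
    using assms tendsto_iff[of f 0 sequentially] by (simp add: dist_real_def)
  then show "\<forall>\<^sub>F n in sequentially. off_small_set M e (\<lambda>\<omega>. \<bar>f n\<bar> < r)"
    by eventually_elim (rule off_small_set_UNIV[OF _ \<open>e > 0\<close>])
qed

lemma prob_bounded_const:
  assumes "f \<longlonglongrightarrow> c"
  shows "prob_bounded M (\<lambda>n \<omega>. f n)"
proof -
  obtain K where "\<And>n. \<bar>f n\<bar> \<le> K"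
    using convergent_imp_Bseq[of f] assms by (auto simp: convergent_def Bseq_def)
  then show ?thesis
    unfolding prob_bounded_def by (auto intro!: exI[of _ K] always_eventually off_small_set_UNIV)
qed

lemma prob_bounded_mult:
  assumes "prob_bounded M X" "prob_bounded M Y"
  shows "prob_bounded M (\<lambda>n \<omega>. X n \<omega> * Y n \<omega>)"
  unfolding prob_bounded_def
proof (intro allI impI)
  fix e :: real assume "e > 0"
  then have e: "e / 2 > 0" by simp
  obtain K L where
    "\<forall>\<^sub>F n in sequentially. off_small_set M (e / 2) (\<lambda>\<omega>. \<bar>X n \<omega>\<bar> \<le> K)"
    "\<forall>\<^sub>F n in sequentially. off_small_set M (e / 2) (\<lambda>\<omega>. \<bar>Y n \<omega>\<bar> \<le> L)"
    using assms e unfolding prob_bounded_def by blast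
  then have "\<forall>\<^sub>F n in sequentially. off_small_set M e (\<lambda>\<omega>. \<bar>X n \<omega> * Y n \<omega>\<bar> \<le> K * L)"
  proof eventually_elim
    case (elim n)
    show ?case
      by (rule off_small_set_mono[OF off_small_set_conj[OF elim]])
        (auto simp: abs_mult intro!: mult_mono' abs_ge_zero)
  qed
  then show "\<exists>K. \<forall>\<^sub>F n in sequentially. off_small_set M e (\<lambda>\<omega>. \<bar>X n \<omega> * Y n \<omega>\<bar> \<le> K)"
    by blast
qed

lemma prob_null_mult:
  assumes "prob_null M X" "prob_bounded M Y"
  shows "prob_null M (\<lambda>n \<omega>. X n \<omega> * Y n \<omega>)"
  unfolding prob_null_def whp_def
proof (intro allI impI)
  fix r e :: real assume r: "r > 0" and "e > 0"
  then have e: "e / 2 > 0" by simp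
  obtain K where K: "\<forall>\<^sub>F n in sequentially. off_small_set M (e / 2) (\<lambda>\<omega>. \<bar>Y n \<omega>\<bar> \<le> K)"
    using assms(2) e unfolding prob_bounded_def by blast
  define L where "L = \<bar>K\<bar> + 1"
  have L: "L > 0" "K \<le> L" by (auto simp: L_def)
  have "\<forall>\<^sub>F n in sequentially. off_small_set M (e / 2) (\<lambda>\<omega>. \<bar>X n \<omega>\<bar> < r / L)"
    using assms(1) e divide_pos_pos[OF r L(1)] unfolding prob_null_def whp_def by blast
  with K show "\<forall>\<^sub>F n in sequentially. off_small_set M e (\<lambda>\<omega>. \<bar>X n \<omega> * Y n \<omega>\<bar> < r)"
  proof eventually_elim
    case (elim n)
    show ?case
    proof (rule off_small_set_mono[OF off_small_set_conj[OF elim]])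
      fix \<omega> assume XY: "\<bar>Y n \<omega>\<bar> \<le> K \<and> \<bar>X n \<omega>\<bar> < r / L"
      have "\<bar>X n \<omega>\<bar> * \<bar>Y n \<omega>\<bar> \<le> \<bar>X n \<omega>\<bar> * L"
        using XY L by (intro mult_left_mono) auto
      also have "\<dots> < r" using XY L by (simp add: pos_less_divide_eq)
      finally show "\<bar>X n \<omega> * Y n \<omega>\<bar> < r" by (simp add: abs_mult)
    qed
  qed
qed

lemma prob_null_cmult: "prob_null M X \<Longrightarrow> prob_null M (\<lambda>n \<omega>. (c::real) * X n \<omega>)"
  using prob_null_mult[of X "\<lambda>n \<omega>. c"] prob_bounded_const[of "\<lambda>_. c" c]
  by (simp add: mult.commute)

lemma prob_bounded_add_null:
  assumes "prob_bounded M X" "prob_null M (\<lambda>n \<omega>. Y n \<omega> - X n \<omega>)"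
  shows "prob_bounded M Y"
  unfolding prob_bounded_def
proof (intro allI impI)
  fix e :: real assume "e > 0"
  then have e: "e / 2 > 0" by simp
  obtain K where "\<forall>\<^sub>F n in sequentially. off_small_set M (e / 2) (\<lambda>\<omega>. \<bar>X n \<omega>\<bar> \<le> K)"
    using assms(1) e unfolding prob_bounded_def by blast
  moreover have "\<forall>\<^sub>F n in sequentially. off_small_set M (e / 2) (\<lambda>\<omega>. \<bar>Y n \<omega> - X n \<omega>\<bar> < 1)"
    using assms(2) e zero_less_one unfolding prob_null_def whp_def by blast
  ultimately have "\<forall>\<^sub>F n in sequentially. off_small_set M e (\<lambda>\<omega>. \<bar>Y n \<omega>\<bar> \<le> K + 1)"
    by eventually_elim (rule off_small_set_mono, erule (1) off_small_set_conj, linarith)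
  then show "\<exists>K. \<forall>\<^sub>F n in sequentially. off_small_set M e (\<lambda>\<omega>. \<bar>Y n \<omega>\<bar> \<le> K)" by blast
qed

lemma prob_bounded_tendsto:
  assumes "prob_null M (\<lambda>n \<omega>. X n \<omega> - a)"
  shows "prob_bounded M X"
  by (rule prob_bounded_add_null[OF prob_bounded_const[OF tendsto_const] assms])

lemma prob_null_continuous:
  assumes "prob_null M (\<lambda>n \<omega>. X n \<omega> - a)" "isCont f (a::real)"
  shows "prob_null M (\<lambda>n \<omega>. f (X n \<omega>) - (f a :: real))"
  unfolding prob_null_def
proof (intro allI impI)
  fix r :: real assume "r > 0"
  then obtain d where d: "d > 0" "\<And>x. \<bar>x - a\<bar> < d \<Longrightarrow> \<bar>f x - f a\<bar> < r"
    using assms(2) unfolding continuous_at_eps_delta by (auto simp: dist_real_def)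
  have "whp M (\<lambda>n \<omega>. \<bar>X n \<omega> - a\<bar> < d)" using assms(1) d(1) by (simp add: prob_null_def)
  then show "whp M (\<lambda>n \<omega>. \<bar>f (X n \<omega>) - f a\<bar> < r)"
    by (rule whp_mono) (use d(2) in auto)
qed

lemma prob_tendsto_mult:
  assumes "prob_null M (\<lambda>n \<omega>. X n \<omega> - a)" "prob_null M (\<lambda>n \<omega>. Y n \<omega> - b)"
  shows "prob_null M (\<lambda>n \<omega>. X n \<omega> * Y n \<omega> - a * b)"
proof -
  have "prob_null M (\<lambda>n \<omega>. (X n \<omega> - a) * Y n \<omega> + a * (Y n \<omega> - b))"
    using assms by (intro prob_null_add prob_null_mult prob_null_cmult prob_bounded_tendsto[OF assms(2)])
  then show ?thesis by (simp add: algebra_simps)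
qed

lemma whp_pos:
  assumes "prob_null M (\<lambda>n \<omega>. X n \<omega> - a)" "a > 0"
  shows "whp M (\<lambda>n \<omega>. X n \<omega> > 0)"
proof -
  have "whp M (\<lambda>n \<omega>. \<bar>X n \<omega> - a\<bar> < a)" using assms by (simp add: prob_null_def)
  then show ?thesis by (rule whp_mono) (auto intro!: always_eventually)
qed

lemma whp_nonzero:
  assumes "prob_null M (\<lambda>n \<omega>. X n \<omega> - a)" "a \<noteq> 0"
  shows "whp M (\<lambda>n \<omega>. X n \<omega> \<noteq> 0)"
proof -
  have "whp M (\<lambda>n \<omega>. \<bar>X n \<omega> - a\<bar> < \<bar>a\<bar>)" using assms by (simp add: prob_null_def)
  then show ?thesis by (rule whp_mono) (auto intro!: always_eventually)
qed

lemma prob_null_expectation: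
  assumes "\<And>n. integrable M (Y n)" "\<And>n \<omega>. \<omega> \<in> space M \<Longrightarrow> 0 \<le> Y n \<omega>"
    and "(\<lambda>n. expectation (Y n)) \<longlonglongrightarrow> 0"
  shows "prob_null M Y"
  unfolding prob_null_def whp_def
proof (intro allI impI)
  fix r e :: real assume r: "r > 0" and "e > 0"
  then have "\<forall>\<^sub>F n in sequentially. expectation (Y n) < e * r"
    using assms(3) by (intro order_tendstoD(2)[of _ 0]) auto
  then show "\<forall>\<^sub>F n in sequentially. off_small_set M e (\<lambda>\<omega>. \<bar>Y n \<omega>\<bar> < r)"
    by eventually_elim (rule off_small_set_Markov[OF assms(1,2) r])
qed

text \<open>Chebyshev's inequality.\<close>

lemma prob_bounded_second_moment:
  assumes int: "\<And>n. integrable M (\<lambda>\<omega>. (Y n \<omega>)\<^sup>2)" and C: "\<And>n. expectation (\<lambda>\<omega>. (Y n \<omega>)\<^sup>2) \<le> C"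
  shows "prob_bounded M Y"
  unfolding prob_bounded_def
proof (intro allI impI)
  fix e :: real assume e: "e > 0"
  define r where "r = (\<bar>C\<bar> + 1) / e"
  have r: "r > 0" "e * r = \<bar>C\<bar> + 1" using e by (simp_all add: r_def)
  have "off_small_set M e (\<lambda>\<omega>. \<bar>Y n \<omega>\<bar> \<le> sqrt r)" for n
  proof (rule off_small_set_mono[OF off_small_set_Markov[OF int _ r(1)]])
    show "expectation (\<lambda>\<omega>. (Y n \<omega>)\<^sup>2) < e * r" unfolding r(2) using C[of n] by linarith
    show "\<bar>Y n \<omega>\<bar> \<le> sqrt r" if "\<bar>(Y n \<omega>)\<^sup>2\<bar> < r" for \<omega>
      using that by (simp add: real_le_rsqrt)
  qed simp
  then show "\<exists>K. \<forall>\<^sub>F n in sequentially. off_small_set M e (\<lambda>\<omega>. \<bar>Y n \<omega>\<bar> \<le> K)"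
    by (intro exI[of _ "sqrt r"] always_eventually) simp
qed

end

section \<open>Weak convergence to a normal law\<close>

lemma normal_distribution_eq_distr:
  assumes "s > 0"
  shows "density lborel (normal_density 0 s) = distr std_normal_distribution borel (\<lambda>x. s * x)"
proof -
  interpret N: prob_space std_normal_distribution by (rule prob_space_normal_density) simp
  have "distributed std_normal_distribution lborel (\<lambda>x. x) (normal_density 0 1)"
    unfolding distributed_def by (auto intro!: distr_id2 measurable_ident_sets)
  from N.normal_density_affine[OF this, of s 0] assms
  have "distributed std_normal_distribution lborel (\<lambda>x. s * x) (normal_density 0 s)"
    by simp
  then have "distr std_normal_distribution lborel (\<lambda>x. s * x) = density lborel (normal_density 0 s)"
    by (rule distributed_distr_eq_density)
  then show ?thesis by (simp cong: distr_cong)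
qed

lemma real_distribution_normal:
  "s > 0 \<Longrightarrow> real_distribution (density lborel (normal_density 0 s))"
  using prob_space_normal_density by (auto simp: real_distribution_def real_distribution_axioms_def)

lemma char_normal:
  assumes "v > 0"
  shows "char (density lborel (normal_density 0 (sqrt v))) t = complex_of_real (exp (- v * t\<^sup>2 / 2))"
proof -
  have "char (density lborel (normal_density 0 (sqrt v))) t = char std_normal_distribution (t * sqrt v)"
    using assms by (subst normal_distribution_eq_distr) (simp_all add: char_def integral_distr mult.assoc)
  then show ?thesis
    using assms by (simp add: char_std_normal_distribution power_mult_distrib mult.commute)
qed

lemma cmod_iexp_diff_le: "cmod (iexp a - iexp b) \<le> \<bar>a - b\<bar>"
proof -
  have "iexp a - iexp b = iexp b * (iexp (a - b) - 1)"
    by (simp add: exp_diff field_simps exp_minus)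
  moreover have "cmod (iexp (a - b) - 1) \<le> \<bar>a - b\<bar>"
    using iexp_approx1[of "a - b" 0] by simp
  ultimately show ?thesis by (simp add: norm_mult)
qed

lemma (in real_distribution) truncated_mean_small:
  assumes "e > 0"
  shows "\<exists>\<tau>>0. (\<integral>x. min 1 (\<tau> * \<bar>x\<bar>) \<partial>M) < e"
proof -
  have "(\<lambda>k. \<integral>x. min 1 (inverse (real (Suc k)) * \<bar>x\<bar>) \<partial>M) \<longlonglongrightarrow> (\<integral>x. 0 \<partial>M)"
  proof (rule integral_dominated_convergence[where w="\<lambda>_. 1"])
    have "(\<lambda>k. min 1 (inverse (real (Suc k)) * \<bar>x\<bar>)) \<longlonglongrightarrow> min 1 (0 * \<bar>x\<bar>)" for x :: real
      by (intro tendsto_intros LIMSEQ_inverse_real_of_nat)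
    then show "AE x in M. (\<lambda>k. min 1 (inverse (real (Suc k)) * \<bar>x\<bar>)) \<longlonglongrightarrow> 0" by simp
  qed auto
  then have "\<forall>\<^sub>F k in sequentially. (\<integral>x. min 1 (inverse (real (Suc k)) * \<bar>x\<bar>) \<partial>M) < e"
    using assms by (intro order_tendstoD) auto
  then obtain k where "(\<integral>x. min 1 (inverse (real (Suc k)) * \<bar>x\<bar>) \<partial>M) < e"
    by (auto simp: eventually_sequentially)
  then show ?thesis by (intro exI[of _ "inverse (real (Suc k))"]) simp
qed

context prob_space
begin

lemma char_distr_eq:
  assumes [measurable]: "X \<in> borel_measurable M"
  shows "char (distr M borel X) t = (CLINT \<omega>|M. iexp (t * X \<omega>))"
  unfolding char_def by (subst integral_distr) auto

lemma tends_to_normal_iff_char: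
  assumes "v > 0" and "\<And>n. Z n \<in> borel_measurable M"
  shows "tends_to_normal M Z v \<longleftrightarrow>
    (\<forall>t. (\<lambda>n. char (distr M borel (Z n)) t) \<longlonglongrightarrow> complex_of_real (exp (- v * t\<^sup>2 / 2)))"
proof -
  have N: "real_distribution (density lborel (normal_density 0 (sqrt v)))"
    using assms by (intro real_distribution_normal) simp
  have Z: "real_distribution (distr M borel (Z n))" for n
    using assms by (intro real_distribution_distr)
  show ?thesis
    unfolding tends_to_normal_def char_normal[OF assms(1), symmetric]
  proof (intro iffI allI)
    show "(\<lambda>n. char (distr M borel (Z n)) t) \<longlonglongrightarrow> char (density lborel (normal_density 0 (sqrt v))) t"
      if "weak_conv_m (\<lambda>n. distr M borel (Z n)) (density lborel (normal_density 0 (sqrt v)))" for t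
      by (rule levy_continuity1[OF Z N that])
    show "weak_conv_m (\<lambda>n. distr M borel (Z n)) (density lborel (normal_density 0 (sqrt v)))"
      if "\<forall>t. (\<lambda>n. char (distr M borel (Z n)) t) \<longlonglongrightarrow> char (density lborel (normal_density 0 (sqrt v))) t"
      by (rule levy_continuity[OF Z N that[rule_format]])
  qed
qed

text \<open>Bounded continuous test functions transfer the tightness of the normal law to the sequence.\<close>

lemma tends_to_normal_tight:
  assumes "tends_to_normal M Z v" "v > 0" and [measurable]: "\<And>n. Z n \<in> borel_measurable M" and "e > 0"
  shows "\<exists>\<tau>>0. \<forall>\<^sub>F n in sequentially. expectation (\<lambda>\<omega>. min 1 (\<tau> * \<bar>Z n \<omega>\<bar>)) < e"
proof -
  let ?N = "density lborel (normal_density 0 (sqrt v))"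
  have N: "real_distribution ?N"
    using assms(2) by (intro real_distribution_normal) simp
  obtain \<tau> where \<tau>: "\<tau> > 0" and k: "(\<integral>x. min 1 (\<tau> * \<bar>x\<bar>) \<partial>?N) < e"
    using real_distribution.truncated_mean_small[OF N \<open>e > 0\<close>] by (elim exE conjE) (rule that)
  have "(\<lambda>n. \<integral>x. min 1 (\<tau> * \<bar>x\<bar>) \<partial>distr M borel (Z n)) \<longlonglongrightarrow> (\<integral>x. min 1 (\<tau> * \<bar>x\<bar>) \<partial>?N)"
  proof (rule weak_conv_imp_integral_bdd_continuous_conv[where B=1])
    show "real_distribution (distr M borel (Z n))" for n by (rule real_distribution_distr) measurable
    show "weak_conv_m (\<lambda>n. distr M borel (Z n)) ?N" using assms(1) by (simp only: tends_to_normal_def)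
    show "isCont (\<lambda>x. min 1 (\<tau> * \<bar>x\<bar>)) x" for x by (intro continuous_intros)
    show "norm (min 1 (\<tau> * \<bar>x\<bar>)) \<le> 1" for x using \<tau> by simp
  qed (rule N)
  then have "\<forall>\<^sub>F n in sequentially. (\<integral>x. min 1 (\<tau> * \<bar>x\<bar>) \<partial>distr M borel (Z n)) < e"
    using k by (rule order_tendstoD)
  then show ?thesis
    using \<tau> by (intro exI[of _ \<tau>]) (simp add: integral_distr)
qed

lemma tends_to_normal_bounded:
  assumes "tends_to_normal M Z v" "v > 0" and [measurable]: "\<And>n. Z n \<in> borel_measurable M"
  shows "prob_bounded M Z"
  unfolding prob_bounded_def
proof (intro allI impI)
  fix e :: real assume "e > 0"
  then obtain \<tau> where \<tau>: "\<tau> > 0"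
    "\<forall>\<^sub>F n in sequentially. expectation (\<lambda>\<omega>. min 1 (\<tau> * \<bar>Z n \<omega>\<bar>)) < e"
    using tends_to_normal_tight[OF assms \<open>e > 0\<close>] by (elim exE conjE) (rule that)
  from \<tau>(2) have "\<forall>\<^sub>F n in sequentially. off_small_set M e (\<lambda>\<omega>. \<bar>Z n \<omega>\<bar> \<le> 1 / \<tau>)"
  proof eventually_elim
    case (elim n)
    show ?case
    proof (rule off_small_set_mono)
      show "off_small_set M e (\<lambda>\<omega>. \<bar>min 1 (\<tau> * \<bar>Z n \<omega>\<bar>)\<bar> < 1)"
        using \<tau>(1) elim
        by (intro off_small_set_Markov) (auto intro!: integrable_const_bound[where B=1])
      show "\<bar>Z n \<omega>\<bar> \<le> 1 / \<tau>" if "\<bar>min 1 (\<tau> * \<bar>Z n \<omega>\<bar>)\<bar> < 1" for \<omega>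
        using that \<tau>(1) by (simp add: pos_le_divide_eq mult.commute split: if_splits)
    qed
  qed
  then show "\<exists>K. \<forall>\<^sub>F n in sequentially. off_small_set M e (\<lambda>\<omega>. \<bar>Z n \<omega>\<bar> \<le> K)" by blast
qed

text \<open>Slutsky's lemma: off an event of small probability the two characteristic functions integrate
  values that are uniformly close.\<close>

lemma tends_to_normal_add_null:
  assumes Z: "tends_to_normal M Z v" and "v > 0"
    and meas[measurable]: "\<And>n. Z n \<in> borel_measurable M" "\<And>n. W n \<in> borel_measurable M"
    and null: "prob_null M (\<lambda>n \<omega>. W n \<omega> - Z n \<omega>)"
  shows "tends_to_normal M W v"
proof -
  have "(\<lambda>n. char (distr M borel (W n)) t - char (distr M borel (Z n)) t) \<longlonglongrightarrow> 0" for t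
  proof (rule LIMSEQ_I)
    fix r :: real assume r: "r > 0"
    define e where "e = r / (3 + \<bar>t\<bar>)"
    have e: "e > 0" using r by (simp add: e_def add_pos_nonneg)
    have "\<bar>t\<bar> * e + 3 * e = r"
      using abs_ge_zero[of t] by (simp add: e_def add_divide_distrib[symmetric] distrib_right[symmetric] add.commute)
    then have er: "\<bar>t\<bar> * e + 2 * e < r" using e by simp
    have "\<forall>\<^sub>F n in sequentially. off_small_set M e (\<lambda>\<omega>. \<bar>W n \<omega> - Z n \<omega>\<bar> < e)"
      using null e unfolding prob_null_def whp_def by blast
    then have "\<forall>\<^sub>F n in sequentially. norm (char (distr M borel (W n)) t - char (distr M borel (Z n)) t - 0) < r"
    proof eventually_elim
      case (elim n)
      then obtain A where A[measurable]: "A \<in> events" and "prob A < e" "\<forall>\<omega>\<in>space M - A. \<bar>W n \<omega> - Z n \<omega>\<bar> < e"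
        unfolding off_small_set_def by blast
      note A = this
      \<comment> \<open>\<open>|iexp a - iexp b|\<close> is at most \<open>|a - b|\<close>, used off \<open>A\<close>, and at most 2, used on \<open>A\<close>\<close>
      have int: "integrable M (\<lambda>\<omega>. iexp (t * W n \<omega>))" "integrable M (\<lambda>\<omega>. iexp (t * Z n \<omega>))"
        by (rule integrable_const_bound[where B=1]; simp del: of_real_mult)+
      have "char (distr M borel (W n)) t - char (distr M borel (Z n)) t
          = (CLINT \<omega>|M. iexp (t * W n \<omega>) - iexp (t * Z n \<omega>))"
        using int by (simp add: char_distr_eq)
      then have "norm (char (distr M borel (W n)) t - char (distr M borel (Z n)) t)
          \<le> expectation (\<lambda>\<omega>. cmod (iexp (t * W n \<omega>) - iexp (t * Z n \<omega>)))"
        by (simp only: integral_norm_bound)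
      also have "\<dots> \<le> expectation (\<lambda>\<omega>. \<bar>t\<bar> * e + 2 * indicator A \<omega>)"
      proof (rule integral_mono)
        fix \<omega> assume \<omega>: "\<omega> \<in> space M"
        have 1: "cmod (iexp (t * W n \<omega>) - iexp (t * Z n \<omega>)) \<le> 2"
          by (rule order_trans[OF norm_triangle_ineq4]) (simp del: of_real_mult)
        have 2: "cmod (iexp (t * W n \<omega>) - iexp (t * Z n \<omega>)) \<le> \<bar>t\<bar> * \<bar>W n \<omega> - Z n \<omega>\<bar>"
          using cmod_iexp_diff_le[of "t * W n \<omega>" "t * Z n \<omega>"]
          by (simp add: abs_mult right_diff_distrib[symmetric] del: of_real_mult)
        show "cmod (iexp (t * W n \<omega>) - iexp (t * Z n \<omega>)) \<le> \<bar>t\<bar> * e + 2 * indicator A \<omega>"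
        proof (cases "\<omega> \<in> A")
          case True
          have "0 \<le> \<bar>t\<bar> * e" using e by simp
          then show ?thesis using True 1 by simp
        next
          case False
          then have "\<bar>t\<bar> * \<bar>W n \<omega> - Z n \<omega>\<bar> \<le> \<bar>t\<bar> * e"
            using A \<omega> by (intro mult_left_mono) (auto simp: less_imp_le)
          then show ?thesis using False 2 by simp
        qed
      next
        show "integrable M (\<lambda>\<omega>. cmod (iexp (t * W n \<omega>) - iexp (t * Z n \<omega>)))"
          by (intro integrable_norm Bochner_Integration.integrable_diff int)
        show "integrable M (\<lambda>\<omega>. \<bar>t\<bar> * e + 2 * indicator A \<omega>)"
          by (intro integrable_const_bound[where B="\<bar>t\<bar> * e + 2"])
             (use e in \<open>simp_all add: indicator_def\<close>)
      qed
      also have "\<dots> = \<bar>t\<bar> * e + 2 * prob A"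
        using A(1) by (subst Bochner_Integration.integral_add) (auto simp: prob_space integrable_real_indicator emeasure_eq_measure)
      also have "\<dots> < r" using A(2) er by linarith
      finally show ?case by (simp only: diff_0_right)
    qed
    then show "\<exists>N. \<forall>n\<ge>N. norm (char (distr M borel (W n)) t - char (distr M borel (Z n)) t - 0) < r"
      by (simp add: eventually_sequentially)
  qed
  note diff = this
  show ?thesis
    unfolding tends_to_normal_iff_char[OF assms(2) meas(2)]
  proof
    fix t
    have "(\<lambda>n. char (distr M borel (Z n)) t) \<longlonglongrightarrow> complex_of_real (exp (- v * t\<^sup>2 / 2))"
      using Z unfolding tends_to_normal_iff_char[OF assms(2) meas(1)] by blast
    from tendsto_add[OF diff[of t] this]
    show "(\<lambda>n. char (distr M borel (W n)) t) \<longlonglongrightarrow> complex_of_real (exp (- v * t\<^sup>2 / 2))"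
      by simp
  qed
qed

lemma tends_to_normal_cmult:
  assumes "tends_to_normal M Z v" "v > 0" "c \<noteq> 0"
    and meas_Z[measurable]: "\<And>n. Z n \<in> borel_measurable M"
  shows "tends_to_normal M (\<lambda>n \<omega>. c * Z n \<omega>) (c\<^sup>2 * v)"
proof -
  have char: "char (distr M borel (\<lambda>\<omega>. c * Z n \<omega>)) t = char (distr M borel (Z n)) (t * c)" for n t
    by (subst (1 2) char_distr_eq) (simp_all add: mult.assoc)
  have v: "c\<^sup>2 * v > 0" using assms by simp
  have lim: "(\<lambda>n. char (distr M borel (Z n)) (t * c)) \<longlonglongrightarrow> complex_of_real (exp (- v * (t * c)\<^sup>2 / 2))" for t
    using assms(1) unfolding tends_to_normal_iff_char[OF assms(2) meas_Z] by (rule spec)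
  have e: "- (c\<^sup>2 * v) * t\<^sup>2 / 2 = - v * (t * c)\<^sup>2 / 2" for t by (simp add: power_mult_distrib)
  have meas: "(\<lambda>\<omega>. c * Z n \<omega>) \<in> borel_measurable M" for n by measurable
  show ?thesis
    unfolding tends_to_normal_iff_char[OF v meas] char e by (rule allI) (rule lim)
qed

end

section \<open>Sums of independent copies\<close>

lemma power_limit_exp:
  fixes x :: "nat \<Rightarrow> real"
  assumes "(\<lambda>n. real n * (1 - x n)) \<longlonglongrightarrow> a" "a \<ge> 0"
    and "\<And>n. 0 \<le> x n" "\<And>n. x n \<le> 1"
  shows "(\<lambda>n. x n ^ n) \<longlonglongrightarrow> exp (- a)"
proof -
  have "(\<lambda>n. x n ^ n - (1 + (- a) / real n) ^ n) \<longlonglongrightarrow> 0"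
  proof (rule Lim_null_comparison)
    obtain N where "max a 1 \<le> real N" using real_arch_simple by blast
    then have N: "real N \<ge> a" "N > 0" by auto
    show "\<forall>\<^sub>F n in sequentially. norm (x n ^ n - (1 + (- a) / real n) ^ n) \<le> \<bar>real n * (1 - x n) - a\<bar>"
    proof (rule eventually_sequentiallyI)
      fix n assume "n \<ge> N"
      then have n: "real n \<ge> a" "real n > 0" using N by auto
      have "norm (x n ^ n - (1 + (- a) / real n) ^ n) \<le> real n * norm (x n - (1 + (- a) / real n))"
        using assms n by (intro norm_power_diff) (auto simp: abs_le_iff field_simps)
      also have "\<dots> = \<bar>real n * (x n - (1 + (- a) / real n))\<bar>" by (simp add: abs_mult)
      also have "real n * (x n - (1 + (- a) / real n)) = - (real n * (1 - x n) - a)"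
        using n by (simp add: field_simps)
      also have "\<bar>\<dots>\<bar> = \<bar>real n * (1 - x n) - a\<bar>" by (rule abs_minus_cancel)
      finally show "norm (x n ^ n - (1 + (- a) / real n) ^ n) \<le> \<bar>real n * (1 - x n) - a\<bar>" .
    qed
    show "(\<lambda>n. \<bar>real n * (1 - x n) - a\<bar>) \<longlonglongrightarrow> 0"
      using assms(1) by (intro tendsto_rabs_zero) (simp add: LIM_zero_iff)
  qed
  from tendsto_add[OF this tendsto_exp_limit_sequentially[of "- a"]] show ?thesis
    by (simp only: diff_add_cancel add_0_left)
qed

lemma exp_difference_quotient:
  "(\<lambda>n. real n * (1 - exp (- x / real n))) \<longlonglongrightarrow> (x::real)"
proof -
  have "((\<lambda>h. exp (- x * h)) has_real_derivative (- x)) (at 0)"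
    by (auto intro!: derivative_eq_intros)
  then have lim: "((\<lambda>h. (exp (- x * h) - 1) / h) \<longlongrightarrow> - x) (at 0)"
    by (simp add: DERIV_def)
  have "(\<lambda>n. (exp (- x * (1 / real n)) - 1) / (1 / real n)) \<longlonglongrightarrow> - x"
    by (rule filterlim_compose[OF lim])
       (auto simp: filterlim_at eventually_sequentially intro!: lim_1_over_n exI[of _ 1])
  from tendsto_minus[OF this] show ?thesis by (simp add: field_simps)
qed

lemma iid_copies_measurable:
  assumes "prob_space M" "iid_copies M N X0 X"
  shows "X0 \<in> measurable M N" "i \<ge> 1 \<Longrightarrow> X i \<in> measurable M N"
proof -
  interpret prob_space M by fact
  show "X0 \<in> measurable M N" using assms(2) by (simp only: iid_copies_def)
  show "X i \<in> measurable M N" if "i \<ge> 1"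
    using assms(2) that unfolding iid_copies_def indep_vars_def2 by simp
qed

lemma iid_copies_compose:
  assumes "prob_space M" "iid_copies M N X0 X" and [measurable]: "f \<in> measurable N N'"
  shows "iid_copies M N' (\<lambda>\<omega>. f (X0 \<omega>)) (\<lambda>i \<omega>. f (X i \<omega>))"
proof -
  interpret prob_space M by fact
  note [measurable] = iid_copies_measurable[OF assms(1,2)]
  have "indep_vars (\<lambda>_. N') (\<lambda>i \<omega>. f (X i \<omega>)) {1..}"
    using assms(2) unfolding iid_copies_def by (auto intro: indep_vars_compose2)
  moreover have "distr M N' (\<lambda>\<omega>. f (X i \<omega>)) = distr M N' (\<lambda>\<omega>. f (X0 \<omega>))" if "i \<ge> 1" for i
  proof -
    note [measurable] = iid_copies_measurable(2)[OF assms(1,2) that]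
    have "distr M N' (\<lambda>\<omega>. f (X i \<omega>)) = distr (distr M N (X i)) N' f"
      by (subst distr_distr) (auto simp: comp_def)
    also have "\<dots> = distr (distr M N X0) N' f" using assms(2) that by (simp add: iid_copies_def)
    also have "\<dots> = distr M N' (\<lambda>\<omega>. f (X0 \<omega>))" by (subst distr_distr) (auto simp: comp_def)
    finally show ?thesis .
  qed
  ultimately show ?thesis by (simp add: iid_copies_def)
qed

context prob_space
begin

lemmas iid_measurable = iid_copies_measurable[OF prob_space_axioms]
lemmas iid_compose = iid_copies_compose[OF prob_space_axioms]

lemma iid_expectation:
  fixes f :: "'b \<Rightarrow> 'c::{banach, second_countable_topology}"
  assumes "iid_copies M N X0 X" "i \<ge> 1" and [measurable]: "f \<in> borel_measurable N"
  shows "expectation (\<lambda>\<omega>. f (X i \<omega>)) = expectation (\<lambda>\<omega>. f (X0 \<omega>))"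
    and "integrable M (\<lambda>\<omega>. f (X i \<omega>)) \<longleftrightarrow> integrable M (\<lambda>\<omega>. f (X0 \<omega>))"
proof -
  note [measurable] = iid_measurable(1)[OF assms(1)] iid_measurable(2)[OF assms(1,2)]
  have "distr M N (X i) = distr M N X0" using assms by (simp add: iid_copies_def)
  then show "expectation (\<lambda>\<omega>. f (X i \<omega>)) = expectation (\<lambda>\<omega>. f (X0 \<omega>))"
    "integrable M (\<lambda>\<omega>. f (X i \<omega>)) \<longleftrightarrow> integrable M (\<lambda>\<omega>. f (X0 \<omega>))"
    by (simp_all flip: integral_distr[of _ M N f] integrable_distr_eq[of _ M N f])
qed

text \<open>With \<open>g\<close> complex this factorizes characteristic functions, with \<open>g\<close> real Laplace
  transforms.\<close>

lemma iid_expectation_prod: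
  fixes g :: "'b \<Rightarrow> 'c::{real_normed_field, banach, second_countable_topology}"
  assumes iid: "iid_copies M N X0 X" and [measurable]: "g \<in> borel_measurable N"
    and bound: "\<And>x. norm (g x) \<le> B"
  shows "expectation (\<lambda>\<omega>. \<Prod>i=1..n. g (X i \<omega>)) = expectation (\<lambda>\<omega>. g (X0 \<omega>)) ^ n"
proof -
  have "indep_vars (\<lambda>_. borel) (\<lambda>i \<omega>. g (X i \<omega>)) {1..n}"
    using iid_compose[OF iid, of g borel] by (auto simp: iid_copies_def intro: indep_vars_subset)
  moreover have "integrable M (\<lambda>\<omega>. g (X i \<omega>))" if "i \<in> {1..n}" for i
    using iid_measurable(2)[OF iid, of i] that by (intro integrable_const_bound[where B=B]) (auto intro: bound)
  ultimately have "expectation (\<lambda>\<omega>. \<Prod>i=1..n. g (X i \<omega>)) = (\<Prod>i=1..n. expectation (\<lambda>\<omega>. g (X i \<omega>)))"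
    by (intro indep_vars_lebesgue_integral) auto
  also have "\<dots> = (\<Prod>i=1..n. expectation (\<lambda>\<omega>. g (X0 \<omega>)))"
    by (intro prod.cong iid_expectation(1)[OF iid]) auto
  finally show ?thesis by simp
qed

lemma iid_char_sum:
  assumes iid: "iid_copies M borel Y0 (Y :: nat \<Rightarrow> 'a \<Rightarrow> real)"
  shows "char (distr M borel (\<lambda>\<omega>. (\<Sum>i=1..n. Y i \<omega>) / b)) t = char (distr M borel Y0) (t / b) ^ n"
proof -
  note [measurable] = iid_measurable[OF iid]
  have "char (distr M borel (\<lambda>\<omega>. (\<Sum>i=1..n. Y i \<omega>) / b)) t
      = (CLINT \<omega>|M. (\<Prod>i=1..n. iexp (t / b * Y i \<omega>)))"
    by (subst char_distr_eq) (auto simp: sum_divide_distrib sum_distrib_left exp_sum[symmetric] intro!: Bochner_Integration.integral_cong)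
  also have "\<dots> = (CLINT \<omega>|M. iexp (t / b * Y0 \<omega>)) ^ n"
    by (rule iid_expectation_prod[OF iid, where B=1]) (simp_all del: of_real_mult of_real_divide)
  finally show ?thesis by (simp add: char_distr_eq)
qed

text \<open>If the Laplace transform of \<open>V n\<close> tends to that of the constant \<open>K\<close>, then so does \<open>V n\<close>
  in probability: the transforms at 1 and 2 determine the second moment of
  \<open>exp (- V n) - exp (- K)\<close>, which therefore tends to 0. The transform of a sum of \<open>n\<close> independent
  copies is an \<open>n\<close>-th power, so that the hypothesis concerns a single copy. The norming constants
  are arbitrary: apart from the law of large numbers this yields the convergence of normed sums
  of squares of infinite mean.\<close>

lemma laplace_law_of_large_numbers:
  assumes iid: "iid_copies M borel Y0 (Y :: nat \<Rightarrow> 'a \<Rightarrow> real)"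
    and nonneg: "\<And>\<omega>. \<omega> \<in> space M \<Longrightarrow> Y0 \<omega> \<ge> 0" "\<And>i \<omega>. i \<ge> 1 \<Longrightarrow> \<omega> \<in> space M \<Longrightarrow> Y i \<omega> \<ge> 0"
    and c: "\<And>n. c n \<ge> 0" and K: "K \<ge> 0"
    and lim: "\<And>s. s > 0 \<Longrightarrow> (\<lambda>n. real n * (1 - expectation (\<lambda>\<omega>. exp (- s * (Y0 \<omega> / c n))))) \<longlonglongrightarrow> s * K"
  shows "prob_null M (\<lambda>n \<omega>. (\<Sum>i=1..n. Y i \<omega>) / c n - K)"
proof -
  note [measurable] = iid_measurable[OF iid]
  define V where "V n \<omega> = (\<Sum>i=1..n. Y i \<omega>) / c n" for n \<omega>
  have V_nonneg: "V n \<omega> \<ge> 0" if "\<omega> \<in> space M" for n \<omega>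
    unfolding V_def using that nonneg(2) c by (intro divide_nonneg_nonneg sum_nonneg) auto
  have [measurable]: "V n \<in> borel_measurable M" for n unfolding V_def by measurable
  have int: "integrable M (\<lambda>\<omega>. exp (- s * V n \<omega>))" if "s > 0" for n s
    using V_nonneg that by (intro integrable_const_bound[where B=1]) auto
  have laplace: "(\<lambda>n. expectation (\<lambda>\<omega>. exp (- s * V n \<omega>))) \<longlonglongrightarrow> exp (- s * K)" if s: "s > 0" for s
  proof -
    have "expectation (\<lambda>\<omega>. exp (- s * V n \<omega>)) = expectation (\<lambda>\<omega>. exp (- s * (Y0 \<omega> / c n))) ^ n" for n
    proof -
      have "expectation (\<lambda>\<omega>. exp (- s * V n \<omega>))
          = expectation (\<lambda>\<omega>. \<Prod>i=1..n. exp (- s * (max 0 (Y i \<omega>) / c n)))"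
        \<comment> \<open>\<open>max 0\<close> makes the integrand a bounded function of the whole real line\<close>
        using nonneg(2)
        by (intro Bochner_Integration.integral_cong)
           (auto simp: V_def exp_sum[symmetric] sum_divide_distrib sum_distrib_left sum_negf intro!: sum.cong)
      also have "\<dots> = expectation (\<lambda>\<omega>. exp (- s * (max 0 (Y0 \<omega>) / c n))) ^ n"
        using s c by (intro iid_expectation_prod[OF iid, where B=1]) auto
      also have "expectation (\<lambda>\<omega>. exp (- s * (max 0 (Y0 \<omega>) / c n))) = expectation (\<lambda>\<omega>. exp (- s * (Y0 \<omega> / c n)))"
        using nonneg(1) by (intro Bochner_Integration.integral_cong) auto
      finally show ?thesis .
    qed
    moreover have "expectation (\<lambda>\<omega>. exp (- s * (Y0 \<omega> / c n))) \<le> 1" for n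
    proof (rule integral_le_const)
      show "integrable M (\<lambda>\<omega>. exp (- s * (Y0 \<omega> / c n)))"
        using nonneg(1) c s by (intro integrable_const_bound[where B=1]) auto
    qed (use nonneg(1) c s in auto)
    ultimately show ?thesis
      using power_limit_exp[OF lim[OF s]] s K by (simp add: integral_nonneg)
  qed
  have sq: "expectation (\<lambda>\<omega>. (exp (- V n \<omega>) - exp (- K))\<^sup>2)
      = expectation (\<lambda>\<omega>. exp (- 2 * V n \<omega>)) - 2 * exp (- K) * expectation (\<lambda>\<omega>. exp (- 1 * V n \<omega>)) + (exp (- K))\<^sup>2" for n
  proof -
    have "(exp (- V n \<omega>) - exp (- K))\<^sup>2
        = exp (- 2 * V n \<omega>) - 2 * exp (- K) * exp (- 1 * V n \<omega>) + (exp (- K))\<^sup>2" for \<omega>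
      by (simp add: power2_diff exp_double[symmetric])
    then show ?thesis using int[of 1 n] int[of 2 n] by (simp add: prob_space)
  qed
  have "(\<lambda>n. expectation (\<lambda>\<omega>. (exp (- V n \<omega>) - exp (- K))\<^sup>2))
      \<longlonglongrightarrow> exp (- 2 * K) - 2 * exp (- K) * exp (- 1 * K) + (exp (- K))\<^sup>2"
    unfolding sq by (intro tendsto_intros laplace) auto
  also have "exp (- 2 * K) - 2 * exp (- K) * exp (- 1 * K) + (exp (- K))\<^sup>2 = 0"
    using exp_double[of "- K"] by (simp add: power2_eq_square)
  finally have "(\<lambda>n. expectation (\<lambda>\<omega>. (exp (- V n \<omega>) - exp (- K))\<^sup>2)) \<longlonglongrightarrow> 0" .
  then have "prob_null M (\<lambda>n \<omega>. (exp (- V n \<omega>) - exp (- K))\<^sup>2)"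
  proof (intro prob_null_expectation integrable_const_bound[where B=1] AE_I2)
    fix n \<omega> assume "\<omega> \<in> space M"
    then have "exp (- V n \<omega>) \<le> 1" "exp (- K) \<le> 1" using V_nonneg K by simp_all
    then have "\<bar>exp (- V n \<omega>) - exp (- K)\<bar> \<le> 1"
      using exp_gt_zero[of "- V n \<omega>"] exp_gt_zero[of "- K"] by linarith
    then show "norm ((exp (- V n \<omega>) - exp (- K))\<^sup>2) \<le> 1"
      by (simp add: abs_square_le_1)
  qed simp_all
  then have "prob_null M (\<lambda>n \<omega>. (exp (- V n \<omega>) - exp (- K))\<^sup>2 - 0)" by simp
  from prob_null_continuous[OF this isCont_real_sqrt]
  have "prob_null M (\<lambda>n \<omega>. exp (- V n \<omega>) - exp (- K))"
    by (rule prob_null_dominated) auto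
  have "isCont ln (exp (- K))" by (intro isCont_ln) simp
  from prob_null_continuous[OF \<open>prob_null M (\<lambda>n \<omega>. exp (- V n \<omega>) - exp (- K))\<close> this] have "prob_null M (\<lambda>n \<omega>. ln (exp (- V n \<omega>)) - ln (exp (- K)))"
    by simp
  from prob_null_minus[OF this] show ?thesis by (simp add: V_def)
qed

text \<open>Only the first moment is assumed: \<open>n (1 - exp (- s y / n))\<close> tends to \<open>s y\<close> and is dominated
  by it.\<close>

lemma weak_law_of_large_numbers_nonneg:
  assumes iid: "iid_copies M borel Y0 (Y :: nat \<Rightarrow> 'a \<Rightarrow> real)"
    and nonneg: "\<And>\<omega>. \<omega> \<in> space M \<Longrightarrow> Y0 \<omega> \<ge> 0" "\<And>i \<omega>. i \<ge> 1 \<Longrightarrow> \<omega> \<in> space M \<Longrightarrow> Y i \<omega> \<ge> 0"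
    and int: "integrable M Y0"
  shows "prob_null M (\<lambda>n \<omega>. (\<Sum>i=1..n. Y i \<omega>) / real n - expectation Y0)"
proof (rule laplace_law_of_large_numbers[OF iid])
  note [measurable] = iid_measurable[OF iid]
  fix s :: real assume s: "s > 0"
  have "(\<lambda>n. expectation (\<lambda>\<omega>. real n * (1 - exp (- (s * Y0 \<omega>) / real n)))) \<longlonglongrightarrow> expectation (\<lambda>\<omega>. s * Y0 \<omega>)"
  proof (rule integral_dominated_convergence[where w="\<lambda>\<omega>. s * Y0 \<omega>"])
    show "AE \<omega> in M. norm (real n * (1 - exp (- (s * Y0 \<omega>) / real n))) \<le> s * Y0 \<omega>" for n
    proof (rule AE_I2)
      fix \<omega> assume \<omega>: "\<omega> \<in> space M"
      have "0 \<le> s * Y0 \<omega>" using s nonneg(1)[OF \<omega>] by simp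
      moreover have "1 - exp (- (s * Y0 \<omega>) / real n) \<le> s * Y0 \<omega> / real n"
        using exp_ge_add_one_self[of "- (s * Y0 \<omega>) / real n"] by simp
      then have "real n * (1 - exp (- (s * Y0 \<omega>) / real n)) \<le> s * Y0 \<omega>" if "n > 0"
        using that by (simp add: field_simps)
      ultimately show "norm (real n * (1 - exp (- (s * Y0 \<omega>) / real n))) \<le> s * Y0 \<omega>"
        by (cases "n = 0") auto
    qed
  qed (use int exp_difference_quotient in auto)
  moreover have "expectation (\<lambda>\<omega>. real n * (1 - exp (- (s * Y0 \<omega>) / real n)))
      = real n * (1 - expectation (\<lambda>\<omega>. exp (- s * (Y0 \<omega> / real n))))" for n
  proof -
    have "integrable M (\<lambda>\<omega>. exp (- (s * Y0 \<omega>) / real n))"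
      using s nonneg(1) by (intro integrable_const_bound[where B=1]) auto
    then have "expectation (\<lambda>\<omega>. 1 - exp (- (s * Y0 \<omega>) / real n)) = 1 - expectation (\<lambda>\<omega>. exp (- (s * Y0 \<omega>) / real n))"
      by (subst Bochner_Integration.integral_diff) (simp_all only: integrable_const integral_const, simp add: prob_space)
    then show ?thesis by simp
  qed
  ultimately show "(\<lambda>n. real n * (1 - expectation (\<lambda>\<omega>. exp (- s * (Y0 \<omega> / real n))))) \<longlonglongrightarrow> s * expectation Y0"
    by (simp only: integral_mult_right_zero)
qed (use nonneg in \<open>auto intro: integral_nonneg\<close>)

theorem weak_law_of_large_numbers:
  assumes iid: "iid_copies M borel Y0 (Y :: nat \<Rightarrow> 'a \<Rightarrow> real)" and int: "integrable M Y0"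
  shows "prob_null M (\<lambda>n \<omega>. (\<Sum>i=1..n. Y i \<omega>) / real n - expectation Y0)"
proof -
  note [measurable] = iid_measurable[OF iid]
  have ints: "integrable M (\<lambda>\<omega>. max 0 (Y0 \<omega>))" "integrable M (\<lambda>\<omega>. max 0 (- Y0 \<omega>))"
    using int by auto
  have "prob_null M (\<lambda>n \<omega>. ((\<Sum>i=1..n. max 0 (Y i \<omega>)) / real n - expectation (\<lambda>\<omega>. max 0 (Y0 \<omega>)))
      - ((\<Sum>i=1..n. max 0 (- Y i \<omega>)) / real n - expectation (\<lambda>\<omega>. max 0 (- Y0 \<omega>))))"
    by (intro prob_null_diff weak_law_of_large_numbers_nonneg ints
         iid_compose[OF iid, of "\<lambda>y. max 0 y"] iid_compose[OF iid, of "\<lambda>y. max 0 (- y)"]) auto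
  moreover have pm: "max 0 y - max 0 (- y) = y" for y :: real by simp
  have "expectation (\<lambda>\<omega>. max 0 (Y0 \<omega>)) - expectation (\<lambda>\<omega>. max 0 (- Y0 \<omega>)) = expectation Y0"
    by (subst Bochner_Integration.integral_diff[symmetric, OF ints]) (simp only: pm)
  moreover have "(\<Sum>i=1..n. max 0 (Y i \<omega>)) - (\<Sum>i=1..n. max 0 (- Y i \<omega>)) = (\<Sum>i=1..n. Y i \<omega>)" for n \<omega>
    by (simp only: sum_subtractf[symmetric] pm)
  moreover have "(a / r - c) - (b / r - d) = (a - b) / r - (c - d)" for a b c d r :: real
    by (simp add: diff_divide_distrib)
  ultimately show ?thesis by simp
qed

lemma iid_sum_second_moment:
  assumes iid: "iid_copies M borel Y0 (Y :: nat \<Rightarrow> 'a \<Rightarrow> real)"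
    and sq: "integrable M (\<lambda>\<omega>. (Y0 \<omega>)\<^sup>2)" and zero: "expectation Y0 = 0"
  shows "integrable M (\<lambda>\<omega>. (\<Sum>i=1..n. Y i \<omega>)\<^sup>2) \<and>
    expectation (\<lambda>\<omega>. (\<Sum>i=1..n. Y i \<omega>)\<^sup>2) = real n * expectation (\<lambda>\<omega>. (Y0 \<omega>)\<^sup>2)"
proof (induction n)
  case (Suc n)
  note [measurable] = iid_measurable[OF iid]
  have int: "integrable M Y0"
    by (rule square_integrable_imp_integrable[OF _ sq]) measurable
  let ?S = "\<lambda>\<omega>. \<Sum>i=1..n. Y i \<omega>"
  have int': "integrable M (Y i)" "integrable M (\<lambda>\<omega>. (Y i \<omega>)\<^sup>2)" "expectation (Y i) = 0"
    "expectation (\<lambda>\<omega>. (Y i \<omega>)\<^sup>2) = expectation (\<lambda>\<omega>. (Y0 \<omega>)\<^sup>2)" if "i \<ge> 1" for i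
    using iid_expectation[OF iid that, of "\<lambda>y. y"] iid_expectation[OF iid that, of "\<lambda>y. y\<^sup>2"] int sq zero
    by simp_all
  have "indep_var borel (Y (Suc n)) borel ?S"
    using iid by (intro indep_vars_sum) (auto simp: iid_copies_def intro: indep_vars_subset)
  moreover have "integrable M ?S" by (intro Bochner_Integration.integrable_sum int') auto
  ultimately have "expectation (\<lambda>\<omega>. Y (Suc n) \<omega> * ?S \<omega>) = 0" "integrable M (\<lambda>\<omega>. Y (Suc n) \<omega> * ?S \<omega>)"
    using int'[of "Suc n"]
    by (auto simp: indep_var_lebesgue_integral intro: indep_var_integrable)
  moreover have "(\<Sum>i=1..Suc n. Y i \<omega>)\<^sup>2 = (?S \<omega>)\<^sup>2 + (Y (Suc n) \<omega>)\<^sup>2 + 2 * (Y (Suc n) \<omega> * ?S \<omega>)" for \<omega>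
    by (simp add: power2_sum)
  ultimately show ?case using Suc int'[of "Suc n"] by (simp add: algebra_simps)
qed simp

lemma iid_sum_bounded:
  assumes iid: "iid_copies M borel Y0 (Y :: nat \<Rightarrow> 'a \<Rightarrow> real)"
    and sq: "integrable M (\<lambda>\<omega>. (Y0 \<omega>)\<^sup>2)" and zero: "expectation Y0 = 0"
  shows "prob_bounded M (\<lambda>n \<omega>. (\<Sum>i=1..n. Y i \<omega>) / sqrt (real n))"
proof -
  note m = iid_sum_second_moment[OF assms]
  have eq: "((\<Sum>i=1..n. Y i \<omega>) / sqrt (real n))\<^sup>2 = (\<Sum>i=1..n. Y i \<omega>)\<^sup>2 / real n" for n \<omega>
    by (simp add: power_divide)
  show ?thesis
  proof (rule prob_bounded_second_moment)
    show "integrable M (\<lambda>\<omega>. ((\<Sum>i=1..n. Y i \<omega>) / sqrt (real n))\<^sup>2)" for n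
      unfolding eq using m[of n] by simp
    show "expectation (\<lambda>\<omega>. ((\<Sum>i=1..n. Y i \<omega>) / sqrt (real n))\<^sup>2) \<le> expectation (\<lambda>\<omega>. (Y0 \<omega>)\<^sup>2)" for n
      unfolding eq using m[of n] by (cases "n = 0") (auto intro: integral_nonneg)
  qed
qed

text \<open>The classical central limit theorem, transferred to sequences that start at index 1.\<close>

lemma iid_central_limit_theorem:
  assumes iid: "iid_copies M borel Y0 (Y :: nat \<Rightarrow> 'a \<Rightarrow> real)"
    and sq: "integrable M (\<lambda>\<omega>. (Y0 \<omega>)\<^sup>2)" and zero: "expectation Y0 = 0"
    and v: "v = expectation (\<lambda>\<omega>. (Y0 \<omega>)\<^sup>2)" "v > 0"
  shows "tends_to_normal M (\<lambda>n \<omega>. (\<Sum>i=1..n. Y i \<omega>) / sqrt (real n)) v"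
proof -
  note [measurable] = iid_measurable[OF iid]
  define X where "X n = Y (Suc n)" for n
  have [measurable]: "X n \<in> borel_measurable M" for n by (simp add: X_def)
  have "indep_sets (\<lambda>i. {Y i -` A \<inter> space M | A. A \<in> sets borel}) {1..}"
    using iid unfolding iid_copies_def indep_vars_def2 by simp
  then have "indep_sets (\<lambda>i. {X i -` A \<inter> space M | A. A \<in> sets borel}) UNIV"
    unfolding X_def
  proof (intro indep_setsI, goal_cases)
    case (2 A J)
    have "prob (\<Inter>j\<in>Suc ` J. A (j - 1)) = (\<Prod>j\<in>Suc ` J. prob (A (j - 1)))"
      using 2 by (intro indep_setsD[OF 2(1)]) auto
    then show ?case by (simp add: prod.reindex)
  qed auto
  then have indep: "indep_vars (\<lambda>_. borel) X UNIV"
    unfolding indep_vars_def2 by auto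
  have e: "expectation (X n) = 0" "integrable M (\<lambda>x. (X n x)\<^sup>2)" "variance (X n) = (sqrt v)\<^sup>2"
    "distr M borel (X n) = distr M borel Y0" for n
    using iid_expectation[OF iid, of "Suc n" "\<lambda>y. y"] iid_expectation[OF iid, of "Suc n" "\<lambda>y. y\<^sup>2"]
      zero sq v iid by (auto simp: X_def iid_copies_def)
  have "weak_conv_m (\<lambda>n. distr M borel (\<lambda>x. (\<Sum>i<n. X i x) / sqrt (n * (sqrt v)\<^sup>2))) std_normal_distribution"
    using indep e v(2) by (intro central_limit_theorem_zero_mean[where \<mu>="distr M borel Y0"]) auto
  moreover have "(\<Sum>i<n. X i x) = (\<Sum>i=1..n. Y i x)" for n x
    unfolding X_def by (simp add: sum.atLeast1_atMost_eq)
  ultimately have "tends_to_normal M (\<lambda>n \<omega>. (\<Sum>i=1..n. Y i \<omega>) / sqrt (real n * v)) 1"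
    using v(2) by (simp add: tends_to_normal_def)
  from tends_to_normal_cmult[OF this, of "sqrt v"] v(2) show ?thesis
    by (simp add: real_sqrt_mult)
qed

end

section \<open>Characteristic functions near the origin\<close>

lemma one_minus_cos_ge:
  assumes "\<bar>x::real\<bar> \<le> 1"
  shows "x\<^sup>2 / 4 \<le> 1 - cos x"
proof -
  have "cmod (iexp x - (1 + \<i> * x - x\<^sup>2 / 2)) \<le> \<bar>x\<bar> ^ 3 / 6"
    using iexp_approx1[of x 2] by (simp add: numeral_eq_Suc algebra_simps)
  then have "\<bar>Re (iexp x - (1 + \<i> * x - x\<^sup>2 / 2))\<bar> \<le> \<bar>x\<bar> ^ 3 / 6"
    using abs_Re_le_cmod order_trans by blast
  then have "\<bar>cos x - (1 - x\<^sup>2 / 2)\<bar> \<le> \<bar>x\<bar> ^ 3 / 6"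
    by (simp add: Re_exp)
  then have "cos x - (1 - x\<^sup>2 / 2) \<le> \<bar>x\<bar> ^ 3 / 6" by (rule abs_le_D1)
  moreover have "\<bar>x\<bar> ^ 3 \<le> x\<^sup>2" using power_decreasing[of 2 3 "\<bar>x\<bar>"] assms by simp
  ultimately show ?thesis using zero_le_power2[of x] by linarith
qed

context real_distribution
begin

lemma integrable_cos_sin:
  "integrable M (\<lambda>x. cos (u * x))" "integrable M (\<lambda>x. sin (u * x))"
  by (rule integrable_const_bound[where B=1]; simp)+

lemma char_Re_Im:
  "1 - Re (char M u) = (\<integral>x. 1 - cos (u * x) \<partial>M)" "Im (char M u) = (\<integral>x. sin (u * x) \<partial>M)"
proof -
  have int: "complex_integrable M (\<lambda>x. iexp (u * x))"
    by (intro integrable_iexp) auto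
  have "Re (char M u) = (\<integral>x. Re (iexp (u * x)) \<partial>M)" "Im (char M u) = (\<integral>x. Im (iexp (u * x)) \<partial>M)"
    unfolding char_def using int by (simp_all only: integral_Re integral_Im)
  then have "Re (char M u) = (\<integral>x. cos (u * x) \<partial>M)" "Im (char M u) = (\<integral>x. sin (u * x) \<partial>M)"
    by (simp_all add: Re_exp Im_exp)
  then show "1 - Re (char M u) = (\<integral>x. 1 - cos (u * x) \<partial>M)" "Im (char M u) = (\<integral>x. sin (u * x) \<partial>M)"
    using prob_space by (simp_all add: integrable_cos_sin)
qed

lemma one_minus_Re_char_nonneg: "0 \<le> 1 - Re (char M u)"
  unfolding char_Re_Im by (intro Bochner_Integration.integral_nonneg) simp

text \<open>This is \<open>1 - cos (2 y) \<le> 4 (1 - cos y)\<close>, integrated. It propagates bounds on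
  \<open>1 - Re (char M u)\<close> from a neighbourhood of 0 to a quadratic bound on the whole line.\<close>

lemma one_minus_Re_char_double: "1 - Re (char M (2 * u)) \<le> 4 * (1 - Re (char M u))"
proof -
  have "1 - cos (2 * u * x) \<le> 4 * (1 - cos (u * x))" for x
  proof -
    have "cos (2 * u * x) = 2 * (cos (u * x))\<^sup>2 - 1"
      using cos_double_cos[of "u * x"] by (simp add: mult.assoc)
    then have "4 * (1 - cos (u * x)) - (1 - cos (2 * u * x)) = 2 * (1 - cos (u * x))\<^sup>2"
      by (simp add: power2_eq_square algebra_simps)
    moreover have "0 \<le> 2 * (1 - cos (u * x))\<^sup>2" by simp
    ultimately show ?thesis by linarith
  qed
  then have "(\<integral>x. 1 - cos (2 * u * x) \<partial>M) \<le> (\<integral>x. 4 * (1 - cos (u * x)) \<partial>M)"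
    by (intro integral_mono Bochner_Integration.integrable_diff integrable_mult_right integrable_cos_sin integrable_const)
  then show ?thesis unfolding char_Re_Im by (simp only: integral_mult_right_zero)
qed

lemma one_minus_Re_char_power2: "1 - Re (char M (2 ^ k * u)) \<le> 4 ^ k * (1 - Re (char M u))"
proof (induction k)
  case (Suc k)
  have "1 - Re (char M (2 ^ Suc k * u)) \<le> 4 * (1 - Re (char M (2 ^ k * u)))"
    using one_minus_Re_char_double[of "2 ^ k * u"] by (simp add: mult.assoc)
  also have "\<dots> \<le> 4 * (4 ^ k * (1 - Re (char M u)))" using Suc by simp
  finally show ?case by simp
qed simp

text \<open>On \<open>|x| \<le> k\<close> and for small \<open>u\<close> the integrand \<open>1 - cos (u x)\<close> is at least \<open>(u x)\<^sup>2 / 4\<close>, and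
  the truncated second moments tend to infinity.\<close>

lemma one_minus_Re_char_superquadratic:
  assumes inf: "\<not> integrable M (\<lambda>x. x\<^sup>2)"
  shows "\<exists>d>0. \<forall>u. \<bar>u\<bar> < d \<longrightarrow> A * u\<^sup>2 \<le> 1 - Re (char M u)"
proof -
  define T where "T k x = x\<^sup>2 * indicator {- real k..real k} x" for k and x :: real
  have T_int: "integrable M (T k)" for k
  proof (rule integrable_const_bound[where B="(real k)\<^sup>2"])
    have "\<bar>T k x\<bar> \<le> (real k)\<^sup>2" for x
      by (auto simp: T_def indicator_def abs_le_iff intro!: power2_le_iff_abs_le[THEN iffD2])
    then show "AE x in M. norm (T k x) \<le> (real k)\<^sup>2" by simp
  qed (simp add: T_def[abs_def])
  have T_mono: "T k x \<le> T l x" if "k \<le> l" for k l x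
    using that by (auto simp: T_def indicator_def)
  have "\<exists>k. integral\<^sup>L M (T k) > 4 * A"
  proof (rule ccontr)
    assume "\<nexists>k. integral\<^sup>L M (T k) > 4 * A"
    then have bdd: "integral\<^sup>L M (T k) \<le> 4 * A" for k by (simp add: not_less)
    have "incseq (\<lambda>k. integral\<^sup>L M (T k))"
      by (intro incseq_SucI integral_mono T_int T_mono) simp
    from incseq_convergent[OF this, of "4 * A"] bdd obtain L where L: "(\<lambda>k. integral\<^sup>L M (T k)) \<longlonglongrightarrow> L"
      by blast
    have "integrable M (\<lambda>x. x\<^sup>2)"
    proof (rule integrable_monotone_convergence[where f=T])
      show "AE x in M. mono (\<lambda>n. T n x)" by (simp add: mono_def T_mono)
      have "(\<lambda>k. T k x) \<longlonglongrightarrow> x\<^sup>2" for x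
      proof (rule tendsto_eventually)
        obtain N where "\<bar>x\<bar> \<le> real N" using real_arch_simple by blast
        then show "\<forall>\<^sub>F k in sequentially. T k x = x\<^sup>2"
          by (intro eventually_sequentiallyI[of N]) (auto simp: T_def indicator_def abs_le_iff)
      qed
      then show "AE x in M. (\<lambda>k. T k x) \<longlonglongrightarrow> x\<^sup>2" by simp
    qed (use L T_int in simp_all)
    with inf show False by blast
  qed
  then obtain k where k: "integral\<^sup>L M (T k) > 4 * A" by blast
  show ?thesis
  proof (intro exI[of _ "1 / (real k + 1)"] conjI allI impI)
    fix u :: real assume u: "\<bar>u\<bar> < 1 / (real k + 1)"
    have "u\<^sup>2 / 4 * T k x \<le> 1 - cos (u * x)" for x
    proof (cases "x \<in> {- real k..real k}")
      case True
      then have "\<bar>u * x\<bar> \<le> 1 / (real k + 1) * real k"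
        unfolding abs_mult using u by (intro mult_mono) auto
      also have "\<dots> \<le> 1" by simp
      finally show ?thesis using one_minus_cos_ge[of "u * x"] True
        by (simp add: T_def power_mult_distrib)
    qed (simp add: T_def)
    then have "(\<integral>x. u\<^sup>2 / 4 * T k x \<partial>M) \<le> (\<integral>x. 1 - cos (u * x) \<partial>M)"
      by (intro integral_mono Bochner_Integration.integrable_diff integrable_mult_right integrable_cos_sin T_int integrable_const)
    moreover have "A * u\<^sup>2 \<le> u\<^sup>2 / 4 * integral\<^sup>L M (T k)"
      using mult_left_mono[OF less_imp_le[OF k], of "u\<^sup>2 / 4"] by (simp add: mult.commute)
    ultimately show "A * u\<^sup>2 \<le> 1 - Re (char M u)"
      unfolding char_Re_Im by simp
  qed simp
qed

lemma tail_prob_small: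
  assumes "e > 0"
  shows "\<exists>A>0. prob {x. A \<le> \<bar>x\<bar>} < e"
proof -
  obtain \<tau> where \<tau>: "\<tau> > 0" "(\<integral>x. min 1 (\<tau> * \<bar>x\<bar>) \<partial>M) < e"
    using truncated_mean_small[OF assms] by blast
  have "prob {x\<in>space M. 1 \<le> min 1 (\<tau> * \<bar>x\<bar>)} \<le> (\<integral>x. min 1 (\<tau> * \<bar>x\<bar>) \<partial>M) / 1"
    using \<tau>(1) by (intro integral_Markov_inequality_measure[where A="{}"])
        (auto intro!: integrable_const_bound[where B=1])
  moreover have "{x\<in>space M. 1 \<le> min 1 (\<tau> * \<bar>x\<bar>)} = {x. 1 / \<tau> \<le> \<bar>x\<bar>}"
    using \<tau>(1) by (auto simp: field_simps)
  ultimately show ?thesis using \<tau> by (intro exI[of _ "1 / \<tau>"]) simp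
qed

text \<open>For a law of infinite variance the imaginary part of the characteristic function does not
  contribute to its modulus at the order of \<open>1 - Re (char M u)\<close>, even if the mean is not zero. The
  values \<open>|x| < A\<close> contribute at most \<open>|u| A\<close> to \<open>E sin (u x)\<close>, whose square is negligible by
  the previous growth lemma. For the others, the Cauchy-Schwarz inequality and
  \<open>sin\<^sup>2 y \<le> 2 (1 - cos y)\<close> give the square at most \<open>P(|x| \<ge> A)\<close> times \<open>2 (1 - Re (char M u))\<close>, where
  the probability is as small as desired.\<close>

lemma Im_char_negligible:
  assumes inf: "\<not> integrable M (\<lambda>x. x\<^sup>2)" and e: "e > 0"
  shows "\<exists>d>0. \<forall>u. \<bar>u\<bar> < d \<longrightarrow> (Im (char M u))\<^sup>2 \<le> e * (1 - Re (char M u))"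
proof -
  obtain A where A: "A > 0" "prob {x. A \<le> \<bar>x\<bar>} < e / 8"
    using tail_prob_small[of "e / 8"] e by auto
  define I where "I x = (indicator {x. A \<le> \<bar>x\<bar>} x :: real)" for x :: real
  have [measurable]: "{x. A \<le> \<bar>x\<bar>} \<in> sets borel" by measurable
  have I_meas[measurable]: "I \<in> borel_measurable borel" unfolding I_def[abs_def] by measurable
  have I_exp: "integral\<^sup>L M I < e / 8" using A(2) by (simp add: I_def[abs_def])
  obtain d where d: "d > 0" "\<And>u. \<bar>u\<bar> < d \<Longrightarrow> (4 * A\<^sup>2 / e) * u\<^sup>2 \<le> 1 - Re (char M u)"
    using one_minus_Re_char_superquadratic[OF inf, of "4 * A\<^sup>2 / e"] by blast
  show ?thesis
  proof (intro exI[of _ d] conjI allI impI)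
    fix u assume u: "\<bar>u\<bar> < d"
    let ?G = "1 - Re (char M u)"
    define c where "c = (\<integral>x. sin (u * x) * I x \<partial>M)"
    have ints: "integrable M (\<lambda>x. sin (u * x) * I x)" "integrable M (\<lambda>x. (sin (u * x))\<^sup>2)"
      "integrable M I" "integrable M (\<lambda>x. sin (u * x) * (1 - I x))"
      by (rule integrable_const_bound[where B=1]; auto simp: I_def indicator_def abs_square_le_1)+
    have "(\<integral>x. (sin (u * x))\<^sup>2 \<partial>M) \<le> (\<integral>x. 2 * (1 - cos (u * x)) \<partial>M)"
    proof (rule integral_mono)
      fix x
      have "2 * (1 - cos (u * x)) - (sin (u * x))\<^sup>2 = (1 - cos (u * x))\<^sup>2"
        by (simp add: sin_squared_eq power2_eq_square algebra_simps)
      moreover have "0 \<le> (1 - cos (u * x))\<^sup>2" by simp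
      ultimately show "(sin (u * x))\<^sup>2 \<le> 2 * (1 - cos (u * x))" by linarith
    qed (use ints integrable_cos_sin in auto)
    then have sin2: "(\<integral>x. (sin (u * x))\<^sup>2 \<partial>M) \<le> 2 * ?G"
      unfolding char_Re_Im by (simp only: integral_mult_right_zero)
    have c2: "c\<^sup>2 \<le> e / 8 * (2 * ?G)"
    proof -
      \<comment> \<open>Cauchy-Schwarz: this \<open>r\<close> minimizes the bound that follows from \<open>E (sin (u x) - r I)\<^sup>2 \<ge> 0\<close>\<close>
      define r where "r = c / (e / 8)"
      have "0 \<le> (\<integral>x. (sin (u * x) - r * I x)\<^sup>2 \<partial>M)" by simp
      also have "(\<lambda>x. (sin (u * x) - r * I x)\<^sup>2) = (\<lambda>x. (sin (u * x))\<^sup>2 - 2 * r * (sin (u * x) * I x) + r\<^sup>2 * I x)"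
        by (auto simp: fun_eq_iff I_def indicator_def power2_diff)
      also have "(\<integral>x. (sin (u * x))\<^sup>2 - 2 * r * (sin (u * x) * I x) + r\<^sup>2 * I x \<partial>M)
          = (\<integral>x. (sin (u * x))\<^sup>2 \<partial>M) - 2 * r * c + r\<^sup>2 * integral\<^sup>L M I"
        unfolding c_def using ints by simp
      also have "\<dots> \<le> 2 * ?G - 2 * r * c + r\<^sup>2 * (e / 8)"
        using sin2 mult_left_mono[OF less_imp_le[OF I_exp] zero_le_power2[of r]] by linarith
      also have "\<dots> = 2 * ?G - c\<^sup>2 / (e / 8)"
        using e by (simp add: r_def power2_eq_square field_simps)
      finally have "c\<^sup>2 / (e / 8) \<le> 2 * ?G" by simp
      then show ?thesis using e by (simp add: divide_le_eq mult.commute)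
    qed
    have low: "\<bar>\<integral>x. sin (u * x) * (1 - I x) \<partial>M\<bar> \<le> \<bar>u\<bar> * A"
    proof -
      have "\<bar>sin (u * x) * (1 - I x)\<bar> \<le> \<bar>u\<bar> * A" for x
      proof (cases "A \<le> \<bar>x\<bar>")
        case False
        have "\<bar>sin (u * x)\<bar> \<le> \<bar>u * x\<bar>" by (rule abs_sin_x_le_abs_x)
        also have "\<dots> \<le> \<bar>u\<bar> * A" unfolding abs_mult using False by (intro mult_left_mono) auto
        finally show ?thesis using False by (simp add: I_def)
      qed (use A in \<open>simp add: I_def\<close>)
      then have "(\<integral>x. \<bar>sin (u * x) * (1 - I x)\<bar> \<partial>M) \<le> (\<integral>x. \<bar>u\<bar> * A \<partial>M)"
        by (intro integral_mono integrable_abs ints) auto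
      then have "(\<integral>x. \<bar>sin (u * x) * (1 - I x)\<bar> \<partial>M) \<le> \<bar>u\<bar> * A"
        using prob_space by simp
      then show ?thesis by (rule order_trans[OF integral_abs_bound])
    qed
    have "Im (char M u) = (\<integral>x. sin (u * x) * I x + sin (u * x) * (1 - I x) \<partial>M)"
      unfolding char_Re_Im by (simp add: algebra_simps)
    also have "\<dots> = c + (\<integral>x. sin (u * x) * (1 - I x) \<partial>M)"
      unfolding c_def by (rule Bochner_Integration.integral_add[OF ints(1,4)])
    finally have "(Im (char M u))\<^sup>2 \<le> 2 * c\<^sup>2 + 2 * (\<integral>x. sin (u * x) * (1 - I x) \<partial>M)\<^sup>2"
      using sum_squares_ge_zero zero_le_power2[of "c - (\<integral>x. sin (u * x) * (1 - I x) \<partial>M)"]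
      by (simp add: power2_sum power2_diff)
    also have "(\<integral>x. sin (u * x) * (1 - I x) \<partial>M)\<^sup>2 \<le> (\<bar>u\<bar> * A)\<^sup>2"
      using low A by (intro power2_le_iff_abs_le[THEN iffD2]) auto
    also have "(\<bar>u\<bar> * A)\<^sup>2 = e / 4 * ((4 * A\<^sup>2 / e) * u\<^sup>2)"
      using e by (simp add: power_mult_distrib)
    also have "\<dots> \<le> e / 4 * ?G" using d(2)[OF u] e by (intro mult_left_mono) auto
    also have "2 * c\<^sup>2 \<le> 2 * (e / 8 * (2 * ?G))" using c2 by simp
    finally show "(Im (char M u))\<^sup>2 \<le> e * ?G" by (simp add: field_simps)
  qed (rule d(1))
qed

end

section \<open>From normal convergence to the Laplace transform of the squares\<close>

lemma power_limit_exp_converse: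
  fixes x :: "nat \<Rightarrow> real"
  assumes lim: "(\<lambda>n. x n ^ n) \<longlonglongrightarrow> exp (- a)" and x: "\<And>n. 0 \<le> x n"
  shows "(\<lambda>n. real n * (1 - x n)) \<longlonglongrightarrow> a"
proof -
  have pos: "\<forall>\<^sub>F n in sequentially. x n > 0"
  proof -
    have "\<forall>\<^sub>F n in sequentially. x n ^ n > 0" using lim by (rule order_tendstoD) simp
    then show ?thesis using eventually_gt_at_top[of 0]
    proof eventually_elim
      case (elim n)
      then show ?case using x[of n] by (cases "x n = 0") (auto simp: power_0_left)
    qed
  qed
  have "(\<lambda>n. ln (x n ^ n)) \<longlonglongrightarrow> ln (exp (- a))"
    by (rule tendsto_ln[OF lim]) simp
  then have "(\<lambda>n. ln (x n ^ n)) \<longlonglongrightarrow> - a" by (simp only: ln_exp)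
  then have y: "(\<lambda>n. real n * ln (x n)) \<longlonglongrightarrow> - a"
    by (rule Lim_transform_eventually) (use pos in \<open>auto elim!: eventually_mono simp: ln_realpow\<close>)
  have "(\<lambda>n. exp (real n * ln (x n) * (1 / real n))) \<longlonglongrightarrow> exp (- a * 0)"
    by (intro tendsto_intros y lim_1_over_n)
  then have x1: "x \<longlonglongrightarrow> 1"
    by (simp only: mult_zero_right exp_zero, elim Lim_transform_eventually)
       (use pos eventually_gt_at_top[of 0] in eventually_elim, auto)
  have low: "(\<lambda>n. x n * - (real n * ln (x n))) \<longlonglongrightarrow> 1 * - (- a)"
    by (intro tendsto_mult tendsto_minus x1 y)
  have up: "(\<lambda>n. - (real n * ln (x n))) \<longlonglongrightarrow> - (- a)"
    by (intro tendsto_minus y)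
  have "\<forall>\<^sub>F n in sequentially. x n * - (real n * ln (x n)) \<le> real n * (1 - x n)"
    using pos
  proof eventually_elim
    case (elim n)
    have "ln (1 / x n) \<le> 1 / x n - 1" using elim by (intro ln_le_minus_one) simp
    then have "x n * - ln (x n) \<le> x n * (1 / x n - 1)"
      using elim by (intro mult_left_mono) (simp_all add: ln_div)
    also have "x n * (1 / x n - 1) = 1 - x n" using elim by (simp add: right_diff_distrib)
    finally have "x n * - ln (x n) \<le> 1 - x n" .
    from mult_left_mono[OF this, of "real n"] show ?case by (simp add: mult_ac)
  qed
  moreover have "\<forall>\<^sub>F n in sequentially. real n * (1 - x n) \<le> - (real n * ln (x n))"
    using pos
  proof eventually_elim
    case (elim n)
    have "1 - x n \<le> - ln (x n)" using ln_le_minus_one[OF elim] by simp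
    from mult_left_mono[OF this, of "real n"] show ?case by simp
  qed
  ultimately show ?thesis
    using low[unfolded minus_minus mult_1_left] up[unfolded minus_minus]
    by (rule tendsto_sandwich)
qed

lemma le_ln_4:
  assumes "1 / 4 \<le> exp (- c)"
  shows "(c::real) \<le> ln 4"
proof -
  have "exp c * (1 / 4) \<le> exp c * exp (- c)"
    using assms by (rule mult_left_mono) simp
  also have "\<dots> = 1" by (simp flip: exp_add)
  finally have "exp c \<le> 4" by simp
  then show ?thesis by (simp add: ln_ge_iff)
qed

context real_distribution
begin

lemma one_minus_char_norm_sq:
  "1 - (cmod (char M u))\<^sup>2
     = (1 - Re (char M u)) * (2 - (1 - Re (char M u))) - (Im (char M u))\<^sup>2"
  by (simp add: cmod_power2) (simp add: power2_eq_square algebra_simps)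

lemma one_minus_Re_char_tendsto_0: "((\<lambda>u. 1 - Re (char M u)) \<longlongrightarrow> 0) (at 0)"
proof -
  have "(char M \<longlongrightarrow> char M 0) (at 0)" using isCont_char by (simp add: isCont_def)
  then have "((\<lambda>u. 1 - Re (char M u)) \<longlongrightarrow> 1 - Re (char M 0)) (at 0)" by (intro tendsto_intros)
  then show ?thesis by (simp add: char_zero)
qed

text \<open>The hypothesis concerns only the modulus of the characteristic function of the normed sums, so
  that centring is irrelevant. As \<open>1 - |char|\<^sup>2 = (1 - Re)(2 - (1 - Re)) - Im\<^sup>2\<close> with \<open>Im\<^sup>2\<close> negligible,
  the limit of \<open>n (1 - |char|\<^sup>2)\<close> is twice that of \<open>n (1 - Re)\<close>.\<close>

lemma scaled_one_minus_Re_char_limit: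
  assumes inf: "\<not> integrable M (\<lambda>x. x\<^sup>2)" and b: "filterlim b at_top sequentially"
    and lim: "\<And>t. (\<lambda>n. cmod (char M (t / b n)) ^ n) \<longlonglongrightarrow> exp (- t\<^sup>2 / 2)"
  shows "(\<lambda>n. real n * (1 - Re (char M (t / b n)))) \<longlonglongrightarrow> t\<^sup>2 / 2"
proof (cases "t = 0")
  case True
  then show ?thesis by (simp add: char_zero)
next
  case t: False
  define G where "G u = 1 - Re (char M u)" for u
  define I where "I u = Im (char M u)" for u
  have "((\<lambda>u. (I u)\<^sup>2 / G u) \<longlongrightarrow> 0) (at 0)"
  proof (rule tendstoI)
    fix e :: real assume e: "e > 0"
    then obtain d where d: "d > 0" "\<And>u. \<bar>u\<bar> < d \<Longrightarrow> (I u)\<^sup>2 \<le> e / 2 * G u"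
      using Im_char_negligible[OF inf, of "e / 2"] unfolding G_def I_def by auto
    have "dist ((I u)\<^sup>2 / G u) 0 < e" if "\<bar>u\<bar> < d" for u
    proof -
      have "G u \<ge> 0" unfolding G_def by (rule one_minus_Re_char_nonneg)
      then have "(I u)\<^sup>2 / G u \<le> e / 2"
        using d(2)[OF that] e by (cases "G u = 0") (auto simp: divide_le_eq)
      then have "(I u)\<^sup>2 / G u < e" by (rule le_less_trans) (use e in simp)
      then show ?thesis using \<open>G u \<ge> 0\<close> by simp
    qed
    then show "\<forall>\<^sub>F u in at 0. dist ((I u)\<^sup>2 / G u) 0 < e"
      unfolding eventually_at using d(1) by (intro exI[of _ d]) auto
  qed
  then have "((\<lambda>u. 2 - (G u + (I u)\<^sup>2 / G u)) \<longlongrightarrow> 2 - (0 + 0)) (at 0)"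
    unfolding G_def by (intro tendsto_intros one_minus_Re_char_tendsto_0)
  moreover have tb: "filterlim (\<lambda>n. t / b n) (at 0) sequentially"
  proof -
    have "(\<lambda>n. t / b n) \<longlonglongrightarrow> 0"
      using b by (intro tendsto_divide_0[OF tendsto_const] filterlim_at_top_imp_at_infinity)
    moreover have "\<forall>\<^sub>F n in sequentially. b n > 0" using b unfolding filterlim_at_top_dense by (rule spec)
    ultimately show ?thesis using t by (auto simp: filterlim_at elim!: eventually_mono)
  qed
  ultimately have q: "(\<lambda>n. 2 - (G (t / b n) + (I (t / b n))\<^sup>2 / G (t / b n))) \<longlonglongrightarrow> 2"
    by (auto dest: filterlim_compose)
  have "(\<lambda>n. (cmod (char M (t / b n)) ^ n)\<^sup>2) \<longlonglongrightarrow> (exp (- t\<^sup>2 / 2))\<^sup>2"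
    by (intro tendsto_intros lim)
  then have "(\<lambda>n. ((cmod (char M (t / b n)))\<^sup>2) ^ n) \<longlonglongrightarrow> exp (- t\<^sup>2)"
    by (simp add: power_mult[symmetric] mult.commute exp_double[symmetric])
  then have H: "(\<lambda>n. real n * (1 - (cmod (char M (t / b n)))\<^sup>2)) \<longlonglongrightarrow> t\<^sup>2"
    by (rule power_limit_exp_converse) simp
  have "(\<lambda>n. real n * (1 - (cmod (char M (t / b n)))\<^sup>2) / (2 - (G (t / b n) + (I (t / b n))\<^sup>2 / G (t / b n)))) \<longlonglongrightarrow> t\<^sup>2 / 2"
    by (intro tendsto_divide H q) simp
  moreover have "\<forall>\<^sub>F n in sequentially. real n * (1 - (cmod (char M (t / b n)))\<^sup>2) / (2 - (G (t / b n) + (I (t / b n))\<^sup>2 / G (t / b n)))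
      = real n * G (t / b n)"
  proof -
    have "\<exists>d>0. \<forall>u. \<bar>u\<bar> < d \<longrightarrow> (I u)\<^sup>2 \<le> 1 * G u"
      using Im_char_negligible[OF inf, of 1] unfolding G_def I_def by simp
    then obtain d where d: "d > 0" "\<And>u. \<bar>u\<bar> < d \<Longrightarrow> (I u)\<^sup>2 \<le> 1 * G u" by blast
    have "\<forall>\<^sub>F u in at 0. \<bar>u\<bar> < d" using d(1) by (auto simp: eventually_at intro!: exI[of _ d])
    then have "\<forall>\<^sub>F n in sequentially. \<bar>t / b n\<bar> < d" using tb by (rule eventually_compose_filterlim)
    moreover have "\<forall>\<^sub>F n in sequentially. 2 - (G (t / b n) + (I (t / b n))\<^sup>2 / G (t / b n)) > 0"
      using q by (rule order_tendstoD) simp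
    ultimately show ?thesis
    proof eventually_elim
      case (elim n)
      let ?u = "t / b n"
      have "1 - (cmod (char M ?u))\<^sup>2 = G ?u * (2 - (G ?u + (I ?u)\<^sup>2 / G ?u))"
      proof (cases "G ?u = 0")
        case True
        then have "I ?u = 0" using d(2)[OF elim(1)] by simp
        then show ?thesis using True one_minus_char_norm_sq[of ?u] by (simp add: G_def I_def)
      next
        case False
        then show ?thesis unfolding one_minus_char_norm_sq
          by (fold G_def I_def) (simp add: field_simps power2_eq_square)
      qed
      then show ?case using elim(2) by simp
    qed
  qed
  ultimately show ?thesis unfolding G_def[symmetric]
    by (rule Lim_transform_eventually)
qed

text \<open>Convergence for each \<open>t\<close> does not allow \<open>t\<close> to be integrated out; this bound does. On
  \<open>|t| \<le> \<tau>\<close> it comes from the uniform lower bound for the characteristic functions of the normed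
  sums. Doubling \<open>t\<close> costs a factor 4, which yields a quadratic bound for the other \<open>t\<close>.\<close>

lemma scaled_one_minus_Re_char_bound:
  assumes inf: "\<not> integrable M (\<lambda>x. x\<^sup>2)" and b: "filterlim b at_top sequentially"
    and \<tau>: "\<tau> > 0" "\<forall>\<^sub>F n in sequentially. \<forall>t. \<bar>t\<bar> \<le> \<tau> \<longrightarrow> 1 / 2 \<le> cmod (char M (t / b n)) ^ n"
  shows "\<exists>C. \<forall>\<^sub>F n in sequentially. \<forall>t. real n * (1 - Re (char M (t / b n))) \<le> C * (1 + t\<^sup>2)"
proof -
  define G where "G u = 1 - Re (char M u)" for u
  have "\<exists>d>0. \<forall>u. \<bar>u\<bar> < d \<longrightarrow> (Im (char M u))\<^sup>2 \<le> 1 / 2 * G u"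
    unfolding G_def by (rule Im_char_negligible[OF inf]) simp
  then obtain d1 where d1: "d1 > 0" "\<And>u. \<bar>u\<bar> < d1 \<Longrightarrow> (Im (char M u))\<^sup>2 \<le> 1 / 2 * G u"
    by blast
  have "\<forall>\<^sub>F u in at 0. G u < 1 / 2"
    unfolding G_def by (rule order_tendstoD[OF one_minus_Re_char_tendsto_0]) simp
  then have "\<exists>d>0. \<forall>u\<in>UNIV. u \<noteq> 0 \<and> dist u 0 < d \<longrightarrow> G u < 1 / 2"
    by (rule eventually_at[THEN iffD1])
  then obtain d2 where d2: "d2 > 0" "\<And>u. u \<noteq> 0 \<Longrightarrow> dist u 0 < d2 \<Longrightarrow> G u < 1 / 2"
    by blast
  define d where "d = min d1 d2"
  have d: "d > 0" using d1 d2 by (simp add: d_def)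
  have GH: "G u \<le> 1 - (cmod (char M u))\<^sup>2" if "\<bar>u\<bar> < d" for u
  proof -
    have "G u \<le> 1 / 2" using d2(2)[of u] that by (cases "u = 0") (auto simp: d_def G_def char_zero dist_real_def)
    moreover have "G u \<ge> 0" unfolding G_def by (rule one_minus_Re_char_nonneg)
    ultimately have "G u * (3 / 2) \<le> G u * (2 - G u)" by (intro mult_left_mono) linarith+
    moreover have "(Im (char M u))\<^sup>2 \<le> 1 / 2 * G u" using d1(2)[of u] that by (simp add: d_def)
    moreover have "1 - (cmod (char M u))\<^sup>2 = G u * (2 - G u) - (Im (char M u))\<^sup>2"
      unfolding G_def by (rule one_minus_char_norm_sq)
    ultimately show ?thesis by linarith
  qed
  define L where "L = ln (4 :: real)"
  have L: "L > 0" by (simp add: L_def)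
  have "\<forall>\<^sub>F n in sequentially. b n > \<tau> / d" using b unfolding filterlim_at_top_dense by (rule spec)
  moreover have "\<forall>\<^sub>F n in sequentially. b n > 0" using b unfolding filterlim_at_top_dense by (rule spec)
  ultimately have "\<forall>\<^sub>F n in sequentially. \<forall>t. \<bar>t\<bar> \<le> \<tau> \<longrightarrow> real n * G (t / b n) \<le> L"
    using \<tau>(2)
  proof eventually_elim
    case (elim n)
    show ?case
    proof (intro allI impI)
      fix t assume t: "\<bar>t\<bar> \<le> \<tau>"
      let ?h = "1 - (cmod (char M (t / b n)))\<^sup>2"
      have "\<tau> < d * b n" using elim(1) d by (simp add: pos_divide_less_eq mult.commute)
      then have "\<bar>t / b n\<bar> < d"
        using t elim(2) by (simp add: pos_divide_less_eq)
      then have "real n * G (t / b n) \<le> real n * ?h" by (intro mult_left_mono GH) auto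
      moreover have "real n * ?h \<le> L"
      proof -
        have "(1 / 2)\<^sup>2 \<le> (cmod (char M (t / b n)) ^ n)\<^sup>2"
          using elim(3) t by (intro power_mono) auto
        then have "1 / 4 \<le> (cmod (char M (t / b n)) ^ n)\<^sup>2"
          by (simp add: power2_eq_square)
        also have "\<dots> = (1 - ?h) ^ n" by (simp add: power_mult[symmetric] mult.commute)
        also have "\<dots> \<le> exp (- ?h) ^ n"
          using exp_ge_add_one_self[of "- ?h"] by (intro power_mono) auto
        also have "\<dots> = exp (- (real n * ?h))" by (simp only: exp_of_nat_mult[symmetric] mult_minus_right)
        finally have "1 / 4 \<le> exp (- (real n * ?h))" .
        then show ?thesis unfolding L_def by (rule le_ln_4)
      qed
      ultimately show "real n * G (t / b n) \<le> L" by simp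
    qed
  qed
  then have "\<forall>\<^sub>F n in sequentially. \<forall>t. real n * G (t / b n) \<le> (L * (1 + 4 / \<tau>\<^sup>2)) * (1 + t\<^sup>2)"
  proof eventually_elim
    case (elim n)
    show ?case
    proof
      fix t
      show "real n * G (t / b n) \<le> (L * (1 + 4 / \<tau>\<^sup>2)) * (1 + t\<^sup>2)"
      proof (cases "\<bar>t\<bar> \<le> \<tau>")
        case True
        have "real n * G (t / b n) \<le> L * (1 * 1)" using elim True by simp
        also have "\<dots> \<le> L * ((1 + 4 / \<tau>\<^sup>2) * (1 + t\<^sup>2))"
          using L by (intro mult_left_mono mult_mono) auto
        finally show ?thesis by (simp only: mult.assoc)
      next
        case False
        obtain m where "\<bar>t\<bar> / \<tau> < 2 ^ m" using real_arch_pow[where x=2 and y="\<bar>t\<bar> / \<tau>"] by auto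
        then have ex: "\<bar>t\<bar> \<le> 2 ^ m * \<tau>" using \<tau>(1) by (simp add: pos_divide_less_eq)
        \<comment> \<open>the number of doublings that lead from \<open>[-\<tau>, \<tau>]\<close> to \<open>t\<close>\<close>
        define k where "k = (LEAST m. \<bar>t\<bar> \<le> 2 ^ m * \<tau>)"
        have k: "\<bar>t\<bar> \<le> 2 ^ k * \<tau>" unfolding k_def by (rule LeastI[of _ m]) (rule ex)
        have "k \<noteq> 0" using k False by (intro notI) simp
        then obtain j where j: "k = Suc j" using not0_implies_Suc by blast
        have "\<not> \<bar>t\<bar> \<le> 2 ^ j * \<tau>"
          using not_less_Least[of j "\<lambda>m. \<bar>t\<bar> \<le> 2 ^ m * \<tau>"] j unfolding k_def[symmetric] by simp
        then have "2 ^ k * \<tau> \<le> 2 * \<bar>t\<bar>" by (simp add: j)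
        then have "(2 ^ k * \<tau>)\<^sup>2 \<le> (2 * \<bar>t\<bar>)\<^sup>2" using \<tau>(1) by (intro power_mono) auto
        then have "4 ^ k * \<tau>\<^sup>2 \<le> 4 * t\<^sup>2"
          by (simp add: power_mult_distrib power_mult[symmetric] mult.commute[of k] power_mult)
        then have four: "4 ^ k \<le> 4 / \<tau>\<^sup>2 * t\<^sup>2" using \<tau>(1) by (simp add: pos_le_divide_eq)
        have "G (t / b n) = G (2 ^ k * ((t / 2 ^ k) / b n))" by simp
        also have "\<dots> \<le> 4 ^ k * G ((t / 2 ^ k) / b n)"
          unfolding G_def by (rule one_minus_Re_char_power2)
        finally have "real n * G (t / b n) \<le> real n * (4 ^ k * G ((t / 2 ^ k) / b n))"
          by (intro mult_left_mono) auto
        also have "\<dots> = 4 ^ k * (real n * G ((t / 2 ^ k) / b n))" by (simp only: mult_ac)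
        also have "\<dots> \<le> 4 ^ k * L"
          using elim[rule_format, of "t / 2 ^ k"] k \<tau>(1)
          by (intro mult_left_mono) (auto simp: abs_divide pos_divide_le_eq mult.commute)
        also have "\<dots> \<le> (4 / \<tau>\<^sup>2 * t\<^sup>2) * L" using four L by (intro mult_right_mono) auto
        also have "\<dots> \<le> ((1 + 4 / \<tau>\<^sup>2) * (1 + t\<^sup>2)) * L"
          using L by (intro mult_right_mono mult_mono) auto
        finally show ?thesis by (simp only: mult_ac)
      qed
    qed
  qed
  then show ?thesis unfolding G_def by blast
qed

text \<open>\<open>exp (- s y\<^sup>2)\<close> is the characteristic function of the standard normal law at
  \<open>sqrt (2 s) y\<close>; exchange the two integrations.\<close>

lemma laplace_eq_gaussian_mixture:
  assumes "s \<ge> 0"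
  shows "1 - (\<integral>x. exp (- s * (x\<^sup>2 / b\<^sup>2)) \<partial>M)
    = (\<integral>z. 1 - Re (char M (sqrt (2 * s) * z / b)) \<partial>std_normal_distribution)"
proof -
  interpret N: real_distribution std_normal_distribution by (rule real_dist_normal_dist)
  interpret P: pair_prob_space M std_normal_distribution ..
  define f where "f x z = 1 - cos (sqrt (2 * s) * z / b * x)" for x z :: real
  have f_int: "integrable (M \<Otimes>\<^sub>M std_normal_distribution) (case_prod f)"
  proof (rule P.integrable_const_bound[where B=2])
    have "\<bar>f x z\<bar> \<le> 2" for x z
      using cos_le_one[of "sqrt (2 * s) * z / b * x"] cos_ge_minus_one[of "sqrt (2 * s) * z / b * x"]
      by (simp add: f_def del: cos_le_one cos_ge_minus_one)
    then show "AE p in M \<Otimes>\<^sub>M std_normal_distribution. norm (case_prod f p) \<le> 2" by auto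
  qed (simp add: f_def[abs_def])
  have inner: "(\<integral>z. f x z \<partial>std_normal_distribution) = 1 - exp (- s * (x\<^sup>2 / b\<^sup>2))" for x
  proof -
    have "(\<integral>z. f x z \<partial>std_normal_distribution) = 1 - Re (char std_normal_distribution (sqrt (2 * s) / b * x))"
      unfolding N.char_Re_Im f_def by (simp add: mult_ac)
    also have "\<dots> = 1 - exp (- (sqrt (2 * s) / b * x)\<^sup>2 / 2)"
      by (simp only: char_std_normal_distribution Re_complex_of_real)
    also have "(sqrt (2 * s) / b * x)\<^sup>2 / 2 = s * (x\<^sup>2 / b\<^sup>2)"
      using assms by (simp add: power_mult_distrib power_divide)
    then have "- (sqrt (2 * s) / b * x)\<^sup>2 / 2 = - s * (x\<^sup>2 / b\<^sup>2)" by simp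
    finally show ?thesis .
  qed
  have "(\<integral>z. 1 - Re (char M (sqrt (2 * s) * z / b)) \<partial>std_normal_distribution)
      = (\<integral>z. (\<integral>x. f x z \<partial>M) \<partial>std_normal_distribution)"
    unfolding char_Re_Im f_def ..
  also have "\<dots> = (\<integral>x. (\<integral>z. f x z \<partial>std_normal_distribution) \<partial>M)"
    by (rule P.Fubini_integral[OF f_int])
  also have "\<dots> = (\<integral>x. 1 - exp (- s * (x\<^sup>2 / b\<^sup>2)) \<partial>M)" unfolding inner ..
  also have "\<dots> = 1 - (\<integral>x. exp (- s * (x\<^sup>2 / b\<^sup>2)) \<partial>M)"
  proof -
    have "integrable M (\<lambda>x. exp (- s * (x\<^sup>2 / b\<^sup>2)))"
      using assms by (intro integrable_const_bound[where B=1]) auto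
    then show ?thesis using prob_space by (subst Bochner_Integration.integral_diff) simp_all
  qed
  finally show ?thesis by simp
qed

text \<open>Integrate \<open>n (1 - Re (char M (t / b n)))\<close>, which tends to \<open>t\<^sup>2 / 2\<close>, over \<open>t = sqrt (2 s) z\<close>
  with \<open>z\<close> standard normal, using the quadratic bound to dominate.\<close>

theorem scaled_laplace_limit:
  assumes inf: "\<not> integrable M (\<lambda>x. x\<^sup>2)" and b: "filterlim b at_top sequentially"
    and lim: "\<And>t. (\<lambda>n. cmod (char M (t / b n)) ^ n) \<longlonglongrightarrow> exp (- t\<^sup>2 / 2)"
    and \<tau>: "\<tau> > 0" "\<forall>\<^sub>F n in sequentially. \<forall>t. \<bar>t\<bar> \<le> \<tau> \<longrightarrow> 1 / 2 \<le> cmod (char M (t / b n)) ^ n"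
    and s: "s \<ge> 0"
  shows "(\<lambda>n. real n * (1 - (\<integral>x. exp (- s * (x\<^sup>2 / (b n)\<^sup>2)) \<partial>M))) \<longlonglongrightarrow> s"
proof -
  interpret N: real_distribution std_normal_distribution by (rule real_dist_normal_dist)
  obtain C N0 where C: "\<And>n t. n \<ge> N0 \<Longrightarrow> real n * (1 - Re (char M (t / b n))) \<le> C * (1 + t\<^sup>2)"
    using scaled_one_minus_Re_char_bound[OF inf b \<tau>] by (auto simp: eventually_sequentially)
  \<comment> \<open>shifted by \<open>N0\<close>, since the bound holds only from there on\<close>
  define F where "F n z = real (n + N0) * (1 - Re (char M (sqrt (2 * s) * z / b (n + N0))))" for n z
  have sq: "(sqrt (2 * s) * z)\<^sup>2 = 2 * s * z\<^sup>2" for z using s by (simp add: power_mult_distrib)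
  have z2: "integrable std_normal_distribution (\<lambda>z. z\<^sup>2)" "(\<integral>z. z\<^sup>2 \<partial>std_normal_distribution) = 1"
    using integrable_std_normal_distribution_moment[of 2] std_normal_distribution_even_moments(1)[of 1]
    by (simp_all add: fact_numeral)
  have "(\<lambda>n. integral\<^sup>L std_normal_distribution (F n)) \<longlonglongrightarrow> (\<integral>z. s * z\<^sup>2 \<partial>std_normal_distribution)"
  proof (rule integral_dominated_convergence[where w="\<lambda>z. C * (1 + 2 * s * z\<^sup>2)"])
    show "AE z in std_normal_distribution. (\<lambda>n. F n z) \<longlonglongrightarrow> s * z\<^sup>2"
    proof (rule AE_I2)
      fix z
      have "(\<lambda>n. real n * (1 - Re (char M (sqrt (2 * s) * z / b n)))) \<longlonglongrightarrow> (sqrt (2 * s) * z)\<^sup>2 / 2"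
        by (rule scaled_one_minus_Re_char_limit[OF inf b lim])
      then have "(\<lambda>n. real n * (1 - Re (char M (sqrt (2 * s) * z / b n)))) \<longlonglongrightarrow> s * z\<^sup>2"
        unfolding sq by simp
      then show "(\<lambda>n. F n z) \<longlonglongrightarrow> s * z\<^sup>2" unfolding F_def by (rule LIMSEQ_ignore_initial_segment)
    qed
    show "AE z in std_normal_distribution. norm (F n z) \<le> C * (1 + 2 * s * z\<^sup>2)" for n
    proof (rule AE_I2)
      fix z
      have "F n z \<ge> 0" unfolding F_def using one_minus_Re_char_nonneg by (intro mult_nonneg_nonneg) auto
      moreover have "F n z \<le> C * (1 + 2 * s * z\<^sup>2)"
        unfolding F_def using C[of "n + N0" "sqrt (2 * s) * z"] by (simp add: sq)
      ultimately show "norm (F n z) \<le> C * (1 + 2 * s * z\<^sup>2)" by simp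
    qed
    show "integrable std_normal_distribution (\<lambda>z. C * (1 + 2 * s * z\<^sup>2))"
      using z2(1) by (intro integrable_mult_right Bochner_Integration.integrable_add) auto
    show "F n \<in> borel_measurable std_normal_distribution" for n
      unfolding F_def[abs_def] by measurable
  qed simp
  moreover have "integral\<^sup>L std_normal_distribution (F n)
      = real (n + N0) * (1 - (\<integral>x. exp (- s * (x\<^sup>2 / (b (n + N0))\<^sup>2)) \<partial>M))" for n
    unfolding laplace_eq_gaussian_mixture[OF s] F_def by (rule integral_mult_right_zero)
  ultimately have "(\<lambda>n. real (n + N0) * (1 - (\<integral>x. exp (- s * (x\<^sup>2 / (b (n + N0))\<^sup>2)) \<partial>M))) \<longlonglongrightarrow> s"
    using z2(2) by simp
  then show ?thesis by (rule LIMSEQ_offset)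
qed

end

section \<open>The domain of attraction of the normal law with infinite variance\<close>

context prob_space
begin

text \<open>The normed and centred sums are tight, which makes their characteristic functions close to 1,
  uniformly in \<open>n\<close>, in a neighbourhood of 0.\<close>

theorem normal_attraction_laplace_limit:
  assumes iid: "iid_copies M borel X0 (X :: nat \<Rightarrow> 'a \<Rightarrow> real)"
    and inf: "\<not> integrable M (\<lambda>\<omega>. (X0 \<omega>)\<^sup>2)"
    and b: "filterlim b at_top sequentially"
    and clt: "tends_to_normal M (\<lambda>n \<omega>. ((\<Sum>i=1..n. X i \<omega>) - a n) / b n) 1"
    and s: "s \<ge> 0"
  shows "(\<lambda>n. real n * (1 - expectation (\<lambda>\<omega>. exp (- s * ((X0 \<omega>)\<^sup>2 / (b n)\<^sup>2))))) \<longlonglongrightarrow> s"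
proof -
  note X0_meas[measurable] = iid_measurable(1)[OF iid]
  have X_meas: "(\<lambda>\<omega>. \<Sum>i=1..n. X i \<omega>) \<in> borel_measurable M" for n
    by (intro borel_measurable_sum iid_measurable(2)[OF iid]) simp
  note [measurable] = X_meas
  define Z where "Z n \<omega> = ((\<Sum>i=1..n. X i \<omega>) - a n) / b n" for n \<omega>
  have Z_meas[measurable]: "Z n \<in> borel_measurable M" for n unfolding Z_def[abs_def] by measurable
  let ?D = "distr M borel X0"
  interpret D: real_distribution ?D by (rule real_distribution_distr) measurable
  have norm_char: "cmod (char (distr M borel (Z n)) t) = cmod (char ?D (t / b n)) ^ n" for n t
  proof -
    have "char (distr M borel (Z n)) t = (CLINT \<omega>|M. iexp (- t * a n / b n) * iexp (t * ((\<Sum>i=1..n. X i \<omega>) / b n)))"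
    proof -
      have "iexp (t * Z n \<omega>) = iexp (- t * a n / b n) * iexp (t * ((\<Sum>i=1..n. X i \<omega>) / b n))" for \<omega>
        unfolding exp_add[symmetric] Z_def by (simp add: diff_divide_distrib algebra_simps)
      then show ?thesis by (simp only: char_distr_eq[OF Z_meas])
    qed
    also have "\<dots> = iexp (- t * a n / b n) * (CLINT \<omega>|M. iexp (t * ((\<Sum>i=1..n. X i \<omega>) / b n)))"
      by (rule integral_mult_right_zero)
    also have "(CLINT \<omega>|M. iexp (t * ((\<Sum>i=1..n. X i \<omega>) / b n))) = char (distr M borel (\<lambda>\<omega>. (\<Sum>i=1..n. X i \<omega>) / b n)) t"
      by (rule char_distr_eq[symmetric]) measurable
    also have "\<dots> = char ?D (t / b n) ^ n" by (rule iid_char_sum[OF iid])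
    finally show ?thesis by (simp add: norm_mult norm_power)
  qed
  have clt': "tends_to_normal M Z 1" using clt by (simp add: Z_def[abs_def])
  have lim: "(\<lambda>n. cmod (char ?D (t / b n)) ^ n) \<longlonglongrightarrow> exp (- t\<^sup>2 / 2)" for t
  proof -
    have "(\<lambda>n. char (distr M borel (Z n)) t) \<longlonglongrightarrow> complex_of_real (exp (- 1 * t\<^sup>2 / 2))"
      using clt' unfolding tends_to_normal_iff_char[OF zero_less_one Z_meas] by (rule spec)
    from tendsto_norm[OF this] show ?thesis by (simp add: norm_char)
  qed
  obtain \<tau> where \<tau>: "\<tau> > 0" "\<forall>\<^sub>F n in sequentially. expectation (\<lambda>\<omega>. min 1 (\<tau> * \<bar>Z n \<omega>\<bar>)) < 1 / 4"
    using tends_to_normal_tight[OF clt' zero_less_one Z_meas, of "1 / 4"] by auto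
  from \<tau>(2) have "\<forall>\<^sub>F n in sequentially. \<forall>t. \<bar>t\<bar> \<le> \<tau> \<longrightarrow> 1 / 2 \<le> cmod (char ?D (t / b n)) ^ n"
  proof eventually_elim
    case (elim n)
    show ?case
    proof (intro allI impI)
      fix t assume t: "\<bar>t\<bar> \<le> \<tau>"
      have int: "integrable M (\<lambda>\<omega>. iexp (t * Z n \<omega>))"
        by (rule integrable_const_bound[where B=1]; simp del: of_real_mult)
      have "char (distr M borel (Z n)) t - 1 = (CLINT \<omega>|M. iexp (t * Z n \<omega>) - 1)"
        using int by (simp add: char_distr_eq prob_space)
      then have "cmod (char (distr M borel (Z n)) t - 1) \<le> expectation (\<lambda>\<omega>. cmod (iexp (t * Z n \<omega>) - 1))"
        by (simp only: integral_norm_bound)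
      also have "\<dots> \<le> expectation (\<lambda>\<omega>. 2 * min 1 (\<tau> * \<bar>Z n \<omega>\<bar>))"
      proof (rule integral_mono)
        fix \<omega>
        have 1: "cmod (iexp (t * Z n \<omega>) - 1) \<le> 2"
          by (rule order_trans[OF norm_triangle_ineq4]) (simp del: of_real_mult)
        have "cmod (iexp (t * Z n \<omega>) - 1) \<le> \<bar>t\<bar> * \<bar>Z n \<omega>\<bar>"
          using cmod_iexp_diff_le[of "t * Z n \<omega>" 0] by (simp add: abs_mult)
        also have "\<dots> \<le> \<tau> * \<bar>Z n \<omega>\<bar>" using t by (intro mult_right_mono) auto
        finally have "cmod (iexp (t * Z n \<omega>) - 1) \<le> \<tau> * \<bar>Z n \<omega>\<bar>" .
        moreover have "0 \<le> \<tau> * \<bar>Z n \<omega>\<bar>" using \<tau>(1) by simp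
        ultimately show "cmod (iexp (t * Z n \<omega>) - 1) \<le> 2 * min 1 (\<tau> * \<bar>Z n \<omega>\<bar>)" using 1 by linarith
      next
        show "integrable M (\<lambda>\<omega>. cmod (iexp (t * Z n \<omega>) - 1))"
          by (intro integrable_norm Bochner_Integration.integrable_diff int integrable_const)
        show "integrable M (\<lambda>\<omega>. 2 * min 1 (\<tau> * \<bar>Z n \<omega>\<bar>))"
          by (rule integrable_const_bound[where B=2]) (use \<tau>(1) in auto)
      qed
      also have "\<dots> = 2 * expectation (\<lambda>\<omega>. min 1 (\<tau> * \<bar>Z n \<omega>\<bar>))" by (rule integral_mult_right_zero)
      finally have "cmod (char (distr M borel (Z n)) t - 1) \<le> 1 / 2" using elim by linarith
      moreover have "1 \<le> cmod (char (distr M borel (Z n)) t) + cmod (1 - char (distr M borel (Z n)) t)"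
        using norm_triangle_ineq[of "char (distr M borel (Z n)) t" "1 - char (distr M borel (Z n)) t"] by simp
      ultimately have "1 / 2 \<le> cmod (char (distr M borel (Z n)) t)" by (simp add: norm_minus_commute)
      then show "1 / 2 \<le> cmod (char ?D (t / b n)) ^ n" by (simp only: norm_char)
    qed
  qed
  moreover have "\<not> integrable ?D (\<lambda>x. x\<^sup>2)" using inf by (subst integrable_distr_eq) auto
  ultimately have "(\<lambda>n. real n * (1 - (\<integral>x. exp (- s * (x\<^sup>2 / (b n)\<^sup>2)) \<partial>?D))) \<longlonglongrightarrow> s"
    using b lim \<tau>(1) s by (intro D.scaled_laplace_limit)
  then show ?thesis by (subst (asm) integral_distr) auto
qed

end

context real_distribution
begin

text \<open>A centred law of variance \<open>v\<close> agrees with the normal law up to \<open>o(t\<^sup>2)\<close> at the origin. The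
  form of the bound allows an argument \<open>t\<close> that is itself random.\<close>

lemma char_quadratic_approx:
  assumes int: "integrable M (\<lambda>x. x\<^sup>2)" and mean: "(\<integral>x. x \<partial>M) = 0" and v: "(\<integral>x. x\<^sup>2 \<partial>M) = v" and e: "e > 0"
  shows "\<exists>d>0. \<forall>t. \<bar>t\<bar> \<le> d \<longrightarrow> cmod (char M t - of_real (exp (- v * t\<^sup>2 / 2))) \<le> e * t\<^sup>2"
proof -
  have int1: "integrable M (\<lambda>x. x)"
    by (rule square_integrable_imp_integrable[OF _ int]) simp
  have v0: "v \<ge> 0" unfolding v[symmetric] by (rule Bochner_Integration.integral_nonneg) simp
  define R where "R t = (\<integral>x. min (6 * x\<^sup>2) (\<bar>t\<bar> * \<bar>x\<bar> ^ 3) \<partial>M)" for t :: real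
  have R_int: "integrable M (\<lambda>x. min (6 * x\<^sup>2) (\<bar>t\<bar> * \<bar>x\<bar> ^ 3))" for t
    by (rule Bochner_Integration.integrable_bound[where f="\<lambda>x. 6 * x\<^sup>2"]) (use int in auto)
  have R_mono: "R t \<le> R t'" if "\<bar>t\<bar> \<le> \<bar>t'\<bar>" for t t'
    unfolding R_def using that by (intro integral_mono R_int min.mono mult_right_mono) auto
  have "(\<lambda>k. R (inverse (real (Suc k)))) \<longlonglongrightarrow> (\<integral>x. 0 \<partial>M)"
    unfolding R_def
  proof (rule integral_dominated_convergence[where w="\<lambda>x. 6 * x\<^sup>2"])
    have "(\<lambda>k. min (6 * x\<^sup>2) (\<bar>inverse (real (Suc k))\<bar> * \<bar>x\<bar> ^ 3)) \<longlonglongrightarrow> min (6 * x\<^sup>2) (\<bar>0\<bar> * \<bar>x\<bar> ^ 3)" for x :: real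
      by (intro tendsto_intros LIMSEQ_inverse_real_of_nat)
    then show "AE x in M. (\<lambda>k. min (6 * x\<^sup>2) (\<bar>inverse (real (Suc k))\<bar> * \<bar>x\<bar> ^ 3)) \<longlonglongrightarrow> 0"
      by simp
  qed (use int in auto)
  then have "\<forall>\<^sub>F k in sequentially. R (inverse (real (Suc k))) < 3 * e"
    using e by (intro order_tendstoD) auto
  then obtain k where k: "R (inverse (real (Suc k))) < 3 * e"
    by (auto simp: eventually_sequentially)
  define d where "d = min (inverse (real (Suc k))) (e / (v\<^sup>2 + 1))"
  have v1: "v\<^sup>2 + 1 > 0" by (simp add: add_nonneg_pos)
  have d: "d > 0" using e v1 by (simp add: d_def)
  define d' where "d' = min d 1"
  have "cmod (char M t - of_real (exp (- v * t\<^sup>2 / 2))) \<le> e * t\<^sup>2" if t: "\<bar>t\<bar> \<le> d'" for t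
  proof -
    have t1: "\<bar>t\<bar> \<le> 1" "\<bar>t\<bar> \<le> inverse (real (Suc k))" "\<bar>t\<bar> \<le> e / (v\<^sup>2 + 1)" using t by (auto simp: d'_def d_def)
    have "R t \<le> R (inverse (real (Suc k)))" using t1(2) by (intro R_mono) simp
    then have "R t \<le> 3 * e" using k by simp
    have "cmod (char M t - (1 - t\<^sup>2 * v / 2)) \<le> t\<^sup>2 / 6 * R t"
      unfolding R_def by (rule char_approx3) (use int int1 mean v in auto)
    also have "\<dots> \<le> t\<^sup>2 / 6 * (3 * e)" using \<open>R t \<le> 3 * e\<close> by (intro mult_left_mono) auto
    finally have 1: "cmod (char M t - (1 - t\<^sup>2 * v / 2)) \<le> e / 2 * t\<^sup>2" by simp
    let ?y = "v * t\<^sup>2 / 2"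
    have y: "?y \<ge> 0" using v0 by simp
    have "\<bar>exp (- ?y) - (1 - ?y)\<bar> \<le> ?y\<^sup>2 / 2"
    proof -
      have "1 - ?y \<le> exp (- ?y)" using exp_ge_add_one_self[of "- ?y"] by simp
      moreover have "exp (- ?y) \<le> 1 - ?y + ?y\<^sup>2 / 2"
      proof -
        have "1 + ?y + ?y\<^sup>2 / 2 \<le> exp ?y" using y by (rule exp_lower_Taylor_quadratic)
        then have "exp (- ?y) * (1 + ?y + ?y\<^sup>2 / 2) \<le> exp (- ?y) * exp ?y" by (intro mult_left_mono) auto
        also have "\<dots> = 1" by (simp flip: exp_add)
        also have "1 \<le> (1 - ?y + ?y\<^sup>2 / 2) * (1 + ?y + ?y\<^sup>2 / 2)"
        proof -
          have "(1 - z + z\<^sup>2 / 2) * (1 + z + z\<^sup>2 / 2) = 1 + (z\<^sup>2)\<^sup>2 / 4" for z :: real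
            by (simp add: power2_eq_square algebra_simps)
          then show ?thesis by simp
        qed
        finally show ?thesis using y by (simp add: add_nonneg_pos add_pos_nonneg)
      qed
      ultimately show ?thesis by (simp add: abs_le_iff)
    qed
    also have "?y\<^sup>2 / 2 \<le> e / 2 * t\<^sup>2"
    proof -
      have "v\<^sup>2 * \<bar>t\<bar> \<le> (v\<^sup>2 + 1) * \<bar>t\<bar>" by (intro mult_right_mono) auto
      also have "\<dots> \<le> e" using t1(3) v1 by (simp add: pos_le_divide_eq mult.commute)
      finally have "v\<^sup>2 * \<bar>t\<bar> * \<bar>t\<bar> \<le> e * 1" using t1(1) e by (intro mult_mono) auto
      then have "v\<^sup>2 * t\<^sup>2 \<le> e" by (simp add: mult.assoc power2_eq_square)
      then have "v\<^sup>2 * t\<^sup>2 * t\<^sup>2 \<le> e * t\<^sup>2" by (intro mult_right_mono) auto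
      moreover have "?y\<^sup>2 = v\<^sup>2 * t\<^sup>2 * t\<^sup>2 / 4" by (simp add: power2_eq_square)
      moreover have "0 \<le> e * t\<^sup>2" using e by simp
      ultimately show ?thesis by linarith
    qed
    finally have 2: "\<bar>exp (- ?y) - (1 - ?y)\<bar> \<le> e / 2 * t\<^sup>2" .
    have "char M t - of_real (exp (- v * t\<^sup>2 / 2))
        = (char M t - (1 - t\<^sup>2 * v / 2)) - of_real (exp (- ?y) - (1 - ?y))"
      by (simp add: mult.commute)
    then have "cmod (char M t - of_real (exp (- v * t\<^sup>2 / 2)))
        \<le> cmod (char M t - (1 - t\<^sup>2 * v / 2)) + cmod (of_real (exp (- ?y) - (1 - ?y)))"
      using norm_triangle_ineq4 by metis
    then show ?thesis using 1 2 unfolding norm_of_real by linarith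
  qed
  moreover have "d' > 0" using d by (simp add: d'_def)
  ultimately show ?thesis by blast
qed

end

context prob_space
begin

text \<open>This is Raikov's theorem. The hypothesis says that the Laplace transform of the normed sum
  of squares tends to \<open>exp (- s)\<close>, that of the constant 1.\<close>

theorem normal_attraction_sum_squares:
  assumes iid: "iid_copies M borel X0 (X :: nat \<Rightarrow> 'a \<Rightarrow> real)"
    and lap: "\<And>s. s \<ge> 0 \<Longrightarrow>
      (\<lambda>n. real n * (1 - expectation (\<lambda>\<omega>. exp (- s * ((X0 \<omega>)\<^sup>2 / (b n)\<^sup>2))))) \<longlonglongrightarrow> s"
  shows "prob_null M (\<lambda>n \<omega>. (\<Sum>i=1..n. (X i \<omega>)\<^sup>2) / (b n)\<^sup>2 - 1)"
  by (rule laplace_law_of_large_numbers[OF iid_compose[OF iid, of "\<lambda>x. x\<^sup>2"]])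
     (simp_all only: mult_1_right, use lap in auto)

lemma indep_var_iterated_integral:
  fixes f :: "real \<Rightarrow> real \<Rightarrow> 'c::{banach, second_countable_topology}"
  assumes indep: "indep_var borel X borel Y"
    and [measurable]: "case_prod f \<in> borel_measurable (borel \<Otimes>\<^sub>M borel)"
    and bound: "\<And>x y. norm (f x y) \<le> B"
  shows "expectation (\<lambda>\<omega>. f (X \<omega>) (Y \<omega>)) = expectation (\<lambda>\<omega>. \<integral>y. f (X \<omega>) y \<partial>distr M borel Y)"
proof -
  have [measurable]: "X \<in> borel_measurable M" "Y \<in> borel_measurable M"
    using indep_var_rv1[OF indep] indep_var_rv2[OF indep] by simp_all
  let ?D = "distr M borel X" and ?F = "distr M borel Y"
  interpret D: real_distribution ?D by (rule real_distribution_distr) measurable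
  interpret F: real_distribution ?F by (rule real_distribution_distr) measurable
  interpret P: pair_prob_space ?D ?F ..
  have "integrable (?D \<Otimes>\<^sub>M ?F) (case_prod f)"
    by (rule P.integrable_const_bound[where B=B]) (auto intro!: AE_I2 simp: bound split: prod.split)
  note fub = P.integral_fst[OF this]
  have "expectation (\<lambda>\<omega>. f (X \<omega>) (Y \<omega>))
      = (\<integral>p. case_prod f p \<partial>distr M (borel \<Otimes>\<^sub>M borel) (\<lambda>\<omega>. (X \<omega>, Y \<omega>)))"
    by (subst integral_distr) auto
  also have "distr M (borel \<Otimes>\<^sub>M borel) (\<lambda>\<omega>. (X \<omega>, Y \<omega>)) = ?D \<Otimes>\<^sub>M ?F"
    using indep unfolding indep_var_distribution_eq by simp
  also have "(\<integral>p. case_prod f p \<partial>(?D \<Otimes>\<^sub>M ?F)) = (\<integral>x. (\<integral>y. f x y \<partial>?F) \<partial>?D)"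
    by (rule fub[symmetric])
  also have "\<dots> = expectation (\<lambda>\<omega>. \<integral>y. f (X \<omega>) y \<partial>?F)"
    by (rule integral_distr) measurable
  finally show ?thesis .
qed

text \<open>Given the \<open>X i\<close>, the sum has independent centred summands with variances proportional to the
  \<open>(X i)\<^sup>2\<close>, whose sum is close to \<open>(b n)\<^sup>2\<close>. The proof takes expectations first and compares \<open>n\<close>-th
  powers: if \<open>\<phi>\<close> is the characteristic function of \<open>Y0\<close>, then the one of \<open>X0 Y0\<close> is
  \<open>E \<phi> (u X0)\<close>; replacing \<open>\<phi>\<close> by that of a normal law turns it into a Laplace transform
  of \<open>X0\<^sup>2\<close>, whose \<open>n\<close>-th power converges by hypothesis. The replacement error at \<open>u\<close> is at
  most \<open>e u\<^sup>2\<close> near 0 and at most 2 elsewhere. Hence it is dominated by \<open>1 - exp (- u\<^sup>2)\<close> with a small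
  factor plus a multiple of \<open>(1 - exp (- u\<^sup>2))\<^sup>2\<close>; the expectation of the latter at \<open>u = t X0 / b n\<close> is
  \<open>o(1 / n)\<close>, since the Laplace limit is linear in \<open>s\<close>.\<close>

theorem normal_attraction_product_clt:
  assumes iid: "iid_copies M borel (\<lambda>\<omega>. X0 \<omega> * Y0 \<omega>) (Z :: nat \<Rightarrow> 'a \<Rightarrow> real)"
    and indep: "indep_var borel X0 borel Y0"
    and lap: "\<And>s. s \<ge> 0 \<Longrightarrow>
      (\<lambda>n. real n * (1 - expectation (\<lambda>\<omega>. exp (- s * ((X0 \<omega>)\<^sup>2 / (b n)\<^sup>2))))) \<longlonglongrightarrow> s"
    and int: "integrable M (\<lambda>\<omega>. (Y0 \<omega>)\<^sup>2)" and mean: "expectation Y0 = 0"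
    and v: "expectation (\<lambda>\<omega>. (Y0 \<omega>)\<^sup>2) = v" "v > 0"
  shows "tends_to_normal M (\<lambda>n \<omega>. (\<Sum>i=1..n. Z i \<omega>) / b n) v"
proof -
  have [measurable]: "X0 \<in> borel_measurable M" "Y0 \<in> borel_measurable M"
    using indep_var_rv1[OF indep] indep_var_rv2[OF indep] by simp_all
  have Z_meas: "(\<lambda>\<omega>. (\<Sum>i=1..n. Z i \<omega>) / b n) \<in> borel_measurable M" for n
    by (intro borel_measurable_divide borel_measurable_sum iid_measurable(2)[OF iid] borel_measurable_const) simp
  let ?F = "distr M borel Y0"
  interpret F: real_distribution ?F by (rule real_distribution_distr) measurable
  define \<phi> where "\<phi> = char ?F"
  have [measurable]: "\<phi> \<in> borel_measurable borel" unfolding \<phi>_def by (rule F.char_measurable)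
  have \<phi>_le: "cmod (\<phi> u) \<le> 1" for u unfolding \<phi>_def by (rule F.cmod_char_le_1)
  define g where "g u = exp (- v * u\<^sup>2 / 2)" for u
  have [measurable]: "g \<in> borel_measurable borel" unfolding g_def[abs_def] by measurable
  have g_le: "0 \<le> g u" "g u \<le> 1" for u using v(2) by (simp_all add: g_def)
  have char_prod: "char (distr M borel (\<lambda>\<omega>. X0 \<omega> * Y0 \<omega>)) u = (CLINT \<omega>|M. \<phi> (u * X0 \<omega>))" for u
  proof -
    have "char (distr M borel (\<lambda>\<omega>. X0 \<omega> * Y0 \<omega>)) u = (CLINT \<omega>|M. iexp (u * (X0 \<omega> * Y0 \<omega>)))"
      by (rule char_distr_eq) measurable
    also have "\<dots> = (CLINT \<omega>|M. (CLINT y|?F. iexp (u * (X0 \<omega> * y))))"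
      by (rule indep_var_iterated_integral[OF indep, where B=1]) (simp_all del: of_real_mult)
    finally show ?thesis by (simp add: \<phi>_def char_def mult.assoc)
  qed
  define err where "err t n = expectation (\<lambda>\<omega>. cmod (\<phi> (t / b n * X0 \<omega>) - of_real (g (t / b n * X0 \<omega>))))" for t n
  have small: "(\<lambda>n. real n * err t n) \<longlonglongrightarrow> 0" for t
  proof (rule LIMSEQ_I)
    fix r :: real assume r: "r > 0"
    define w where "w s n \<omega> = exp (- s * ((X0 \<omega>)\<^sup>2 / (b n)\<^sup>2))" for s n \<omega>
    define y where "y n \<omega> = (t / b n * X0 \<omega>)\<^sup>2" for n \<omega>
    have w: "w (t\<^sup>2) n \<omega> = exp (- y n \<omega>)" "w (2 * t\<^sup>2) n \<omega> = (exp (- y n \<omega>))\<^sup>2" for n \<omega>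
      unfolding w_def y_def exp_double[symmetric] by (simp_all add: power_mult_distrib power_divide)
    have w_int: "integrable M (w s n)" if "s \<ge> 0" for s n
      unfolding w_def[abs_def] using that by (intro integrable_const_bound[where B=1]) auto
    define e where "e = r / (4 * (t\<^sup>2 + 1))"
    have e: "e > 0" using r by (simp add: e_def add_nonneg_pos)
    have "\<exists>d>0. \<forall>u. \<bar>u\<bar> \<le> d \<longrightarrow> cmod (\<phi> u - of_real (exp (- v * u\<^sup>2 / 2))) \<le> e * u\<^sup>2"
      unfolding \<phi>_def by (rule F.char_quadratic_approx[OF _ _ _ e]) (use int mean v in \<open>auto simp: integrable_distr_eq integral_distr\<close>)
    then obtain d0 where d0: "d0 > 0" "\<And>u. \<bar>u\<bar> \<le> d0 \<Longrightarrow> cmod (\<phi> u - of_real (g u)) \<le> e * u\<^sup>2"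
      unfolding g_def by blast
    define d where "d = min d0 1"
    have d: "d > 0" "d \<le> 1" "d \<le> d0" using d0(1) by (auto simp: d_def)
    define K where "K = 2 / (1 - exp (- d\<^sup>2))\<^sup>2"
    have ed: "1 - exp (- d\<^sup>2) > 0" using d(1) by simp
    have K: "K \<ge> 0" by (simp add: K_def)
    have point: "cmod (\<phi> u - of_real (g u)) \<le> 2 * e * (1 - exp (- u\<^sup>2)) + K * (1 - exp (- u\<^sup>2))\<^sup>2" for u
    proof (cases "\<bar>u\<bar> \<le> d")
      case True
      have "\<bar>u\<bar> \<le> 1" using True d by simp
      then have u1: "u\<^sup>2 \<le> 1" by (simp add: abs_square_le_1)
      have "u\<^sup>2 / 2 \<le> 1 - exp (- u\<^sup>2)"
      proof -
        have "exp (- u\<^sup>2) * (1 + u\<^sup>2) \<le> exp (- u\<^sup>2) * exp (u\<^sup>2)"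
          by (intro mult_left_mono exp_ge_add_one_self) auto
        also have "\<dots> = 1" by (simp flip: exp_add)
        also have "1 \<le> (1 - u\<^sup>2 / 2) * (1 + u\<^sup>2)"
        proof -
          have "(1 - z / 2) * (1 + z) = 1 + z * (1 - z) / 2" for z :: real by (simp add: field_simps)
          moreover have "0 \<le> u\<^sup>2 * (1 - u\<^sup>2)" using u1 by simp
          ultimately show ?thesis by simp
        qed
        finally have "exp (- u\<^sup>2) \<le> 1 - u\<^sup>2 / 2"
          by (rule mult_right_le_imp_le) (simp add: add_pos_nonneg)
        then show ?thesis by simp
      qed
      then have "e * u\<^sup>2 \<le> 2 * e * (1 - exp (- u\<^sup>2))"
        using mult_left_mono[of "u\<^sup>2 / 2" "1 - exp (- u\<^sup>2)" "2 * e"] e by simp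
      moreover have "0 \<le> K * (1 - exp (- u\<^sup>2))\<^sup>2" using K by simp
      moreover have "cmod (\<phi> u - of_real (g u)) \<le> e * u\<^sup>2" using d0(2)[of u] True d by simp
      ultimately show ?thesis by linarith
    next
      case False
      have "cmod (\<phi> u - of_real (g u)) \<le> cmod (\<phi> u) + cmod (of_real (g u))" by (rule norm_triangle_ineq4)
      also have "\<dots> \<le> 2" using \<phi>_le[of u] g_le[of u] by simp
      also have "2 \<le> K * (1 - exp (- u\<^sup>2))\<^sup>2"
      proof -
        have "d\<^sup>2 \<le> \<bar>u\<bar>\<^sup>2" using False d by (intro power_mono) auto
        then have "1 - exp (- d\<^sup>2) \<le> 1 - exp (- u\<^sup>2)" by simp
        then have "(1 - exp (- d\<^sup>2))\<^sup>2 \<le> (1 - exp (- u\<^sup>2))\<^sup>2" using ed by (intro power_mono) auto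
        from mult_left_mono[OF this K] show ?thesis using ed by (simp add: K_def)
      qed
      also have "\<dots> \<le> 2 * e * (1 - exp (- u\<^sup>2)) + K * (1 - exp (- u\<^sup>2))\<^sup>2" using e by simp
      finally show ?thesis .
    qed
    define B where "B n = 2 * e * (real n * (1 - expectation (w (t\<^sup>2) n)))
      + K * (2 * (real n * (1 - expectation (w (t\<^sup>2) n))) - real n * (1 - expectation (w (2 * t\<^sup>2) n)))" for n
    have bound: "real n * err t n \<le> B n" for n
    proof -
      have wi: "integrable M (w (t\<^sup>2) n)" "integrable M (w (2 * t\<^sup>2) n)" by (intro w_int; simp)+
      have "err t n
          \<le> expectation (\<lambda>\<omega>. 2 * e * (1 - w (t\<^sup>2) n \<omega>) + K * (2 * (1 - w (t\<^sup>2) n \<omega>) - (1 - w (2 * t\<^sup>2) n \<omega>)))"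
        unfolding err_def
      proof (rule integral_mono)
        show "integrable M (\<lambda>\<omega>. cmod (\<phi> (t / b n * X0 \<omega>) - of_real (g (t / b n * X0 \<omega>))))"
        proof (rule integrable_const_bound[where B=2])
          have "cmod (\<phi> u - of_real (g u)) \<le> 2" for u
            using norm_triangle_ineq4[of "\<phi> u" "of_real (g u)"] \<phi>_le[of u] g_le[of u] by simp
          then show "AE \<omega> in M. norm (cmod (\<phi> (t / b n * X0 \<omega>) - of_real (g (t / b n * X0 \<omega>)))) \<le> 2" by simp
        qed measurable
        show "integrable M (\<lambda>\<omega>. 2 * e * (1 - w (t\<^sup>2) n \<omega>) + K * (2 * (1 - w (t\<^sup>2) n \<omega>) - (1 - w (2 * t\<^sup>2) n \<omega>)))"
          by (intro Bochner_Integration.integrable_add Bochner_Integration.integrable_diff integrable_mult_right wi integrable_const)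
        fix \<omega>
        have sq: "(1 - z)\<^sup>2 = 2 * (1 - z) - (1 - z\<^sup>2)" for z :: real by (simp add: power2_eq_square algebra_simps)
        show "cmod (\<phi> (t / b n * X0 \<omega>) - of_real (g (t / b n * X0 \<omega>)))
          \<le> 2 * e * (1 - w (t\<^sup>2) n \<omega>) + K * (2 * (1 - w (t\<^sup>2) n \<omega>) - (1 - w (2 * t\<^sup>2) n \<omega>))"
          using point[of "t / b n * X0 \<omega>"] unfolding sq w y_def .
      qed
      also have "\<dots> = 2 * e * (1 - expectation (w (t\<^sup>2) n)) + K * (2 * (1 - expectation (w (t\<^sup>2) n)) - (1 - expectation (w (2 * t\<^sup>2) n)))"
        using wi by (simp add: prob_space)
      finally have "real n * err t n
          \<le> real n * (2 * e * (1 - expectation (w (t\<^sup>2) n)) + K * (2 * (1 - expectation (w (t\<^sup>2) n)) - (1 - expectation (w (2 * t\<^sup>2) n))))"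
        by (rule mult_left_mono) simp
      also have "\<dots> = B n" unfolding B_def by (simp add: algebra_simps)
      finally show ?thesis .
    qed
    have "B \<longlonglongrightarrow> 2 * e * t\<^sup>2 + K * (2 * t\<^sup>2 - 2 * t\<^sup>2)"
      unfolding B_def w_def by (intro tendsto_intros lap) auto
    moreover have "2 * e * t\<^sup>2 + K * (2 * t\<^sup>2 - 2 * t\<^sup>2) < r"
    proof -
      have p: "4 * (t\<^sup>2 + 1) > 0" by (simp add: add_nonneg_pos)
      then have "e * (4 * (t\<^sup>2 + 1)) = r" unfolding e_def by simp
      then have "4 * (e * t\<^sup>2) + 4 * e = r" by (simp add: algebra_simps)
      moreover have "0 \<le> e * t\<^sup>2" using e by simp
      moreover have "2 * e * t\<^sup>2 + K * (2 * t\<^sup>2 - 2 * t\<^sup>2) = 2 * (e * t\<^sup>2)" by simp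
      ultimately show ?thesis using e by linarith
    qed
    ultimately have "\<forall>\<^sub>F n in sequentially. B n < r" by (rule order_tendstoD)
    then obtain N where N: "\<And>n. n \<ge> N \<Longrightarrow> B n < r" unfolding eventually_sequentially by blast
    show "\<exists>N. \<forall>n\<ge>N. norm (real n * err t n - 0) < r"
    proof (intro exI allI impI)
      fix n assume "N \<le> n"
      then have "real n * err t n < r"
        using bound[of n] N[of n] by linarith
      moreover have "0 \<le> err t n" unfolding err_def by (rule Bochner_Integration.integral_nonneg) simp
      ultimately show "norm (real n * err t n - 0) < r"
        by (simp add: abs_mult)
    qed
  qed
  show ?thesis unfolding tends_to_normal_iff_char[OF v(2) Z_meas]
  proof
    fix t
    define c where "c n = char (distr M borel (\<lambda>\<omega>. X0 \<omega> * Y0 \<omega>)) (t / b n)" for n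
    define h where "h n = expectation (\<lambda>\<omega>. g (t / b n * X0 \<omega>))" for n
    have h_int: "integrable M (\<lambda>\<omega>. g (t / b n * X0 \<omega>))" for n
      by (rule integrable_const_bound[where B=1]) (use g_le in auto)
    have \<phi>_int: "integrable M (\<lambda>\<omega>. \<phi> (t / b n * X0 \<omega>))" for n
      by (rule integrable_const_bound[where B=1]) (use \<phi>_le in auto)
    have h01: "0 \<le> h n" "h n \<le> 1" for n
    proof -
      show "0 \<le> h n" unfolding h_def using g_le by (intro Bochner_Integration.integral_nonneg) auto
      show "h n \<le> 1" unfolding h_def using g_le h_int by (intro integral_le_const) auto
    qed
    have c1: "cmod (c n) \<le> 1" for n
      unfolding c_def by (rule real_distribution.cmod_char_le_1, rule real_distribution_distr) measurable
    have "(\<lambda>n. real n * (1 - h n)) \<longlonglongrightarrow> v * t\<^sup>2 / 2"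
    proof -
      have "g (t / b n * X0 \<omega>) = exp (- (v * t\<^sup>2 / 2) * ((X0 \<omega>)\<^sup>2 / (b n)\<^sup>2))" for n \<omega>
        by (simp add: g_def power_mult_distrib power_divide)
      then show ?thesis unfolding h_def using lap[of "v * t\<^sup>2 / 2"] v(2) by simp
    qed
    then have "(\<lambda>n. h n ^ n) \<longlonglongrightarrow> exp (- (v * t\<^sup>2 / 2))"
      using v(2) h01 by (intro power_limit_exp) auto
    then have "(\<lambda>n. complex_of_real (h n ^ n)) \<longlonglongrightarrow> complex_of_real (exp (- (v * t\<^sup>2 / 2)))"
      by (rule tendsto_of_real)
    moreover have "(\<lambda>n. c n ^ n - complex_of_real (h n ^ n)) \<longlonglongrightarrow> 0"
    proof (rule Lim_null_comparison[OF always_eventually small[of t]], rule allI)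
      fix n
      have "cmod (c n ^ n - complex_of_real (h n) ^ n) \<le> real n * cmod (c n - complex_of_real (h n))"
        using c1 h01 by (intro norm_power_diff) auto
      also have "c n - complex_of_real (h n) = (CLINT \<omega>|M. \<phi> (t / b n * X0 \<omega>) - of_real (g (t / b n * X0 \<omega>)))"
        unfolding c_def h_def char_prod using h_int \<phi>_int by simp
      also have "real n * cmod \<dots> \<le> real n * err t n"
        unfolding err_def by (intro mult_left_mono integral_norm_bound) auto
      finally show "cmod (c n ^ n - complex_of_real (h n ^ n))
        \<le> real n * err t n" by simp
    qed
    ultimately have "(\<lambda>n. complex_of_real (h n ^ n) + (c n ^ n - complex_of_real (h n ^ n)))
        \<longlonglongrightarrow> complex_of_real (exp (- (v * t\<^sup>2 / 2))) + 0"
      by (rule tendsto_add)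
    then have "(\<lambda>n. c n ^ n) \<longlonglongrightarrow> complex_of_real (exp (- (v * t\<^sup>2 / 2)))"
      by (simp only: add_diff_cancel_left' diff_add_cancel add.right_neutral add.commute[of "complex_of_real _"])
    moreover have "- v * t\<^sup>2 / 2 = - (v * t\<^sup>2 / 2)" by simp
    ultimately show "(\<lambda>n. char (distr M borel (\<lambda>\<omega>. (\<Sum>i=1..n. Z i \<omega>) / b n)) t) \<longlonglongrightarrow> complex_of_real (exp (- v * t\<^sup>2 / 2))"
      unfolding iid_char_sum[OF iid] c_def by (simp only:)
  qed
qed

end

section \<open>Sample second moments\<close>

lemma smean_add: "smean (\<lambda>i. u i + v i) n = smean u n + smean v n"
  by (simp add: smean_def sum.distrib add_divide_distrib)

lemma smean_diff: "smean (\<lambda>i. u i - v i) n = smean u n - smean v n"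
  by (simp add: smean_def sum_subtractf diff_divide_distrib)

lemma smean_cmult: "smean (\<lambda>i. a * u i) n = a * smean u n"
  by (simp add: smean_def sum_distrib_left)

lemma smean_const: "n \<ge> 1 \<Longrightarrow> smean (\<lambda>i. a) n = a"
  by (simp add: smean_def)

lemma smean_cong: "(\<And>i. 1 \<le> i \<Longrightarrow> u i = v i) \<Longrightarrow> smean u n = smean v n"
  by (simp add: smean_def)

lemma S_cong:
  assumes "\<And>i. 1 \<le> i \<Longrightarrow> u i = u' i" "\<And>i. 1 \<le> i \<Longrightarrow> v i = v' i"
  shows "S c u v n = S c u' v' n"
proof -
  have "smean u n = smean u' n" "smean v n = smean v' n" using assms by (auto intro: smean_cong)
  then show ?thesis using assms by (simp add: S_def)
qed

text \<open>Both values of \<open>c\<close> satisfy \<open>c\<^sup>2 = c\<close>; for \<open>n = 0\<close> both sides are 0.\<close>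

lemma S_eq_smean:
  assumes "c = 0 \<or> c = 1"
  shows "S c u v n = smean (\<lambda>i. u i * v i) n - c * (smean u n * smean v n)"
proof (cases "n = 0")
  case False
  let ?a = "c * smean u n" and ?b = "c * smean v n"
  have "S c u v n = smean (\<lambda>i. u i * v i - (?a * v i + (?b * u i - ?a * ?b))) n"
    unfolding S_def smean_def[of "\<lambda>i. _ i - _ i"] by (simp add: algebra_simps)
  also have "\<dots> = smean (\<lambda>i. u i * v i) n - (?a * smean v n + (?b * smean u n - ?a * ?b))"
    using False by (simp only: smean_diff smean_add smean_cmult smean_const)
  finally show ?thesis using assms by auto
qed (simp add: S_def smean_def)

text \<open>The constants drop out, by centring if \<open>c = 1\<close> and because they are 0 if \<open>c = 0\<close>.\<close>

lemma S_affine_expand: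
  assumes c: "(c = 0 \<and> a0 = 0 \<and> b0 = 0) \<or> c = 1" and n: "n \<ge> 1"
  shows "S c (\<lambda>i. a * X i + a0 + P i) (\<lambda>i. b * X i + b0 + Q i) n
    = a * b * S c X X n + a * S c X Q n + b * S c X P n + S c P Q n"
proof -
  have c': "c = 0 \<or> c = 1" using c by blast
  have "smean (\<lambda>i. (a * X i + a0 + P i) * (b * X i + b0 + Q i)) n
    = smean (\<lambda>i. a * b * (X i * X i) + (a * (X i * Q i) + (b * (X i * P i) + (P i * Q i
        + (a * b0 * X i + (a0 * b * X i + (a0 * Q i + (b0 * P i + a0 * b0)))))))) n"
    by (simp add: algebra_simps)
  then have prod: "smean (\<lambda>i. (a * X i + a0 + P i) * (b * X i + b0 + Q i)) n
    = a * b * smean (\<lambda>i. X i * X i) n + a * smean (\<lambda>i. X i * Q i) n + b * smean (\<lambda>i. X i * P i) n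
      + smean (\<lambda>i. P i * Q i) n + a * b0 * smean X n + a0 * b * smean X n + a0 * smean Q n + b0 * smean P n + a0 * b0"
    using n by (simp add: smean_add smean_cmult smean_const)
  have lin: "smean (\<lambda>i. a * X i + a0 + P i) n = a * smean X n + a0 + smean P n"
    "smean (\<lambda>i. b * X i + b0 + Q i) n = b * smean X n + b0 + smean Q n"
    using n by (simp_all add: smean_add smean_cmult smean_const)
  show ?thesis
    unfolding S_eq_smean[OF c'] prod lin using c by (auto simp: algebra_simps)
qed

lemma S_linear_right:
  assumes "c = 0 \<or> c = 1"
  shows "S c u (\<lambda>i. v i - b * w i) n = S c u v n - b * S c u w n"
proof -
  have "smean (\<lambda>i. u i * (v i - b * w i)) n = smean (\<lambda>i. u i * v i - b * (u i * w i)) n"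
    by (simp add: algebra_simps)
  then show ?thesis
    unfolding S_eq_smean[OF assms] by (simp add: smean_diff smean_cmult algebra_simps)
qed

context prob_space
begin

lemma S_tendsto:
  assumes c: "c = 0 \<or> c = 1"
    and "iid_copies M borel U0 U" "integrable M U0"
    and "iid_copies M borel V0 V" "integrable M V0"
    and "iid_copies M borel (\<lambda>\<omega>. U0 \<omega> * V0 \<omega>) (\<lambda>i \<omega>. U i \<omega> * V i \<omega>)" "integrable M (\<lambda>\<omega>. U0 \<omega> * V0 \<omega>)"
  shows "prob_null M (\<lambda>n \<omega>. S c (\<lambda>i. U i \<omega>) (\<lambda>i. V i \<omega>) n
    - (expectation (\<lambda>\<omega>. U0 \<omega> * V0 \<omega>) - c * (expectation U0 * expectation V0)))"
proof -
  note wl = weak_law_of_large_numbers[OF assms(2,3)] weak_law_of_large_numbers[OF assms(4,5)]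
    weak_law_of_large_numbers[OF assms(6,7)]
  have "prob_null M (\<lambda>n \<omega>. ((\<Sum>i=1..n. U i \<omega> * V i \<omega>) / real n - expectation (\<lambda>\<omega>. U0 \<omega> * V0 \<omega>))
     - c * ((\<Sum>i=1..n. U i \<omega>) / real n * ((\<Sum>i=1..n. V i \<omega>) / real n) - expectation U0 * expectation V0))"
    by (intro prob_null_diff prob_null_cmult prob_tendsto_mult wl)
  then show ?thesis
    unfolding S_eq_smean[OF c] smean_def by (simp add: algebra_simps)
qed

end

section \<open>Independence of vectors\<close>

lemma prod_sets_eq_vimage_sigma:
  fixes V :: "'a \<Rightarrow> 'b" and U :: "'a \<Rightarrow> 'c"
  assumes V: "V \<in> \<Omega> \<rightarrow> space N" and U: "U \<in> \<Omega> \<rightarrow> space L"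
  shows "{(\<lambda>\<omega>. (U \<omega>, V \<omega>)) -` C \<inter> \<Omega> | C. C \<in> sets (L \<Otimes>\<^sub>M N)}
    = sigma_sets \<Omega> {(U -` A \<inter> \<Omega>) \<inter> (V -` B \<inter> \<Omega>) | A B. A \<in> sets L \<and> B \<in> sets N}"
proof -
  have "{(\<lambda>\<omega>. (U \<omega>, V \<omega>)) -` C \<inter> \<Omega> | C. C \<in> sigma_sets (space L \<times> space N) {a \<times> b | a b. a \<in> sets L \<and> b \<in> sets N}}
    = sigma_sets \<Omega> {(\<lambda>\<omega>. (U \<omega>, V \<omega>)) -` C \<inter> \<Omega> | C. C \<in> {a \<times> b | a b. a \<in> sets L \<and> b \<in> sets N}}"
    by (rule sigma_sets_vimage_commute) (use U V in auto)
  also have "{(\<lambda>\<omega>. (U \<omega>, V \<omega>)) -` C \<inter> \<Omega> | C. C \<in> {a \<times> b | a b. a \<in> sets L \<and> b \<in> sets N}}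
    = {(U -` A \<inter> \<Omega>) \<inter> (V -` B \<inter> \<Omega>) | A B. A \<in> sets L \<and> B \<in> sets N}"
  proof -
    have "(\<lambda>\<omega>. (U \<omega>, V \<omega>)) -` (A \<times> B) \<inter> \<Omega> = (U -` A \<inter> \<Omega>) \<inter> (V -` B \<inter> \<Omega>)" for A B by auto
    then show ?thesis by (auto; metis)
  qed
  finally show ?thesis by (simp only: sets_pair_measure)
qed

text \<open>Two independent sequences, each with independent members, form a sequence of independent pairs:
  the rectangles are a generator, closed under intersection, of the events of a pair, and the
  probability of an intersection of rectangles factorizes, first into the two sequences and then
  within each of them.\<close>

lemma (in prob_space) indep_vars_Pair:
  fixes U :: "nat \<Rightarrow> 'a \<Rightarrow> 'b" and V :: "nat \<Rightarrow> 'a \<Rightarrow> 'c"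
  assumes U: "indep_vars (\<lambda>_. L) U I" and V: "indep_vars (\<lambda>_. N) V I"
    and UV: "indep_rvs M (Pi\<^sub>M I (\<lambda>_. N)) (\<lambda>\<omega>. \<lambda>i\<in>I. V i \<omega>) (Pi\<^sub>M I (\<lambda>_. L)) (\<lambda>\<omega>. \<lambda>i\<in>I. U i \<omega>)"
  shows "indep_vars (\<lambda>_. L \<Otimes>\<^sub>M N) (\<lambda>i \<omega>. (U i \<omega>, V i \<omega>)) I"
proof -
  have U_meas: "U i \<in> M \<rightarrow>\<^sub>M L" and V_meas: "V i \<in> M \<rightarrow>\<^sub>M N" if "i \<in> I" for i
    using U V that unfolding indep_vars_def2 by auto
  let ?F = "\<lambda>i. {(U i -` A \<inter> space M) \<inter> (V i -` B \<inter> space M) | A B. A \<in> sets L \<and> B \<in> sets N}"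
  have "indep_sets ?F I"
  proof (rule indep_setsI)
    fix i assume "i \<in> I"
    then show "?F i \<subseteq> events" using U_meas V_meas by (auto intro!: sets.Int measurable_sets)
  next
    fix F J assume J: "J \<noteq> {}" "J \<subseteq> I" "finite J" and F: "\<forall>j\<in>J. F j \<in> ?F j"
    have "\<forall>j\<in>J. \<exists>A B. F j = (U j -` A \<inter> space M) \<inter> (V j -` B \<inter> space M) \<and> A \<in> sets L \<and> B \<in> sets N"
      using F by blast
    then obtain A B where AB: "\<And>j. j \<in> J \<Longrightarrow> F j = (U j -` A j \<inter> space M) \<inter> (V j -` B j \<inter> space M)"
      "\<And>j. j \<in> J \<Longrightarrow> A j \<in> sets L" "\<And>j. j \<in> J \<Longrightarrow> B j \<in> sets N" by metis
    have split: "prob ((\<Inter>j\<in>J'. U j -` A j \<inter> space M) \<inter> (\<Inter>j\<in>J'. V j -` B j \<inter> space M))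
        = (\<Prod>j\<in>J'. prob (U j -` A j \<inter> space M)) * (\<Prod>j\<in>J'. prob (V j -` B j \<inter> space M))"
      if J': "J' \<subseteq> J" "J' \<noteq> {}" for J'
    proof -
      have fin: "finite J'" and sub: "J' \<subseteq> I" using J' J by (auto intro: finite_subset)
      let ?CA = "prod_emb I (\<lambda>_. L) J' (Pi\<^sub>E J' A)" and ?CB = "prod_emb I (\<lambda>_. N) J' (Pi\<^sub>E J' B)"
      have CA: "?CA \<in> sets (Pi\<^sub>M I (\<lambda>_. L))" and CB: "?CB \<in> sets (Pi\<^sub>M I (\<lambda>_. N))"
        using AB(2,3) J' fin sub by (auto intro!: sets_PiM_I)
      have inI: "j \<in> I" if "j \<in> J'" for j using that sub by blast
      have eqA: "(\<lambda>\<omega>. \<lambda>i\<in>I. U i \<omega>) -` ?CA \<inter> space M = (\<Inter>j\<in>J'. U j -` A j \<inter> space M)"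
        using J' U_meas[THEN measurable_space] by (auto simp: prod_emb_def PiE_iff inI cong: ball_cong)
      have eqB: "(\<lambda>\<omega>. \<lambda>i\<in>I. V i \<omega>) -` ?CB \<inter> space M = (\<Inter>j\<in>J'. V j -` B j \<inter> space M)"
        using J' V_meas[THEN measurable_space] by (auto simp: prod_emb_def PiE_iff inI cong: ball_cong)
      have "prob (((\<lambda>\<omega>. \<lambda>i\<in>I. V i \<omega>) -` ?CB \<inter> space M) \<inter> ((\<lambda>\<omega>. \<lambda>i\<in>I. U i \<omega>) -` ?CA \<inter> space M))
        = prob ((\<lambda>\<omega>. \<lambda>i\<in>I. V i \<omega>) -` ?CB \<inter> space M) * prob ((\<lambda>\<omega>. \<lambda>i\<in>I. U i \<omega>) -` ?CA \<inter> space M)"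
        using UV CA CB unfolding indep_rvs_def by (intro indep_setD) auto
      then have "prob ((\<Inter>j\<in>J'. U j -` A j \<inter> space M) \<inter> (\<Inter>j\<in>J'. V j -` B j \<inter> space M))
        = prob (\<Inter>j\<in>J'. U j -` A j \<inter> space M) * prob (\<Inter>j\<in>J'. V j -` B j \<inter> space M)"
        unfolding eqA eqB by (simp only: Int_commute mult.commute)
      also have "prob (\<Inter>j\<in>J'. U j -` A j \<inter> space M) = (\<Prod>j\<in>J'. prob (U j -` A j \<inter> space M))"
        by (rule indep_varsD[OF U]) (use J' fin sub AB in auto)
      also have "prob (\<Inter>j\<in>J'. V j -` B j \<inter> space M) = (\<Prod>j\<in>J'. prob (V j -` B j \<inter> space M))"
        by (rule indep_varsD[OF V]) (use J' fin sub AB in auto)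
      finally show ?thesis .
    qed
    have "(\<Inter>j\<in>J. F j) = (\<Inter>j\<in>J. U j -` A j \<inter> space M) \<inter> (\<Inter>j\<in>J. V j -` B j \<inter> space M)"
      using AB(1) J by auto
    then have "prob (\<Inter>j\<in>J. F j) = (\<Prod>j\<in>J. prob (U j -` A j \<inter> space M)) * (\<Prod>j\<in>J. prob (V j -` B j \<inter> space M))"
      using split[of J] J by simp
    also have "\<dots> = (\<Prod>j\<in>J. prob (F j))"
      unfolding prod.distrib[symmetric]
    proof (rule prod.cong)
      fix j assume j: "j \<in> J"
      then show "prob (U j -` A j \<inter> space M) * prob (V j -` B j \<inter> space M) = prob (F j)"
        using split[of "{j}"] AB(1)[OF j] by simp
    qed simp
    finally show "prob (\<Inter>j\<in>J. F j) = (\<Prod>j\<in>J. prob (F j))" .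
  qed
  then have "indep_sets (\<lambda>i. sigma_sets (space M) (?F i)) I"
  proof (rule indep_sets_sigma)
    fix i
    show "Int_stable (?F i)"
    proof (rule Int_stableI)
      fix a b assume "a \<in> ?F i" "b \<in> ?F i"
      then obtain A B A' B' where ab: "a = (U i -` A \<inter> space M) \<inter> (V i -` B \<inter> space M)" "b = (U i -` A' \<inter> space M) \<inter> (V i -` B' \<inter> space M)"
        and s: "A \<in> sets L" "A' \<in> sets L" "B \<in> sets N" "B' \<in> sets N" by auto
      have "a \<inter> b = (U i -` (A \<inter> A') \<inter> space M) \<inter> (V i -` (B \<inter> B') \<inter> space M)" unfolding ab by auto
      then show "a \<inter> b \<in> ?F i" using s by blast
    qed
  qed
  moreover have "sigma_sets (space M) (?F i) = {(\<lambda>\<omega>. (U i \<omega>, V i \<omega>)) -` C \<inter> space M | C. C \<in> sets (L \<Otimes>\<^sub>M N)}" if "i \<in> I" for i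
    by (rule prod_sets_eq_vimage_sigma[symmetric]) (use U_meas[OF that] V_meas[OF that] in \<open>auto dest: measurable_space\<close>)
  ultimately have "indep_sets (\<lambda>i. {(\<lambda>\<omega>. (U i \<omega>, V i \<omega>)) -` C \<inter> space M | C. C \<in> sets (L \<Otimes>\<^sub>M N)}) I"
    by (simp cong: indep_sets_cong)
  then show ?thesis unfolding indep_vars_def2 using U_meas V_meas by simp
qed

lemma (in prob_space) indep_rvs_imp_indep_var:
  assumes "indep_rvs M N V L U" and f: "f \<in> N \<rightarrow>\<^sub>M K"
  shows "indep_var L U K (\<lambda>\<omega>. f (V \<omega>))"
proof -
  have U: "U \<in> M \<rightarrow>\<^sub>M L" and V: "V \<in> M \<rightarrow>\<^sub>M N"
    and ind: "indep_set {V -` A \<inter> space M |A. A \<in> sets N} {U -` B \<inter> space M |B. B \<in> sets L}"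
    using assms(1) unfolding indep_rvs_def by auto
  have fV: "(\<lambda>\<omega>. f (V \<omega>)) \<in> M \<rightarrow>\<^sub>M K" using V f by (rule measurable_compose)
  have stable: "Int_stable {Y -` A \<inter> space M |A. A \<in> sets L'}" for Y :: "'a \<Rightarrow> 'z" and L' :: "'z measure"
  proof (rule Int_stableI)
    fix a b assume "a \<in> {Y -` A \<inter> space M |A. A \<in> sets L'}" "b \<in> {Y -` A \<inter> space M |A. A \<in> sets L'}"
    then obtain A B where "a = Y -` A \<inter> space M" "b = Y -` B \<inter> space M" "A \<in> sets L'" "B \<in> sets L'" by blast
    then have "a \<inter> b = Y -` (A \<inter> B) \<inter> space M \<and> A \<inter> B \<in> sets L'" by auto
    then show "a \<inter> b \<in> {Y -` A \<inter> space M |A. A \<in> sets L'}" by blast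
  qed
  have "indep_set {U -` B \<inter> space M |B. B \<in> sets L} {(\<lambda>\<omega>. f (V \<omega>)) -` A \<inter> space M |A. A \<in> sets K}"
  proof (rule indep_setI)
    show "{U -` B \<inter> space M |B. B \<in> sets L} \<subseteq> events" "{(\<lambda>\<omega>. f (V \<omega>)) -` A \<inter> space M |A. A \<in> sets K} \<subseteq> events"
      using U fV by (auto intro: measurable_sets)
    fix a b assume "a \<in> {U -` B \<inter> space M |B. B \<in> sets L}" "b \<in> {(\<lambda>\<omega>. f (V \<omega>)) -` A \<inter> space M |A. A \<in> sets K}"
    then obtain A B where ab: "a = U -` B \<inter> space M" "b = (\<lambda>\<omega>. f (V \<omega>)) -` A \<inter> space M" "B \<in> sets L" "A \<in> sets K" by blast
    have "b = V -` (f -` A \<inter> space N) \<inter> space M" using measurable_space[OF V] by (auto simp: ab)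
    moreover have "f -` A \<inter> space N \<in> sets N" using f ab(4) by (rule measurable_sets)
    ultimately have "b \<in> {V -` A \<inter> space M |A. A \<in> sets N}" by blast
    moreover have "a \<in> {U -` B \<inter> space M |B. B \<in> sets L}" using ab by blast
    ultimately have "prob (b \<inter> a) = prob b * prob a" by (rule indep_setD[OF ind])
    then show "prob (a \<inter> b) = prob a * prob b" by (simp only: Int_commute mult.commute)
  qed
  then show ?thesis
    unfolding indep_var_eq using U fV by (intro conjI indep_set_sigma_sets stable)
qed

lemma (in prob_space) indep_rvs_distr:
  assumes "indep_rvs M N V L U"
  shows "distr M (L \<Otimes>\<^sub>M N) (\<lambda>\<omega>. (U \<omega>, V \<omega>)) = distr M L U \<Otimes>\<^sub>M distr M N V"
proof -
  have U[measurable]: "U \<in> M \<rightarrow>\<^sub>M L" and V[measurable]: "V \<in> M \<rightarrow>\<^sub>M N"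
    and ind: "indep_set {V -` A \<inter> space M |A. A \<in> sets N} {U -` B \<inter> space M |B. B \<in> sets L}"
    using assms unfolding indep_rvs_def by auto
  interpret DU: prob_space "distr M L U" by (rule prob_space_distr) measurable
  interpret DV: prob_space "distr M N V" by (rule prob_space_distr) measurable
  interpret P: pair_prob_space "distr M L U" "distr M N V" ..
  show ?thesis
  proof (rule pair_measure_eqI[symmetric, OF DU.sigma_finite_measure_axioms DV.sigma_finite_measure_axioms])
    fix A B assume A: "A \<in> sets (distr M L U)" and B: "B \<in> sets (distr M N V)"
    have "prob ((V -` B \<inter> space M) \<inter> (U -` A \<inter> space M)) = prob (V -` B \<inter> space M) * prob (U -` A \<inter> space M)"
      using A B by (intro indep_setD[OF ind]) auto
    moreover have "(V -` B \<inter> space M) \<inter> (U -` A \<inter> space M) = (\<lambda>\<omega>. (U \<omega>, V \<omega>)) -` (A \<times> B) \<inter> space M" by auto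
    ultimately have "prob ((\<lambda>\<omega>. (U \<omega>, V \<omega>)) -` (A \<times> B) \<inter> space M) = prob (U -` A \<inter> space M) * prob (V -` B \<inter> space M)"
      by (simp only: mult.commute)
    then show "emeasure (distr M L U) A * emeasure (distr M N V) B
      = emeasure (distr M (L \<Otimes>\<^sub>M N) (\<lambda>\<omega>. (U \<omega>, V \<omega>))) (A \<times> B)"
      using A B by (simp add: emeasure_distr emeasure_eq_measure ennreal_mult)
  qed simp
qed

lemma (in prob_space) iid_copies_Pair:
  assumes U: "iid_copies M L U0 U" and V: "iid_copies M N V0 V"
    and "indep_rvs M N V0 L U0"
    and UV: "indep_rvs M (Pi\<^sub>M {1..} (\<lambda>_. N)) (\<lambda>\<omega>. \<lambda>i\<in>{1..}. V i \<omega>) (Pi\<^sub>M {1..} (\<lambda>_. L)) (\<lambda>\<omega>. \<lambda>i\<in>{1..}. U i \<omega>)"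
  shows "iid_copies M (L \<Otimes>\<^sub>M N) (\<lambda>\<omega>. (U0 \<omega>, V0 \<omega>)) (\<lambda>i \<omega>. (U i \<omega>, V i \<omega>))"
proof -
  note U_meas = iid_measurable[OF U] and V_meas = iid_measurable[OF V]
  have "distr M (L \<Otimes>\<^sub>M N) (\<lambda>\<omega>. (U i \<omega>, V i \<omega>)) = distr M (L \<Otimes>\<^sub>M N) (\<lambda>\<omega>. (U0 \<omega>, V0 \<omega>))" if i: "i \<ge> 1" for i
  proof -
    have rv: "U i \<in> M \<rightarrow>\<^sub>M L" "V i \<in> M \<rightarrow>\<^sub>M N" using U_meas(2)[OF i] V_meas(2)[OF i] .
    have "indep_rvs M N (V i) L (U i)"
      unfolding indep_rvs_def
    proof (intro conjI rv indep_setI)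
      show "{V i -` A \<inter> space M |A. A \<in> sets N} \<subseteq> events" "{U i -` B \<inter> space M |B. B \<in> sets L} \<subseteq> events"
        using rv by (auto intro: measurable_sets)
      fix a b assume "a \<in> {V i -` A \<inter> space M |A. A \<in> sets N}" "b \<in> {U i -` B \<inter> space M |B. B \<in> sets L}"
      then obtain A B where ab: "a = V i -` A \<inter> space M" "b = U i -` B \<inter> space M" "A \<in> sets N" "B \<in> sets L" by blast
      let ?A = "(\<lambda>f. f i) -` A \<inter> space (Pi\<^sub>M {1..} (\<lambda>_. N))" and ?B = "(\<lambda>f. f i) -` B \<inter> space (Pi\<^sub>M {1..} (\<lambda>_. L))"
      have sets: "?A \<in> sets (Pi\<^sub>M {1..} (\<lambda>_. N))" "?B \<in> sets (Pi\<^sub>M {1..} (\<lambda>_. L))"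
        using i ab by (auto intro!: measurable_sets measurable_component_singleton)
      have rest: "(\<lambda>\<omega>. \<lambda>i\<in>{1..}. V i \<omega>) \<in> M \<rightarrow>\<^sub>M Pi\<^sub>M {1..} (\<lambda>_. N)" "(\<lambda>\<omega>. \<lambda>i\<in>{1..}. U i \<omega>) \<in> M \<rightarrow>\<^sub>M Pi\<^sub>M {1..} (\<lambda>_. L)"
        using UV by (simp_all add: indep_rvs_def)
      have "a = (\<lambda>\<omega>. \<lambda>i\<in>{1..}. V i \<omega>) -` ?A \<inter> space M" "b = (\<lambda>\<omega>. \<lambda>i\<in>{1..}. U i \<omega>) -` ?B \<inter> space M"
        using i rest[THEN measurable_space] by (auto simp: ab)
      then show "prob (a \<inter> b) = prob a * prob b"
        using UV sets unfolding indep_rvs_def by (metis (mono_tags, lifting) indep_setD mem_Collect_eq)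
    qed
    then have "distr M (L \<Otimes>\<^sub>M N) (\<lambda>\<omega>. (U i \<omega>, V i \<omega>)) = distr M L (U i) \<Otimes>\<^sub>M distr M N (V i)"
      by (rule indep_rvs_distr)
    also have "\<dots> = distr M L U0 \<Otimes>\<^sub>M distr M N V0" using U V i by (simp add: iid_copies_def)
    also have "\<dots> = distr M (L \<Otimes>\<^sub>M N) (\<lambda>\<omega>. (U0 \<omega>, V0 \<omega>))" by (rule indep_rvs_distr[OF assms(3), symmetric])
    finally show ?thesis .
  qed
  moreover have "indep_vars (\<lambda>_. L \<Otimes>\<^sub>M N) (\<lambda>i \<omega>. (U i \<omega>, V i \<omega>)) {1..}"
    using U V UV by (intro indep_vars_Pair) (auto simp: iid_copies_def)
  moreover have "(\<lambda>\<omega>. (U0 \<omega>, V0 \<omega>)) \<in> M \<rightarrow>\<^sub>M (L \<Otimes>\<^sub>M N)" using U_meas(1) V_meas(1) by (rule measurable_Pair)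
  ultimately show ?thesis by (simp add: iid_copies_def)
qed

section \<open>The structural model\<close>

lemma fourth_power_sum_le: "((s::real) + t) ^ 4 \<le> 8 * (s ^ 4 + t ^ 4)"
proof -
  have sq: "(a + b)\<^sup>2 \<le> 2 * (a\<^sup>2 + b\<^sup>2)" for a b :: real
    using zero_le_power2[of "a - b"] by (simp add: power2_sum power2_diff)
  have "((s + t)\<^sup>2)\<^sup>2 \<le> (2 * (s\<^sup>2 + t\<^sup>2))\<^sup>2" by (rule power_mono[OF sq]) simp
  also have "\<dots> = 4 * (s\<^sup>2 + t\<^sup>2)\<^sup>2" by (simp only: power_mult_distrib) simp
  also have "\<dots> \<le> 4 * (2 * ((s\<^sup>2)\<^sup>2 + (t\<^sup>2)\<^sup>2))" using sq[of "s\<^sup>2" "t\<^sup>2"] by (rule mult_left_mono) simp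
  finally show ?thesis by simp
qed

text \<open>The triples \<open>(X i, D i, E i)\<close> of the true regressor and the errors in \<open>y\<close> and \<open>x\<close> are
  independent copies of \<open>(X0, D0, E0)\<close>.\<close>

locale structural_errors = prob_space M
  for M :: "'a measure" +
  fixes X0 D0 E0 :: "'a \<Rightarrow> real" and X D E :: "nat \<Rightarrow> 'a \<Rightarrow> real"
  assumes iid: "iid_copies M borel (\<lambda>\<omega>. (X0 \<omega>, D0 \<omega>, E0 \<omega>)) (\<lambda>i \<omega>. (X i \<omega>, D i \<omega>, E i \<omega>))"
    and indep: "\<And>f. f \<in> borel_measurable borel \<Longrightarrow> indep_var borel X0 borel (\<lambda>\<omega>. f (D0 \<omega>, E0 \<omega>))"
    and X_int: "integrable M X0"
    and D_int: "integrable M (\<lambda>\<omega>. D0 \<omega> ^ 4)" and E_int: "integrable M (\<lambda>\<omega>. E0 \<omega> ^ 4)"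
    and D_mean: "expectation D0 = 0" and E_mean: "expectation E0 = 0"
begin

lemma X0_meas[measurable]: "X0 \<in> borel_measurable M"
  and D0_meas[measurable]: "D0 \<in> borel_measurable M"
  and E0_meas[measurable]: "E0 \<in> borel_measurable M"
proof -
  have "(\<lambda>\<omega>. (X0 \<omega>, D0 \<omega>, E0 \<omega>)) \<in> M \<rightarrow>\<^sub>M borel" by (rule iid_measurable(1)[OF iid])
  then have *: "(\<lambda>\<omega>. (X0 \<omega>, D0 \<omega>, E0 \<omega>)) \<in> M \<rightarrow>\<^sub>M (borel \<Otimes>\<^sub>M (borel \<Otimes>\<^sub>M borel))"
    by (simp only: borel_prod)
  show "X0 \<in> borel_measurable M" using measurable_compose[OF * measurable_fst] by simp
  have **: "(\<lambda>\<omega>. (D0 \<omega>, E0 \<omega>)) \<in> M \<rightarrow>\<^sub>M (borel \<Otimes>\<^sub>M borel)" using measurable_compose[OF * measurable_snd] by simp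
  show "D0 \<in> borel_measurable M" using measurable_compose[OF ** measurable_fst] by simp
  show "E0 \<in> borel_measurable M" using measurable_compose[OF ** measurable_snd] by simp
qed

lemma iid_fun:
  assumes "(\<lambda>(x, d, e). h x d e) \<in> borel_measurable (borel \<Otimes>\<^sub>M (borel \<Otimes>\<^sub>M borel))"
  shows "iid_copies M borel (\<lambda>\<omega>. h (X0 \<omega>) (D0 \<omega>) (E0 \<omega>)) (\<lambda>i \<omega>. h (X i \<omega>) (D i \<omega>) (E i \<omega>))"
  using iid_compose[OF iid, of "\<lambda>(x, d, e). h x d e" borel] assms by (simp add: borel_prod)

text \<open>All errors that occur are linear combinations of the two basic ones: \<open>err 1 0\<close> and
  \<open>err 0 1\<close> are the errors in \<open>y\<close> and \<open>x\<close>, and \<open>err 1 (- \<beta>)\<close> is the residual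
  \<open>y i - \<beta> x i - \<alpha>\<close>. The observations have the form \<open>obs a a0 p q\<close>.\<close>

definition err0 :: "real \<Rightarrow> real \<Rightarrow> 'a \<Rightarrow> real" where
  "err0 a b \<omega> = a * D0 \<omega> + b * E0 \<omega>"

definition err :: "real \<Rightarrow> real \<Rightarrow> nat \<Rightarrow> 'a \<Rightarrow> real" where
  "err a b i \<omega> = a * D i \<omega> + b * E i \<omega>"

definition obs :: "real \<Rightarrow> real \<Rightarrow> real \<Rightarrow> real \<Rightarrow> nat \<Rightarrow> 'a \<Rightarrow> real" where
  "obs a a0 p q i \<omega> = a * X i \<omega> + a0 + err p q i \<omega>"

abbreviation resid0 :: "real \<Rightarrow> 'a \<Rightarrow> real" where
  "resid0 \<beta> \<equiv> err0 1 (- \<beta>)"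

abbreviation resid :: "real \<Rightarrow> nat \<Rightarrow> 'a \<Rightarrow> real" where
  "resid \<beta> \<equiv> err 1 (- \<beta>)"

abbreviation err_cov :: "real \<Rightarrow> real \<Rightarrow> real \<Rightarrow> real \<Rightarrow> real" where
  "err_cov p q p' q' \<equiv> expectation (\<lambda>\<omega>. err0 p q \<omega> * err0 p' q' \<omega>)"

abbreviation S_of :: "real \<Rightarrow> (nat \<Rightarrow> 'a \<Rightarrow> real) \<Rightarrow> (nat \<Rightarrow> 'a \<Rightarrow> real) \<Rightarrow> nat \<Rightarrow> 'a \<Rightarrow> real" where
  "S_of c U V n \<omega> \<equiv> S c (\<lambda>i. U i \<omega>) (\<lambda>i. V i \<omega>) n"

abbreviation mean_of :: "(nat \<Rightarrow> 'a \<Rightarrow> real) \<Rightarrow> nat \<Rightarrow> 'a \<Rightarrow> real" where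
  "mean_of U n \<omega> \<equiv> smean (\<lambda>i. U i \<omega>) n"

lemma err0_meas[measurable]: "err0 a b \<in> borel_measurable M"
  unfolding err0_def[abs_def] by measurable

lemma err0_fourth: "integrable M (\<lambda>\<omega>. err0 a b \<omega> ^ 4)"
proof (rule Bochner_Integration.integrable_bound)
  show "integrable M (\<lambda>\<omega>. 8 * (a ^ 4 * D0 \<omega> ^ 4 + b ^ 4 * E0 \<omega> ^ 4))"
    by (intro integrable_mult_right Bochner_Integration.integrable_add D_int E_int)
  show "AE \<omega> in M. norm (err0 a b \<omega> ^ 4) \<le> norm (8 * (a ^ 4 * D0 \<omega> ^ 4 + b ^ 4 * E0 \<omega> ^ 4))"
  proof (rule AE_I2)
    fix \<omega>
    have "err0 a b \<omega> ^ 4 \<le> 8 * (a ^ 4 * D0 \<omega> ^ 4 + b ^ 4 * E0 \<omega> ^ 4)"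
      using fourth_power_sum_le[of "a * D0 \<omega>" "b * E0 \<omega>"] by (simp add: err0_def power_mult_distrib)
    moreover have "0 \<le> err0 a b \<omega> ^ 4" by simp
    ultimately show "norm (err0 a b \<omega> ^ 4) \<le> norm (8 * (a ^ 4 * D0 \<omega> ^ 4 + b ^ 4 * E0 \<omega> ^ 4))" by simp
  qed
qed measurable

lemma err0_mult_sq: "integrable M (\<lambda>\<omega>. (err0 a b \<omega> * err0 a' b' \<omega>)\<^sup>2)"
proof (rule Bochner_Integration.integrable_bound)
  show "integrable M (\<lambda>\<omega>. err0 a b \<omega> ^ 4 + err0 a' b' \<omega> ^ 4)"
    by (intro Bochner_Integration.integrable_add err0_fourth)
  show "AE \<omega> in M. norm ((err0 a b \<omega> * err0 a' b' \<omega>)\<^sup>2) \<le> norm (err0 a b \<omega> ^ 4 + err0 a' b' \<omega> ^ 4)"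
  proof (rule AE_I2)
    fix \<omega>
    have *: "(s * t)\<^sup>2 \<le> s ^ 4 + t ^ 4" for s t :: real
    proof -
      have "2 * (s\<^sup>2 * t\<^sup>2) \<le> (s\<^sup>2)\<^sup>2 + (t\<^sup>2)\<^sup>2"
        using zero_le_power2[of "s\<^sup>2 - t\<^sup>2"] by (simp only: power2_diff)
      moreover have "0 \<le> s\<^sup>2 * t\<^sup>2" by simp
      ultimately have "s\<^sup>2 * t\<^sup>2 \<le> (s\<^sup>2)\<^sup>2 + (t\<^sup>2)\<^sup>2" by linarith
      then show ?thesis by (simp add: power_mult_distrib)
    qed
    show "norm ((err0 a b \<omega> * err0 a' b' \<omega>)\<^sup>2) \<le> norm (err0 a b \<omega> ^ 4 + err0 a' b' \<omega> ^ 4)"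
      using *[of "err0 a b \<omega>" "err0 a' b' \<omega>"] by simp
  qed
qed measurable

lemma err0_mult_int: "integrable M (\<lambda>\<omega>. err0 a b \<omega> * err0 a' b' \<omega>)"
  by (rule square_integrable_imp_integrable[OF _ err0_mult_sq]) measurable

lemma err0_sq_int: "integrable M (\<lambda>\<omega>. (err0 a b \<omega>)\<^sup>2)"
  using err0_mult_int[of a b a b] by (simp add: power2_eq_square)

lemma err0_int: "integrable M (err0 a b)"
  by (rule square_integrable_imp_integrable[OF _ err0_sq_int]) measurable

lemma err0_mean: "expectation (err0 a b) = 0"
proof -
  have "integrable M D0" "integrable M E0"
    using err0_int[of 1 0] err0_int[of 0 1] by (simp_all add: err0_def[abs_def])
  then show ?thesis by (simp add: err0_def[abs_def] D_mean E_mean)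
qed

lemma indep_fun:
  assumes "g \<in> borel_measurable borel" "(\<lambda>(d, e). f d e) \<in> borel_measurable (borel \<Otimes>\<^sub>M borel)"
  shows "indep_var borel (\<lambda>\<omega>. g (X0 \<omega>)) borel (\<lambda>\<omega>. f (D0 \<omega>) (E0 \<omega>) :: real)"
proof -
  have "indep_var borel X0 borel (\<lambda>\<omega>. (\<lambda>(d, e). f d e) (D0 \<omega>, E0 \<omega>))"
    using assms(2) by (intro indep) (simp add: borel_prod)
  from indep_var_compose[OF this assms(1) measurable_ident_sets[OF refl]] show ?thesis
    by (simp add: comp_def)
qed

lemma iid_X: "iid_copies M borel X0 X"
  by (rule iid_fun[of "\<lambda>x d e. x"]) measurable

lemma iid_err: "iid_copies M borel (err0 a b) (err a b)"
  unfolding err0_def[abs_def] err_def[abs_def]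
  by (rule iid_fun[of "\<lambda>x d e. a * d + b * e"]) measurable

lemma iid_X_err: "iid_copies M borel (\<lambda>\<omega>. X0 \<omega> * err0 a b \<omega>) (\<lambda>i \<omega>. X i \<omega> * err a b i \<omega>)"
  unfolding err0_def err_def
  by (rule iid_fun[of "\<lambda>x d e. x * (a * d + b * e)"]) measurable

lemma iid_err_err: "iid_copies M borel (\<lambda>\<omega>. err0 a b \<omega> * err0 a' b' \<omega>) (\<lambda>i \<omega>. err a b i \<omega> * err a' b' i \<omega>)"
  unfolding err0_def err_def
  by (rule iid_fun[of "\<lambda>x d e. (a * d + b * e) * (a' * d + b' * e)"]) measurable

lemma indep_X_err: "indep_var borel X0 borel (err0 a b)"
  unfolding err0_def[abs_def]
  by (rule indep_fun[of "\<lambda>x. x" "\<lambda>d e. a * d + b * e"]) measurable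

lemma X_err_int: "integrable M (\<lambda>\<omega>. X0 \<omega> * err0 a b \<omega>)"
  and X_err_mean: "expectation (\<lambda>\<omega>. X0 \<omega> * err0 a b \<omega>) = 0"
  using indep_var_integrable[OF indep_X_err X_int err0_int]
    indep_var_lebesgue_integral[OF indep_X_err X_int err0_int] err0_mean by auto

text \<open>Since \<open>X0 - E X0\<close> is centred and independent of the errors, the two summands are uncorrelated.
  This makes the asymptotic variances positive: the first summand alone contributes a positive
  amount.\<close>

lemma second_moment_decomposition:
  assumes X2: "integrable M (\<lambda>\<omega>. (X0 \<omega>)\<^sup>2)"
    and f[measurable]: "(\<lambda>(d, e). f d e) \<in> borel_measurable (borel \<Otimes>\<^sub>M borel)"
    and g[measurable]: "(\<lambda>(d, e). g d e) \<in> borel_measurable (borel \<Otimes>\<^sub>M borel)"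
    and f2: "integrable M (\<lambda>\<omega>. (f (D0 \<omega>) (E0 \<omega>))\<^sup>2)" and g2: "integrable M (\<lambda>\<omega>. (g (D0 \<omega>) (E0 \<omega>))\<^sup>2)"
  defines "F \<equiv> \<lambda>\<omega>. (X0 \<omega> - expectation X0) * f (D0 \<omega>) (E0 \<omega>) + g (D0 \<omega>) (E0 \<omega>)"
  shows "integrable M (\<lambda>\<omega>. (F \<omega>)\<^sup>2)"
    and "expectation F = expectation (\<lambda>\<omega>. g (D0 \<omega>) (E0 \<omega>))"
    and "expectation (\<lambda>\<omega>. (F \<omega>)\<^sup>2) = variance X0 * expectation (\<lambda>\<omega>. (f (D0 \<omega>) (E0 \<omega>))\<^sup>2)
      + expectation (\<lambda>\<omega>. (g (D0 \<omega>) (E0 \<omega>))\<^sup>2)"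
proof -
  define m where "m = expectation X0"
  define f0 where "f0 \<omega> = f (D0 \<omega>) (E0 \<omega>)" for \<omega>
  define g0 where "g0 \<omega> = g (D0 \<omega>) (E0 \<omega>)" for \<omega>
  have [measurable]: "f0 \<in> borel_measurable M" "g0 \<in> borel_measurable M"
    unfolding f0_def[abs_def] g0_def[abs_def] by measurable
  have f0_int: "integrable M f0"
    by (rule square_integrable_imp_integrable[OF _ f2[folded f0_def]]) measurable
  have g0_int: "integrable M g0"
    by (rule square_integrable_imp_integrable[OF _ g2[folded g0_def]]) measurable
  have Xc_int: "integrable M (\<lambda>\<omega>. X0 \<omega> - m)" using X_int by simp
  have Xc_mean: "expectation (\<lambda>\<omega>. X0 \<omega> - m) = 0" using X_int by (simp add: m_def prob_space)
  have Xc2_int: "integrable M (\<lambda>\<omega>. (X0 \<omega> - m)\<^sup>2)" using X_int X2 by (simp add: power2_diff)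
  have i1: "indep_var borel (\<lambda>\<omega>. (X0 \<omega> - m)\<^sup>2) borel (\<lambda>\<omega>. (f0 \<omega>)\<^sup>2)"
    unfolding f0_def by (rule indep_fun[of "\<lambda>x. (x - m)\<^sup>2" "\<lambda>d e. (f d e)\<^sup>2"]) measurable
  have i2: "indep_var borel (\<lambda>\<omega>. X0 \<omega> - m) borel (\<lambda>\<omega>. f0 \<omega> * g0 \<omega>)"
    unfolding f0_def g0_def by (rule indep_fun[of "\<lambda>x. x - m" "\<lambda>d e. f d e * g d e"]) measurable
  have i3: "indep_var borel (\<lambda>\<omega>. X0 \<omega> - m) borel f0"
    unfolding f0_def[abs_def] by (rule indep_fun[of "\<lambda>x. x - m" f]) measurable
  have fg_int: "integrable M (\<lambda>\<omega>. f0 \<omega> * g0 \<omega>)"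
  proof (rule Bochner_Integration.integrable_bound)
    show "integrable M (\<lambda>\<omega>. (f0 \<omega>)\<^sup>2 + (g0 \<omega>)\<^sup>2)" using f2 g2 by (simp add: f0_def g0_def)
    have "\<bar>s * t\<bar> \<le> s\<^sup>2 + t\<^sup>2" for s t :: real
    proof -
      have "2 * (\<bar>s\<bar> * \<bar>t\<bar>) \<le> s\<^sup>2 + t\<^sup>2"
        using zero_le_power2[of "\<bar>s\<bar> - \<bar>t\<bar>"] by (simp add: power2_diff)
      moreover have "0 \<le> \<bar>s\<bar> * \<bar>t\<bar>" by simp
      ultimately show ?thesis unfolding abs_mult by linarith
    qed
    then have "norm (f0 \<omega> * g0 \<omega>) \<le> norm ((f0 \<omega>)\<^sup>2 + (g0 \<omega>)\<^sup>2)" for \<omega>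
      unfolding real_norm_def by (rule order_trans[OF _ abs_ge_self])
    then show "AE \<omega> in M. norm (f0 \<omega> * g0 \<omega>) \<le> norm ((f0 \<omega>)\<^sup>2 + (g0 \<omega>)\<^sup>2)" by (rule AE_I2)
  qed measurable
  note I1 = indep_var_integrable[OF i1 Xc2_int f2[folded f0_def]] indep_var_lebesgue_integral[OF i1 Xc2_int f2[folded f0_def]]
  note I2 = indep_var_integrable[OF i2 Xc_int fg_int] indep_var_lebesgue_integral[OF i2 Xc_int fg_int]
  note I3 = indep_var_integrable[OF i3 Xc_int f0_int] indep_var_lebesgue_integral[OF i3 Xc_int f0_int]
  have F: "F = (\<lambda>\<omega>. (X0 \<omega> - m) * f0 \<omega> + g0 \<omega>)" unfolding F_def m_def f0_def g0_def ..
  have F2: "(F \<omega>)\<^sup>2 = (X0 \<omega> - m)\<^sup>2 * (f0 \<omega>)\<^sup>2 + (2 * ((X0 \<omega> - m) * (f0 \<omega> * g0 \<omega>)) + (g0 \<omega>)\<^sup>2)" for \<omega>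
    unfolding F by (simp add: power2_sum power_mult_distrib)
  note g2' = g2[folded g0_def]
  show "integrable M (\<lambda>\<omega>. (F \<omega>)\<^sup>2)"
    unfolding F2 by (intro Bochner_Integration.integrable_add integrable_mult_right I1 I2 g2')
  have "expectation F = expectation (\<lambda>\<omega>. (X0 \<omega> - m) * f0 \<omega>) + expectation g0"
    unfolding F by (rule Bochner_Integration.integral_add[OF I3(1) g0_int])
  then show "expectation F = expectation (\<lambda>\<omega>. g (D0 \<omega>) (E0 \<omega>))"
    using I3(2) Xc_mean by (simp add: g0_def[abs_def])
  have "expectation (\<lambda>\<omega>. (F \<omega>)\<^sup>2) = expectation (\<lambda>\<omega>. (X0 \<omega> - m)\<^sup>2 * (f0 \<omega>)\<^sup>2)
      + (expectation (\<lambda>\<omega>. 2 * ((X0 \<omega> - m) * (f0 \<omega> * g0 \<omega>))) + expectation (\<lambda>\<omega>. (g0 \<omega>)\<^sup>2))"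
    unfolding F2
    by (subst Bochner_Integration.integral_add, (intro Bochner_Integration.integrable_add integrable_mult_right I1 I2 g2')+,
        subst Bochner_Integration.integral_add, (intro integrable_mult_right I2 g2')+, rule refl)
  then show "expectation (\<lambda>\<omega>. (F \<omega>)\<^sup>2) = variance X0 * expectation (\<lambda>\<omega>. (f (D0 \<omega>) (E0 \<omega>))\<^sup>2)
      + expectation (\<lambda>\<omega>. (g (D0 \<omega>) (E0 \<omega>))\<^sup>2)"
    using I1(2) I2(2) Xc_mean by (simp add: f0_def g0_def m_def)
qed

lemma X_meas: "i \<ge> 1 \<Longrightarrow> X i \<in> borel_measurable M"
  by (rule iid_measurable(2)[OF iid_X])

lemma err_meas: "i \<ge> 1 \<Longrightarrow> err p q i \<in> borel_measurable M"
  by (rule iid_measurable(2)[OF iid_err])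

lemma S_X_err_null:
  assumes "c = 0 \<or> c = 1"
  shows "prob_null M (\<lambda>n \<omega>. S_of c X (err p q) n \<omega>)"
  using S_tendsto[OF assms iid_X X_int iid_err err0_int iid_X_err X_err_int, of p q]
  by (simp add: X_err_mean err0_mean)

lemma S_err_err_tendsto:
  assumes "c = 0 \<or> c = 1"
  shows "prob_null M (\<lambda>n \<omega>. S_of c (err p q) (err p' q') n \<omega>
    - err_cov p q p' q')"
  using S_tendsto[OF assms iid_err err0_int iid_err err0_int iid_err_err err0_mult_int, of p q p' q']
  by (simp add: err0_mean)

lemma smean_X_tendsto: "prob_null M (\<lambda>n \<omega>. mean_of X n \<omega> - expectation X0)"
  unfolding smean_def by (rule weak_law_of_large_numbers[OF iid_X X_int])

lemma smean_err_null: "prob_null M (\<lambda>n \<omega>. mean_of (err p q) n \<omega>)"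
  unfolding smean_def using weak_law_of_large_numbers[OF iid_err err0_int, of p q] by (simp add: err0_mean)

lemma sqrt_smean_err_bounded: "prob_bounded M (\<lambda>n \<omega>. sqrt (real n) * mean_of (err p q) n \<omega>)"
proof -
  have "sqrt (real n) * mean_of (err p q) n \<omega> = (\<Sum>i=1..n. err p q i \<omega>) / sqrt (real n)" for n \<omega>
  proof -
    have "sqrt (real n) * (s / real n) = s / sqrt (real n)" for s
      by (cases "n = 0") (simp_all add: field_simps)
    then show ?thesis unfolding smean_def .
  qed
  then show ?thesis
    using iid_sum_bounded[OF iid_err err0_sq_int err0_mean, of p q] by simp
qed

end

section \<open>Linearization of the estimators\<close>

context structural_errors
begin

lemma S_obs_expand:
  assumes "(c = 0 \<and> a0 = 0 \<and> b0 = 0) \<or> c = 1" "n \<ge> 1"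
  shows "S_of c (obs a a0 p q) (obs b b0 p' q') n \<omega> = a * b * S_of c X X n \<omega>
    + a * S_of c X (err p' q') n \<omega> + b * S_of c X (err p q) n \<omega> + S_of c (err p q) (err p' q') n \<omega>"
  unfolding obs_def by (rule S_affine_expand[OF assms])

lemma S_obs_err:
  assumes "(c = 0 \<and> a0 = 0) \<or> c = 1" "n \<ge> 1"
  shows "S_of c (obs a a0 p q) (err p' q') n \<omega>
    = a * S_of c X (err p' q') n \<omega> + S_of c (err p q) (err p' q') n \<omega>"
proof -
  have "(c = 0 \<and> a0 = 0 \<and> (0::real) = 0) \<or> c = 1" using assms(1) by blast
  from S_obs_expand[OF this assms(2), where a=a and b=0 and p=p and q=q and p'=p' and q'=q' and \<omega>=\<omega>]
  show ?thesis by (simp add: obs_def)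
qed

lemma S_resid:
  assumes "c = 0 \<or> c = 1"
  shows "S_of c U (resid \<beta>) n \<omega> = S_of c U (err 1 0) n \<omega> - \<beta> * S_of c U (err 0 1) n \<omega>"
  using S_linear_right[OF assms, of "\<lambda>i. U i \<omega>" "\<lambda>i. err 1 0 i \<omega>" \<beta> "\<lambda>i. err 0 1 i \<omega>"]
  by (simp add: err_def)

text \<open>The slope estimators are, with high probability, quotients of two such centred sample moments.\<close>

lemma S_obs_tendsto:
  assumes c: "(c = 0 \<and> a0 = 0 \<and> b0 = 0) \<or> c = 1"
    and inv: "(\<lambda>n. 1 / l n) \<longlonglongrightarrow> r"
    and SXX: "prob_null M (\<lambda>n \<omega>. S_of c X X n \<omega> / (l n)\<^sup>2 - K)"
  shows "prob_null M (\<lambda>n \<omega>.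
    (S_of c (obs a a0 p q) (obs b b0 p' q') n \<omega> - err_cov p q p' q') / (l n)\<^sup>2 - a * b * K)"
proof -
  have c': "c = 0 \<or> c = 1" using c by blast
  have inv2: "(\<lambda>n. (1 / l n) * (1 / l n)) \<longlonglongrightarrow> r * r" by (intro tendsto_mult inv)
  have "prob_null M (\<lambda>n \<omega>. a * b * (S_of c X X n \<omega> / (l n)\<^sup>2 - K)
    + (a * S_of c X (err p' q') n \<omega> + b * S_of c X (err p q) n \<omega>
       + (S_of c (err p q) (err p' q') n \<omega> - err_cov p q p' q')) * ((1 / l n) * (1 / l n)))"
    by (intro prob_null_add prob_null_cmult prob_null_mult SXX S_X_err_null S_err_err_tendsto c'
        prob_bounded_const[OF inv2])
  then show ?thesis
  proof (rule prob_null_cong_eventually)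
    fix n \<omega> assume n: "1 \<le> (n::nat)"
    have ring: "(a * b * s + u + v + w - e) / L\<^sup>2 - a * b * K
        = a * b * (s / L\<^sup>2 - K) + (u + v + (w - e)) * ((1 / L) * (1 / L))"
      for s u v w e L :: real
      by (simp add: power2_eq_square add_divide_distrib diff_divide_distrib algebra_simps)
    show "(S_of c (obs a a0 p q) (obs b b0 p' q') n \<omega> - err_cov p q p' q') / (l n)\<^sup>2 - a * b * K
      = a * b * (S_of c X X n \<omega> / (l n)\<^sup>2 - K)
        + (a * S_of c X (err p' q') n \<omega> + b * S_of c X (err p q) n \<omega>
          + (S_of c (err p q) (err p' q') n \<omega> - err_cov p q p' q')) * ((1 / l n) * (1 / l n))"
      unfolding S_obs_expand[OF c n] by (rule ring)
  qed
qed

text \<open>The contribution of the \<open>i\<close>-th observation to the error of the slope estimator, up to the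
  factor \<open>1 / (a K)\<close>.\<close>

definition score :: "real \<Rightarrow> real \<Rightarrow> real \<Rightarrow> real \<Rightarrow> real \<Rightarrow> nat \<Rightarrow> 'a \<Rightarrow> real" where
  "score \<beta> c a p q i \<omega> = a * ((X i \<omega> - c * expectation X0) * resid \<beta> i \<omega>)
     + (err p q i \<omega> * resid \<beta> i \<omega> - err_cov p q 1 (- \<beta>))"

definition normed_score ::
  "(nat \<Rightarrow> real) \<Rightarrow> real \<Rightarrow> real \<Rightarrow> real \<Rightarrow> real \<Rightarrow> real \<Rightarrow> nat \<Rightarrow> 'a \<Rightarrow> real" where
  "normed_score l \<beta> c a p q n \<omega> = (\<Sum>i=1..n. score \<beta> c a p q i \<omega>) / (sqrt (real n) * l n)"

definition normed_resid :: "real \<Rightarrow> nat \<Rightarrow> 'a \<Rightarrow> real" where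
  "normed_resid \<beta> n \<omega> = (\<Sum>i=1..n. resid \<beta> i \<omega>) / sqrt (real n)"

lemma score_measurable: "i \<ge> 1 \<Longrightarrow> score \<beta> c a p q i \<in> borel_measurable M"
  using X_meas err_meas unfolding score_def[abs_def]
  by (intro borel_measurable_add borel_measurable_diff borel_measurable_times borel_measurable_const) auto

lemma normed_score_measurable: "normed_score l \<beta> c a p q n \<in> borel_measurable M"
  unfolding normed_score_def[abs_def] using score_measurable
  by (intro borel_measurable_divide borel_measurable_sum borel_measurable_const) auto

lemma normed_resid_measurable: "normed_resid \<beta> n \<in> borel_measurable M"
  unfolding normed_resid_def[abs_def] using err_meas
  by (intro borel_measurable_divide borel_measurable_sum borel_measurable_const) auto

text \<open>If \<open>c = 1\<close>, then \<open>S_of\<close> subtracts products of sample means; replacing the sample mean of the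
  \<open>X i\<close> by the true mean and dropping the means of the errors changes the normed numerator by
  products of a bounded and a null sequence.\<close>

lemma numerator_linearization:
  assumes c: "(c = 0 \<and> a0 = 0) \<or> c = 1" and inv: "(\<lambda>n. 1 / l n) \<longlonglongrightarrow> r"
  shows "prob_null M (\<lambda>n \<omega>. sqrt (real n) / l n *
       (S_of c (obs a a0 p q) (resid \<beta>) n \<omega> - err_cov p q 1 (- \<beta>)) - normed_score l \<beta> c a p q n \<omega>)"
proof -
  have c': "c = 0 \<or> c = 1" using c by blast
  let ?e = "err_cov p q 1 (- \<beta>)" and ?m = "expectation X0" and ?eta = "resid \<beta>"
  have "prob_null M (\<lambda>n \<omega>. (a * (mean_of X n \<omega> - ?m) + mean_of (err p q) n \<omega>)
      * (sqrt (real n) * mean_of ?eta n \<omega>) * (- c * (1 / l n)))"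
    by (intro prob_null_mult prob_null_add prob_null_cmult smean_X_tendsto smean_err_null
          sqrt_smean_err_bounded prob_bounded_const[where c="- c * r"] tendsto_mult tendsto_const inv)
  then show ?thesis
  proof (rule prob_null_cong_eventually)
    fix n \<omega> assume n: "1 \<le> (n::nat)"
    let ?Xe = "smean (\<lambda>i. X i \<omega> * ?eta i \<omega>) n" and ?pe = "smean (\<lambda>i. err p q i \<omega> * ?eta i \<omega>) n"
      and ?X = "mean_of X n \<omega>" and ?p = "mean_of (err p q) n \<omega>" and ?et = "mean_of ?eta n \<omega>"
    have num: "S_of c (obs a a0 p q) ?eta n \<omega> = a * (?Xe - c * (?X * ?et)) + (?pe - c * (?p * ?et))"
      unfolding S_obs_err[OF c n] by (simp add: S_eq_smean[OF c'])
    have "smean (\<lambda>i. score \<beta> c a p q i \<omega>) n = smean (\<lambda>i. a * (X i \<omega> * ?eta i \<omega>)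
        - a * c * ?m * ?eta i \<omega> + (err p q i \<omega> * ?eta i \<omega> - ?e)) n"
      unfolding score_def by (simp add: algebra_simps)
    also have "\<dots> = a * ?Xe - a * c * ?m * ?et + (?pe - ?e)"
      using n by (simp only: smean_add smean_diff smean_cmult smean_const)
    finally have "(\<Sum>i=1..n. score \<beta> c a p q i \<omega>) = real n * (a * ?Xe - a * c * ?m * ?et + (?pe - ?e))"
      using n unfolding smean_def[of "\<lambda>i. score \<beta> c a p q i \<omega>"] by (simp add: field_simps)
    moreover have "(real n * z) / (sqrt (real n) * l n) = sqrt (real n) / l n * z" for z
    proof -
      have "(real n * z) / (sqrt (real n) * l n) = real n / sqrt (real n) / l n * z" by simp
      then show ?thesis by (simp only: real_div_sqrt of_nat_0_le_iff)
    qed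
    ultimately have sc: "normed_score l \<beta> c a p q n \<omega>
        = sqrt (real n) / l n * (a * ?Xe - a * c * ?m * ?et + (?pe - ?e))"
      unfolding normed_score_def by simp
    have ring: "R / L * (a * (Xe - c * (Xm * et)) + (pe - c * (pm * et)) - e)
        - R / L * (a * Xe - a * c * m * et + (pe - e))
       = (a * (Xm - m) + pm) * (R * et) * (- c * (1 / L))" for R L Xe Xm et pe pm e m :: real
      by (simp add: right_diff_distrib[symmetric] divide_inverse) (simp add: algebra_simps)
    show "sqrt (real n) / l n * (S_of c (obs a a0 p q) ?eta n \<omega> - ?e) - normed_score l \<beta> c a p q n \<omega>
       = (a * (?X - ?m) + ?p) * (sqrt (real n) * ?et) * (- c * (1 / l n))"
      unfolding num sc by (rule ring)
  qed
qed

text \<open>What the law of the regressor has to provide: \<open>K\<close> is the limit in probability of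
  \<open>S_of c X X / l\<^sup>2\<close>, and \<open>k\<close> that of the sample mean of the \<open>x i\<close>, divided by \<open>l\<close>. The errors of the two
  estimators behave like multiples of the two normed sums.\<close>

definition score_limits ::
  "(nat \<Rightarrow> real) \<Rightarrow> real \<Rightarrow> real \<Rightarrow> real \<Rightarrow> real \<Rightarrow> real \<Rightarrow> real \<Rightarrow> real \<Rightarrow> real \<Rightarrow> real \<Rightarrow> real \<Rightarrow> bool" where
  "score_limits l \<beta> c a p q r K k v d \<longleftrightarrow>
     (\<lambda>n. 1 / l n) \<longlonglongrightarrow> r \<and> (\<lambda>n. expectation X0 / l n) \<longlonglongrightarrow> k \<and>
     K > 0 \<and> prob_null M (\<lambda>n \<omega>. S_of c X X n \<omega> / (l n)\<^sup>2 - K) \<and>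
     v > 0 \<and> tends_to_normal M (normed_score l \<beta> c a p q) v \<and>
     d > 0 \<and> tends_to_normal M
       (\<lambda>n \<omega>. normed_resid \<beta> n \<omega> - k / (a * K) * normed_score l \<beta> c a p q n \<omega>) d"

text \<open>Let \<open>w = obs a a0 p q\<close> be the observations that occur in both moments of the quotient \<open>bh\<close>. Then
  \<open>bh - \<beta>\<close> is \<open>S_of c w (resid \<beta>)\<close> minus its limit, over the denominator, since \<open>y - \<beta> x\<close> is the
  residual up to a constant. The numerator has been linearized, and the denominator divided by
  \<open>l\<^sup>2\<close> tends to \<open>a K\<close>. For the intercept, \<open>smean y - smean x bh - \<alpha>\<close> equals the mean of the residuals minus
  \<open>smean x (bh - \<beta>)\<close>.\<close>

theorem quotient_estimator_limits:
  assumes c: "(c = 0 \<and> a0 = 0 \<and> \<alpha> = 0) \<or> c = 1"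
    and l: "\<forall>n\<ge>1. l n > 0" and a: "a \<noteq> 0"
    and lims: "score_limits l \<beta> c a p q r K k v d"
    and est: "whp M (\<lambda>n \<omega>. bh n \<omega> =
        (S_of c (obs a a0 p q) (obs \<beta> \<alpha> 1 0) n \<omega> - err_cov p q 1 0)
      / (S_of c (obs a a0 p q) (obs 1 0 0 1) n \<omega> - err_cov p q 0 1))"
    and bh_meas: "\<And>n. bh n \<in> borel_measurable M"
  shows "tends_to_normal M (\<lambda>n \<omega>. sqrt (real n) * l n * (bh n \<omega> - \<beta>)) ((1 / (a * K))\<^sup>2 * v)"
    and "tends_to_normal M (\<lambda>n \<omega>. sqrt (real n) *
       (mean_of (obs \<beta> \<alpha> 1 0) n \<omega> - mean_of (obs 1 0 0 1) n \<omega> * bh n \<omega> - \<alpha>)) d"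
proof -
  have inv: "(\<lambda>n. 1 / l n) \<longlonglongrightarrow> r" and k: "(\<lambda>n. expectation X0 / l n) \<longlonglongrightarrow> k"
    and K: "K > 0" and SXX: "prob_null M (\<lambda>n \<omega>. S_of c X X n \<omega> / (l n)\<^sup>2 - K)"
    and v: "v > 0" and T: "tends_to_normal M (normed_score l \<beta> c a p q) v"
    and d: "d > 0" and T': "tends_to_normal M
       (\<lambda>n \<omega>. normed_resid \<beta> n \<omega> - k / (a * K) * normed_score l \<beta> c a p q n \<omega>) d"
    using lims unfolding score_limits_def by blast+
  have c': "c = 0 \<or> c = 1" and c0: "(c = 0 \<and> a0 = 0) \<or> c = 1"
    and c1: "(c = 0 \<and> a0 = 0 \<and> (0::real) = 0) \<or> c = 1" using c by blast+
  let ?w = "obs a a0 p q" and ?y = "obs \<beta> \<alpha> 1 0" and ?x = "obs 1 0 0 1"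
  define Sc where "Sc = normed_score l \<beta> c a p q"
  define U where "U n \<omega> = sqrt (real n) / l n * (S_of c ?w (resid \<beta>) n \<omega> - err_cov p q 1 (- \<beta>))" for n \<omega>
  define den where "den n \<omega> = S_of c ?w ?x n \<omega> - err_cov p q 0 1" for n \<omega>
  define B where "B n \<omega> = sqrt (real n) * l n * (bh n \<omega> - \<beta>)" for n \<omega>
  have Sc_meas: "Sc n \<in> borel_measurable M" for n unfolding Sc_def by (rule normed_score_measurable)
  have B_meas: "B n \<in> borel_measurable M" for n
    unfolding B_def[abs_def] using bh_meas
    by (intro borel_measurable_times borel_measurable_diff borel_measurable_const) auto
  have T1: "tends_to_normal M Sc v" using T by (simp only: Sc_def)
  have aK: "a * K \<noteq> 0" using a K by simp
  have US: "prob_null M (\<lambda>n \<omega>. U n \<omega> - Sc n \<omega>)"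
    unfolding U_def Sc_def by (rule numerator_linearization[OF c0 inv])
  have VK: "prob_null M (\<lambda>n \<omega>. den n \<omega> / (l n)\<^sup>2 - a * K)"
    using S_obs_tendsto[OF c1 inv SXX, of a p q 1 0 1] unfolding den_def by simp
  have U_bdd: "prob_bounded M U"
    by (rule prob_bounded_add_null[OF tends_to_normal_bounded[OF T1 v Sc_meas] US])
  have "prob_null M (\<lambda>n \<omega>. inverse (den n \<omega> / (l n)\<^sup>2) - inverse (a * K))"
    using aK by (intro prob_null_continuous[OF VK] isCont_def[THEN iffD2] tendsto_inverse tendsto_ident_at)
  then have "prob_null M (\<lambda>n \<omega>. (inverse (den n \<omega> / (l n)\<^sup>2) - inverse (a * K)) * U n \<omega>
      + inverse (a * K) * (U n \<omega> - Sc n \<omega>))"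
    by (intro prob_null_add prob_null_mult prob_null_cmult U_bdd US)
  then have main: "prob_null M (\<lambda>n \<omega>. U n \<omega> / (den n \<omega> / (l n)\<^sup>2) - 1 / (a * K) * Sc n \<omega>)"
    by (simp add: divide_inverse algebra_simps)
  have en_eq: "err_cov p q 1 (- \<beta>) = err_cov p q 1 0 - \<beta> * err_cov p q 0 1"
  proof -
    have "err0 p q \<omega> * resid0 \<beta> \<omega> = err0 p q \<omega> * err0 1 0 \<omega> - \<beta> * (err0 p q \<omega> * err0 0 1 \<omega>)" for \<omega>
      by (simp add: err0_def algebra_simps)
    then show ?thesis by (simp add: err0_mult_int)
  qed
  have num_eq: "S_of c ?w ?y n \<omega> - \<beta> * S_of c ?w ?x n \<omega> = S_of c ?w (resid \<beta>) n \<omega>" if "n \<ge> 1" for n \<omega>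
    unfolding S_obs_expand[OF c that] S_obs_expand[OF c1 that] S_obs_err[OF c0 that] S_resid[OF c']
    by (simp add: algebra_simps)
  have "whp M (\<lambda>n \<omega>. B n \<omega> = U n \<omega> / (den n \<omega> / (l n)\<^sup>2))"
  proof (rule whp_mono[OF whp_conj[OF est whp_nonzero[OF VK aK]]], intro eventually_sequentiallyI[of 1] ballI impI)
    fix n \<omega> assume n: "1 \<le> (n::nat)"
    assume h: "bh n \<omega> = (S_of c ?w ?y n \<omega> - err_cov p q 1 0) / (S_of c ?w ?x n \<omega> - err_cov p q 0 1)
      \<and> den n \<omega> / (l n)\<^sup>2 \<noteq> 0"
    then have bh: "bh n \<omega> = (S_of c ?w ?y n \<omega> - err_cov p q 1 0) / den n \<omega>" and den: "den n \<omega> \<noteq> 0"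
      by (auto simp: den_def)
    have "bh n \<omega> - \<beta> = ((S_of c ?w ?y n \<omega> - err_cov p q 1 0) - \<beta> * den n \<omega>) / den n \<omega>"
      using den by (simp add: bh field_simps)
    also have "(S_of c ?w ?y n \<omega> - err_cov p q 1 0) - \<beta> * den n \<omega> = S_of c ?w (resid \<beta>) n \<omega> - err_cov p q 1 (- \<beta>)"
      unfolding num_eq[OF n, symmetric] en_eq den_def by (simp add: algebra_simps)
    finally have diff: "bh n \<omega> - \<beta> = (S_of c ?w (resid \<beta>) n \<omega> - err_cov p q 1 (- \<beta>)) / den n \<omega>" .
    show "B n \<omega> = U n \<omega> / (den n \<omega> / (l n)\<^sup>2)"
      unfolding B_def U_def diff using l[rule_format, OF n] den by (simp add: field_simps power2_eq_square)
  qed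
  then have "whp M (\<lambda>n \<omega>. \<bar>B n \<omega> - 1 / (a * K) * Sc n \<omega>\<bar>
      \<le> \<bar>U n \<omega> / (den n \<omega> / (l n)\<^sup>2) - 1 / (a * K) * Sc n \<omega>\<bar>)"
    by (rule whp_mono) (simp add: always_eventually)
  then have BS: "prob_null M (\<lambda>n \<omega>. B n \<omega> - 1 / (a * K) * Sc n \<omega>)"
    by (rule prob_null_dominated_whp[OF main])
  have T2: "tends_to_normal M (\<lambda>n \<omega>. 1 / (a * K) * Sc n \<omega>) ((1 / (a * K))\<^sup>2 * v)"
    by (rule tends_to_normal_cmult[OF T1 v _ Sc_meas]) (use aK in simp)
  have v2: "(1 / (a * K))\<^sup>2 * v > 0" using aK v by (intro mult_pos_pos) (simp_all add: zero_less_power2)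
  have cSc_meas: "(\<lambda>\<omega>. z * Sc n \<omega>) \<in> borel_measurable M" for z n
    using Sc_meas by (intro borel_measurable_times borel_measurable_const)
  have T3: "tends_to_normal M B ((1 / (a * K))\<^sup>2 * v)"
    by (rule tends_to_normal_add_null[OF T2 v2 cSc_meas B_meas BS])
  then show "tends_to_normal M (\<lambda>n \<omega>. sqrt (real n) * l n * (bh n \<omega> - \<beta>)) ((1 / (a * K))\<^sup>2 * v)"
    by (simp only: B_def[abs_def])
  define Z where "Z n \<omega> = normed_resid \<beta> n \<omega> - k / (a * K) * Sc n \<omega>" for n \<omega>
  define A where "A n \<omega> = sqrt (real n) * (mean_of ?y n \<omega> - mean_of ?x n \<omega> * bh n \<omega> - \<alpha>)" for n \<omega>
  have mx: "mean_of ?x n \<omega> = mean_of X n \<omega> + mean_of (err 0 1) n \<omega>" for n \<omega>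
    unfolding obs_def by (simp add: smean_add)
  have xk: "prob_null M (\<lambda>n \<omega>. mean_of ?x n \<omega> / l n - k)"
  proof -
    have "prob_null M (\<lambda>n \<omega>. ((mean_of X n \<omega> - expectation X0) + mean_of (err 0 1) n \<omega>) * (1 / l n)
        + (expectation X0 / l n - k))"
      using k by (intro prob_null_add prob_null_mult smean_X_tendsto smean_err_null
          prob_bounded_const[OF inv] prob_null_const) (simp add: LIM_zero_iff)
    then show ?thesis
      by (rule prob_null_cong_eventually) (simp add: mx add_divide_distrib diff_divide_distrib)
  qed
  have "prob_null M (\<lambda>n \<omega>. - ((mean_of ?x n \<omega> / l n - k) * B n \<omega> + k * (B n \<omega> - 1 / (a * K) * Sc n \<omega>)))"
    by (intro prob_null_minus prob_null_add prob_null_mult prob_null_cmult xk BS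
        tends_to_normal_bounded[OF T3 v2 B_meas])
  then have AZ: "prob_null M (\<lambda>n \<omega>. A n \<omega> - Z n \<omega>)"
  proof (rule prob_null_cong_eventually)
    fix n \<omega> assume n: "1 \<le> (n::nat)"
    let ?D = "mean_of (err 1 0) n \<omega>" and ?E = "mean_of (err 0 1) n \<omega>"
    have my: "mean_of ?y n \<omega> = \<beta> * mean_of X n \<omega> + \<alpha> + ?D"
      using n unfolding obs_def by (simp add: smean_add smean_cmult smean_const)
    have "mean_of (resid \<beta>) n \<omega> = smean (\<lambda>i. err 1 0 i \<omega> - \<beta> * err 0 1 i \<omega>) n"
      by (simp add: err_def)
    also have "\<dots> = ?D - \<beta> * ?E" by (simp only: smean_diff smean_cmult)
    finally have "(\<Sum>i=1..n. resid \<beta> i \<omega>) = real n * (?D - \<beta> * ?E)"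
      using n unfolding smean_def[of "\<lambda>i. resid \<beta> i \<omega>"] by (simp add: field_simps)
    moreover have "(real n * z) / sqrt (real n) = sqrt (real n) * z" for z
    proof -
      have "(real n * z) / sqrt (real n) = real n / sqrt (real n) * z" by simp
      then show ?thesis by (simp only: real_div_sqrt of_nat_0_le_iff)
    qed
    ultimately have me: "normed_resid \<beta> n \<omega> = sqrt (real n) * (?D - \<beta> * ?E)"
      unfolding normed_resid_def by simp
    have xB: "mean_of ?x n \<omega> / l n * B n \<omega> = sqrt (real n) * (mean_of ?x n \<omega> * (bh n \<omega> - \<beta>))"
      using l[rule_format, OF n] by (simp add: B_def)
    have "A n \<omega> = sqrt (real n) * (?D - \<beta> * ?E) - mean_of ?x n \<omega> / l n * B n \<omega>"
      unfolding A_def xB unfolding my mx by (simp add: algebra_simps)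
    then show "A n \<omega> - Z n \<omega> = - ((mean_of ?x n \<omega> / l n - k) * B n \<omega> + k * (B n \<omega> - 1 / (a * K) * Sc n \<omega>))"
      unfolding Z_def me by (simp add: left_diff_distrib right_diff_distrib)
  qed
  have A_meas: "A n \<in> borel_measurable M" for n
  proof -
    have "(\<lambda>\<omega>. mean_of ?y n \<omega>) \<in> borel_measurable M" "(\<lambda>\<omega>. mean_of ?x n \<omega>) \<in> borel_measurable M"
      unfolding smean_def obs_def using X_meas err_meas
      by (intro borel_measurable_divide borel_measurable_sum borel_measurable_add borel_measurable_times borel_measurable_const; simp)+
    then show ?thesis unfolding A_def[abs_def] using bh_meas
      by (intro borel_measurable_times borel_measurable_diff borel_measurable_const)
  qed
  have Z_meas: "Z n \<in> borel_measurable M" for n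
    unfolding Z_def[abs_def] by (intro borel_measurable_diff normed_resid_measurable cSc_meas)
  have "tends_to_normal M Z d" using T' by (simp only: Z_def[abs_def] Sc_def)
  from tends_to_normal_add_null[OF this d Z_meas A_meas AZ]
  show "tends_to_normal M (\<lambda>n \<omega>. sqrt (real n) *
       (mean_of ?y n \<omega> - mean_of ?x n \<omega> * bh n \<omega> - \<alpha>)) d"
    by (simp only: A_def[abs_def])
qed

end

section \<open>Regressors of infinite and of finite variance\<close>

context prob_space
begin

lemma tends_to_normal_cong:
  assumes "\<And>n \<omega>. \<omega> \<in> space M \<Longrightarrow> Z n \<omega> = W n \<omega>"
  shows "tends_to_normal M Z v \<longleftrightarrow> tends_to_normal M W v"
proof -
  have "distr M borel (Z n) = distr M borel (W n)" for n
    by (rule distr_cong) (use assms in auto)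
  then show ?thesis by (simp add: tends_to_normal_def)
qed

lemma tends_to_normal_cong_eventually:
  assumes "tends_to_normal M Z v" "v > 0" "\<And>n. Z n \<in> borel_measurable M" "\<And>n. W n \<in> borel_measurable M"
    and "\<And>n \<omega>. n \<ge> 1 \<Longrightarrow> \<omega> \<in> space M \<Longrightarrow> W n \<omega> = Z n \<omega>"
  shows "tends_to_normal M W v"
proof (rule tends_to_normal_add_null[OF assms(1-4)])
  have "prob_null M (\<lambda>n \<omega>. 0)" by (rule prob_null_const) simp
  then show "prob_null M (\<lambda>n \<omega>. W n \<omega> - Z n \<omega>)"
    by (rule prob_null_cong_eventually) (simp add: assms(5))
qed

end

context structural_errors
begin

lemma err0_mult_centred_sq: "integrable M (\<lambda>\<omega>. (err0 p q \<omega> * err0 p' q' \<omega> - z)\<^sup>2)"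
  unfolding power2_diff
  by (intro Bochner_Integration.integrable_add Bochner_Integration.integrable_diff err0_mult_sq
      integrable_const integrable_mult_right integrable_mult_left err0_mult_int)

text \<open>The norming constants \<open>sqrt n * l n\<close> grow faster than \<open>sqrt n\<close>. Hence only the part
  \<open>a X i (resid i)\<close> of the scores contributes to the normed scores, and the mean of the \<open>x i\<close> is
  negligible against \<open>l\<close>, so that the normed residuals alone determine the limit of the intercept.\<close>

lemma score_limits_infinite_variance:
  assumes inf: "\<not> integrable M (\<lambda>\<omega>. (X0 \<omega>)\<^sup>2)"
    and l: "filterlim l at_top sequentially"
    and clt: "tends_to_normal M
      (\<lambda>n \<omega>. ((\<Sum>i=1..n. X i \<omega>) - real n * expectation X0) / (sqrt (real n) * l n)) 1"
    and eta: "expectation (\<lambda>\<omega>. (resid0 \<beta> \<omega>)\<^sup>2) > 0"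
    and a: "a \<noteq> 0" and c: "c = 0 \<or> c = 1"
  shows "\<exists>r K k v d. score_limits l \<beta> c a p q r K k v d"
proof -
  let ?m = "expectation X0" and ?e = "err_cov p q 1 (- \<beta>)"
  define \<sigma>2 where "\<sigma>2 = expectation (\<lambda>\<omega>. (resid0 \<beta> \<omega>)\<^sup>2)"
  have \<sigma>2: "\<sigma>2 > 0" using eta by (simp add: \<sigma>2_def)
  have inv: "(\<lambda>n. z / l n) \<longlonglongrightarrow> 0" for z
    using l by (intro tendsto_divide_0[OF tendsto_const] filterlim_at_top_imp_at_infinity)
  have inv2: "(\<lambda>n. (1 / l n) * (1 / l n)) \<longlonglongrightarrow> 0" using tendsto_mult[OF inv[of 1] inv[of 1]] by simp
  have b: "filterlim (\<lambda>n. sqrt (real n) * l n) at_top sequentially"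
    using filterlim_compose[OF sqrt_at_top filterlim_real_sequentially] l by (rule filterlim_at_top_mult_at_top)
  note lap = normal_attraction_laplace_limit[OF iid_X inf b clt]
  have SXX: "prob_null M (\<lambda>n \<omega>. S_of c X X n \<omega> / (l n)\<^sup>2 - 1)"
  proof -
    have "prob_null M (\<lambda>n \<omega>. ((\<Sum>i=1..n. (X i \<omega>)\<^sup>2) / (sqrt (real n) * l n)\<^sup>2 - 1)
       - (1 / l n) * (1 / l n) * (c * (mean_of X n \<omega> * mean_of X n \<omega>)))"
      by (intro prob_null_diff prob_null_mult prob_null_const inv2 prob_bounded_mult prob_bounded_const[OF tendsto_const]
            prob_bounded_tendsto[OF smean_X_tendsto] normal_attraction_sum_squares[OF iid_X lap])
    moreover have "S_of c X X n \<omega> / (l n)\<^sup>2 - 1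
      = ((\<Sum>i=1..n. (X i \<omega>)\<^sup>2) / (sqrt (real n) * l n)\<^sup>2 - 1)
       - (1 / l n) * (1 / l n) * (c * (mean_of X n \<omega> * mean_of X n \<omega>))" for n \<omega>
    proof -
      have "smean (\<lambda>i. X i \<omega> * X i \<omega>) n / (l n)\<^sup>2 = (\<Sum>i=1..n. (X i \<omega>)\<^sup>2) / (sqrt (real n) * l n)\<^sup>2"
        by (simp add: smean_def power_mult_distrib power2_eq_square[of "X _ \<omega>"])
      then show ?thesis unfolding S_eq_smean[OF c]
        by (simp add: diff_divide_distrib) (simp add: power2_eq_square)
    qed
    ultimately show ?thesis by (simp only:)
  qed
  have meas: "(\<lambda>\<omega>. (\<Sum>i=1..n. X i \<omega> * resid \<beta> i \<omega>) / r) \<in> borel_measurable M" for n r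
    using X_meas err_meas
    by (intro borel_measurable_divide borel_measurable_sum borel_measurable_times borel_measurable_const) auto
  have "tends_to_normal M (\<lambda>n \<omega>. (\<Sum>i=1..n. X i \<omega> * resid \<beta> i \<omega>) / (sqrt (real n) * l n)) \<sigma>2"
    by (rule normal_attraction_product_clt[OF iid_X_err indep_X_err lap err0_sq_int err0_mean _ \<sigma>2])
       (simp_all add: \<sigma>2_def)
  then have T1: "tends_to_normal M
      (\<lambda>n \<omega>. a * ((\<Sum>i=1..n. X i \<omega> * resid \<beta> i \<omega>) / (sqrt (real n) * l n))) (a\<^sup>2 * \<sigma>2)"
    by (intro tends_to_normal_cmult \<sigma>2 a meas)
  have pos: "a\<^sup>2 * \<sigma>2 > 0" using a \<sigma>2 by simp
  have "iid_copies M borel (\<lambda>\<omega>. err0 p q \<omega> * resid0 \<beta> \<omega> - ?e) (\<lambda>i \<omega>. err p q i \<omega> * resid \<beta> i \<omega> - ?e)"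
    by (rule iid_compose[OF iid_err_err, of "\<lambda>z. z - ?e"]) measurable
  then have bdd: "prob_bounded M (\<lambda>n \<omega>. (\<Sum>i=1..n. err p q i \<omega> * resid \<beta> i \<omega> - ?e) / sqrt (real n))"
    by (rule iid_sum_bounded[OF _ err0_mult_centred_sq]) (simp add: err0_mult_int prob_space)
  have T: "tends_to_normal M (normed_score l \<beta> c a p q) (a\<^sup>2 * \<sigma>2)"
  proof (rule tends_to_normal_add_null[OF T1 pos _ normed_score_measurable])
    show "(\<lambda>\<omega>. a * ((\<Sum>i=1..n. X i \<omega> * resid \<beta> i \<omega>) / (sqrt (real n) * l n))) \<in> borel_measurable M" for n
      by (intro borel_measurable_times borel_measurable_const meas)
    have "score \<beta> c a p q i \<omega> = a * (X i \<omega> * resid \<beta> i \<omega>) - a * c * ?m * resid \<beta> i \<omega>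
        + (err p q i \<omega> * resid \<beta> i \<omega> - ?e)" for i \<omega>
      unfolding score_def by (simp add: algebra_simps)
    then have sum_score: "(\<Sum>i=1..n. score \<beta> c a p q i \<omega>) = a * (\<Sum>i=1..n. X i \<omega> * resid \<beta> i \<omega>)
        - a * c * ?m * (\<Sum>i=1..n. resid \<beta> i \<omega>) + (\<Sum>i=1..n. err p q i \<omega> * resid \<beta> i \<omega> - ?e)" for n \<omega>
      by (simp only: sum.distrib sum_subtractf sum_distrib_left)
    have "prob_null M (\<lambda>n \<omega>. (1 / l n) * ((- a * c * ?m) * ((\<Sum>i=1..n. resid \<beta> i \<omega>) / sqrt (real n)))
       + (1 / l n) * ((\<Sum>i=1..n. err p q i \<omega> * resid \<beta> i \<omega> - ?e) / sqrt (real n)))"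
      by (intro prob_null_add prob_null_mult[OF prob_null_const[OF inv]] prob_bounded_mult[OF prob_bounded_const[OF tendsto_const]]
            bdd iid_sum_bounded[OF iid_err err0_sq_int err0_mean])
    then show "prob_null M (\<lambda>n \<omega>. normed_score l \<beta> c a p q n \<omega>
       - a * ((\<Sum>i=1..n. X i \<omega> * resid \<beta> i \<omega>) / (sqrt (real n) * l n)))"
      unfolding normed_score_def sum_score by (simp add: add_divide_distrib diff_divide_distrib mult.commute)
  qed
  have clt_resid: "tends_to_normal M (normed_resid \<beta>) \<sigma>2"
    unfolding normed_resid_def[abs_def]
    by (rule iid_central_limit_theorem[OF iid_err err0_sq_int err0_mean \<sigma>2_def \<sigma>2])
  have "score_limits l \<beta> c a p q 0 1 0 (a\<^sup>2 * \<sigma>2) \<sigma>2"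
    unfolding score_limits_def using inv SXX pos T clt_resid \<sigma>2 by simp
  then show ?thesis by blast
qed

text \<open>Both normed sums, and hence their linear combinations, are normed sums of independent copies.
  The variance is positive by the decomposition above: if \<open>b \<noteq> 0\<close>, then the part
  \<open>b a (X i - E X0) (resid i)\<close> contributes, and otherwise the residual itself does.\<close>

lemma score_combination_clt:
  assumes X2: "integrable M (\<lambda>\<omega>. (X0 \<omega>)\<^sup>2)" and var: "variance X0 > 0"
    and eta: "expectation (\<lambda>\<omega>. (resid0 \<beta> \<omega>)\<^sup>2) > 0"
    and a: "a \<noteq> 0" and hb: "b \<noteq> 0 \<or> h \<noteq> 0"
  shows "\<exists>v>0. tends_to_normal M
    (\<lambda>n \<omega>. (\<Sum>i=1..n. h * resid \<beta> i \<omega> + b * score \<beta> c a p q i \<omega>) / sqrt (real n)) v"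
proof -
  let ?m = "expectation X0" and ?e = "err_cov p q 1 (- \<beta>)"
  define f where "f d e = b * (a * (1 * d + (- \<beta>) * e))" for d e :: real
  define g where "g d e = (h + b * (a * (?m - c * ?m))) * (1 * d + (- \<beta>) * e)
    + b * ((p * d + q * e) * (1 * d + (- \<beta>) * e) - ?e)" for d e :: real
  define F where "F \<omega> = (X0 \<omega> - ?m) * f (D0 \<omega>) (E0 \<omega>) + g (D0 \<omega>) (E0 \<omega>)" for \<omega>
  have fg_meas[measurable]: "(\<lambda>(d, e). f d e) \<in> borel_measurable (borel \<Otimes>\<^sub>M borel)"
    "(\<lambda>(d, e). g d e) \<in> borel_measurable (borel \<Otimes>\<^sub>M borel)"
    unfolding f_def g_def by measurable
  have f_eq: "f (D0 \<omega>) (E0 \<omega>) = b * a * resid0 \<beta> \<omega>" for \<omega>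
    by (simp add: f_def err0_def)
  have g_eq: "g (D0 \<omega>) (E0 \<omega>) = (h + b * (a * (?m - c * ?m))) * resid0 \<beta> \<omega>
      + b * (err0 p q \<omega> * resid0 \<beta> \<omega> - ?e)" for \<omega>
    by (simp add: g_def err0_def)
  have f2: "integrable M (\<lambda>\<omega>. (f (D0 \<omega>) (E0 \<omega>))\<^sup>2)"
    unfolding f_eq power_mult_distrib by (intro integrable_mult_right err0_sq_int)
  have g2: "integrable M (\<lambda>\<omega>. (g (D0 \<omega>) (E0 \<omega>))\<^sup>2)"
  proof (rule Bochner_Integration.integrable_bound)
    let ?U = "\<lambda>\<omega>. (h + b * (a * (?m - c * ?m))) * resid0 \<beta> \<omega>" and ?V = "\<lambda>\<omega>. b * (err0 p q \<omega> * resid0 \<beta> \<omega> - ?e)"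
    show "integrable M (\<lambda>\<omega>. 2 * (?U \<omega>)\<^sup>2 + 2 * (?V \<omega>)\<^sup>2)"
      unfolding power_mult_distrib
      by (intro Bochner_Integration.integrable_add integrable_mult_right err0_sq_int err0_mult_centred_sq)
    show "AE \<omega> in M. norm ((g (D0 \<omega>) (E0 \<omega>))\<^sup>2) \<le> norm (2 * (?U \<omega>)\<^sup>2 + 2 * (?V \<omega>)\<^sup>2)"
    proof (rule AE_I2)
      fix \<omega>
      have "(?U \<omega> + ?V \<omega>)\<^sup>2 \<le> 2 * (?U \<omega>)\<^sup>2 + 2 * (?V \<omega>)\<^sup>2"
        using zero_le_power2[of "?U \<omega> - ?V \<omega>"] unfolding power2_sum power2_diff by linarith
      then show "norm ((g (D0 \<omega>) (E0 \<omega>))\<^sup>2) \<le> norm (2 * (?U \<omega>)\<^sup>2 + 2 * (?V \<omega>)\<^sup>2)"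
        unfolding g_eq by simp
    qed
  qed measurable
  have g_mean: "expectation (\<lambda>\<omega>. g (D0 \<omega>) (E0 \<omega>)) = 0"
    unfolding g_eq by (simp add: err0_int err0_mult_int err0_mean prob_space)
  note sm = second_moment_decomposition[OF X2 fg_meas f2 g2, folded F_def]
  have "0 < expectation (\<lambda>\<omega>. (F \<omega>)\<^sup>2)"
  proof (cases "b = 0")
    case True
    then have "F \<omega> = h * resid0 \<beta> \<omega>" for \<omega> unfolding F_def f_eq g_eq by simp
    then show ?thesis using hb True eta by (simp add: power_mult_distrib)
  next
    case False
    have "expectation (\<lambda>\<omega>. (f (D0 \<omega>) (E0 \<omega>))\<^sup>2) = (b * a)\<^sup>2 * expectation (\<lambda>\<omega>. (resid0 \<beta> \<omega>)\<^sup>2)"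
      unfolding f_eq power_mult_distrib by simp
    moreover have "(b * a)\<^sup>2 > 0" using False a by simp
    ultimately show ?thesis
      unfolding sm(3) using var eta
      by (intro add_pos_nonneg mult_pos_pos Bochner_Integration.integral_nonneg) simp_all
  qed
  moreover have "iid_copies M borel F (\<lambda>i \<omega>. h * resid \<beta> i \<omega> + b * score \<beta> c a p q i \<omega>)"
  proof -
    have "iid_copies M borel (\<lambda>\<omega>. (X0 \<omega> - ?m) * f (D0 \<omega>) (E0 \<omega>) + g (D0 \<omega>) (E0 \<omega>))
       (\<lambda>i \<omega>. (X i \<omega> - ?m) * f (D i \<omega>) (E i \<omega>) + g (D i \<omega>) (E i \<omega>))"
      by (rule iid_fun[of "\<lambda>x d e. (x - ?m) * f d e + g d e"]) measurable
    moreover have "(X i \<omega> - ?m) * f (D i \<omega>) (E i \<omega>) + g (D i \<omega>) (E i \<omega>)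
       = h * resid \<beta> i \<omega> + b * score \<beta> c a p q i \<omega>" for i \<omega>
      unfolding f_def g_def score_def err_def by (simp add: algebra_simps)
    ultimately show ?thesis by (simp only: F_def[abs_def])
  qed
  ultimately show ?thesis
    using iid_central_limit_theorem[OF _ sm(1) _ refl] sm(2) g_mean by auto
qed

lemma score_limits_finite_variance:
  assumes X2: "integrable M (\<lambda>\<omega>. (X0 \<omega>)\<^sup>2)"
    and l: "\<forall>n\<ge>1. l n = sqrt (variance X0)" and var: "variance X0 > 0"
    and eta: "expectation (\<lambda>\<omega>. (resid0 \<beta> \<omega>)\<^sup>2) > 0"
    and a: "a \<noteq> 0" and c: "c = 0 \<or> c = 1"
  shows "\<exists>r K k v d. score_limits l \<beta> c a p q r K k v d"
proof -
  let ?m = "expectation X0"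
  define s where "s = sqrt (variance X0)"
  have s: "s > 0" using var by (simp add: s_def)
  have ls: "l n = s" if "n \<ge> 1" for n using l that by (simp add: s_def)
  have inv: "(\<lambda>n. z / l n) \<longlonglongrightarrow> z / s" for z
    by (rule tendsto_eventually) (auto intro!: eventually_sequentiallyI[of 1] simp: ls)
  define Q where "Q = expectation (\<lambda>\<omega>. X0 \<omega> * X0 \<omega>) - c * (?m * ?m)"
  have Q: "Q > 0"
  proof -
    have "variance X0 = expectation (\<lambda>\<omega>. X0 \<omega> * X0 \<omega>) - ?m * ?m"
      using variance_eq[OF X_int X2] by (simp add: power2_eq_square)
    then have gt: "expectation (\<lambda>\<omega>. X0 \<omega> * X0 \<omega>) > ?m * ?m" using var by linarith
    moreover have "0 \<le> ?m * ?m" by simp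
    ultimately have "expectation (\<lambda>\<omega>. X0 \<omega> * X0 \<omega>) > 0" by (rule le_less_trans[rotated])
    with gt show ?thesis using c unfolding Q_def
      by (elim disjE) (simp_all only: mult_zero_left mult_1_left diff_gt_0_iff_gt diff_0_right)
  qed
  define K where "K = Q / s\<^sup>2"
  have K: "K > 0" using Q s unfolding K_def by (intro divide_pos_pos zero_less_power)
  have SXX: "prob_null M (\<lambda>n \<omega>. S_of c X X n \<omega> / (l n)\<^sup>2 - K)"
  proof -
    have "iid_copies M borel (\<lambda>\<omega>. X0 \<omega> * X0 \<omega>) (\<lambda>i \<omega>. X i \<omega> * X i \<omega>)"
      by (rule iid_compose[OF iid_X, of "\<lambda>z. z * z"]) measurable
    from S_tendsto[OF c iid_X X_int iid_X X_int this]
    have "prob_null M (\<lambda>n \<omega>. 1 / s\<^sup>2 * (S_of c X X n \<omega> - Q))"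
      using X2 by (intro prob_null_cmult) (simp add: Q_def power2_eq_square)
    then show ?thesis
      by (rule prob_null_cong_eventually) (simp add: ls K_def diff_divide_distrib)
  qed
  have meas: "(\<lambda>\<omega>. (\<Sum>i=1..n. h * resid \<beta> i \<omega> + b * score \<beta> c a p q i \<omega>) / sqrt (real n)) \<in> borel_measurable M" for n h b
    using err_meas score_measurable
    by (intro borel_measurable_divide borel_measurable_sum borel_measurable_add borel_measurable_times borel_measurable_const) auto
  have comb: "(\<Sum>i=1..n. h * resid \<beta> i \<omega> + b * score \<beta> c a p q i \<omega>) / sqrt (real n)
      = h * normed_resid \<beta> n \<omega> + b * s * normed_score l \<beta> c a p q n \<omega>" if "n \<ge> 1" for n h b \<omega>
    using ls[OF that] s
    by (simp add: normed_resid_def normed_score_def sum.distrib add_divide_distrib flip: sum_distrib_left)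
  have "1 / s \<noteq> 0 \<or> (0::real) \<noteq> 0" using s by simp
  from score_combination_clt[OF X2 var eta a this] obtain v where v: "v > 0" and T0: "tends_to_normal M
      (\<lambda>n \<omega>. (\<Sum>i=1..n. 0 * resid \<beta> i \<omega> + 1 / s * score \<beta> c a p q i \<omega>) / sqrt (real n)) v"
    by blast
  have T: "tends_to_normal M (normed_score l \<beta> c a p q) v"
    by (rule tends_to_normal_cong_eventually[OF T0 v meas normed_score_measurable])
       (simp only: comb, use s in simp)
  define B where "B = (?m / s) / (a * K)"
  have "- (B / s) \<noteq> 0 \<or> (1::real) \<noteq> 0" by simp
  from score_combination_clt[OF X2 var eta a this] obtain d where d: "d > 0" and T1: "tends_to_normal M
      (\<lambda>n \<omega>. (\<Sum>i=1..n. 1 * resid \<beta> i \<omega> + (- (B / s)) * score \<beta> c a p q i \<omega>) / sqrt (real n)) d"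
    by blast
  have T': "tends_to_normal M (\<lambda>n \<omega>. normed_resid \<beta> n \<omega> - B * normed_score l \<beta> c a p q n \<omega>) d"
  proof (rule tends_to_normal_cong_eventually[OF T1 d meas])
    show "(\<lambda>\<omega>. normed_resid \<beta> n \<omega> - B * normed_score l \<beta> c a p q n \<omega>) \<in> borel_measurable M" for n
      by (intro borel_measurable_diff borel_measurable_times borel_measurable_const normed_resid_measurable normed_score_measurable)
  qed (simp only: comb, use s in simp)
  have "score_limits l \<beta> c a p q (1 / s) K (?m / s) v d"
    unfolding score_limits_def B_def[symmetric] using inv K SXX v T d T' by blast
  then show ?thesis by blast
qed

end

section \<open>The estimators\<close>

lemma pos_definite_2:
  fixes a b d :: real
  assumes "pos_definite (vector [vector [a, b], vector [b, d]] :: real^2^2)" and "u \<noteq> 0 \<or> w \<noteq> 0"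
  shows "u\<^sup>2 * a + 2 * (u * w) * b + w\<^sup>2 * d > 0"
proof -
  let ?v = "vector [u, w] :: real^2"
  have "?v \<noteq> 0" using assms(2) by (auto simp: vec_eq_iff forall_2)
  then have "?v \<bullet> ((vector [vector [a, b], vector [b, d]] :: real^2^2) *v ?v) > 0"
    using assms(1) unfolding pos_definite_def by blast
  also have "?v \<bullet> ((vector [vector [a, b], vector [b, d]] :: real^2^2) *v ?v) = u\<^sup>2 * a + 2 * (u * w) * b + w\<^sup>2 * d"
    by (simp add: inner_vec_def matrix_vector_mult_def sum_2 power2_eq_square algebra_simps)
  finally show ?thesis .
qed

lemma S_commute: "S c u v n = S c v u n"
  by (simp add: S_def mult.commute)

lemma S_measurable:
  assumes "\<And>i. i \<ge> 1 \<Longrightarrow> u i \<in> borel_measurable M" "\<And>i. i \<ge> 1 \<Longrightarrow> v i \<in> borel_measurable M"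
  shows "(\<lambda>\<omega>. S c (\<lambda>i. u i \<omega>) (\<lambda>i. v i \<omega>) n) \<in> borel_measurable M"
proof -
  have "(\<lambda>\<omega>. smean (\<lambda>i. u i \<omega>) n) \<in> borel_measurable M" "(\<lambda>\<omega>. smean (\<lambda>i. v i \<omega>) n) \<in> borel_measurable M"
    unfolding smean_def using assms by (intro borel_measurable_divide borel_measurable_sum borel_measurable_const; simp)+
  then show ?thesis unfolding S_def using assms
    by (intro borel_measurable_divide borel_measurable_sum borel_measurable_times borel_measurable_diff borel_measurable_const) auto
qed

lemma estimators_cong:
  assumes "\<And>i. 1 \<le> i \<Longrightarrow> x i = x' i" "\<And>i. 1 \<le> i \<Longrightarrow> y i = y' i"
  shows "beta_hat1 c a m x y n = beta_hat1 c a m x' y' n" "beta_hat2 c a m x y n = beta_hat2 c a m x' y' n"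
    "alpha_hat1 c a m x y n = alpha_hat1 c a m x' y' n" "alpha_hat2 c a m x y n = alpha_hat2 c a m x' y' n"
proof -
  have "S c x y n = S c x' y' n" "S c y y n = S c y' y' n" "S c x x n = S c x' x' n"
    "smean x n = smean x' n" "smean y n = smean y' n"
    using assms by (auto intro!: S_cong smean_cong)
  then show "beta_hat1 c a m x y n = beta_hat1 c a m x' y' n" "beta_hat2 c a m x y n = beta_hat2 c a m x' y' n"
    "alpha_hat1 c a m x y n = alpha_hat1 c a m x' y' n" "alpha_hat2 c a m x y n = alpha_hat2 c a m x' y' n"
    by (simp_all add: beta_hat1_def beta_hat2_def alpha_hat1_def alpha_hat2_def)
qed

context structural_errors
begin

abbreviation obs_x :: "nat \<Rightarrow> 'a \<Rightarrow> real" where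
  "obs_x \<equiv> obs 1 0 0 1"

abbreviation obs_y :: "real \<Rightarrow> real \<Rightarrow> nat \<Rightarrow> 'a \<Rightarrow> real" where
  "obs_y \<beta> \<alpha> \<equiv> obs \<beta> \<alpha> 1 0"

lemma S_obs_measurable: "(\<lambda>\<omega>. S_of c (obs a a0 p q) (obs b b0 p' q') n \<omega>) \<in> borel_measurable M"
proof -
  have "obs a a0 p q i \<in> borel_measurable M" if "i \<ge> 1" for a a0 p q i
    unfolding obs_def[abs_def] using X_meas[OF that] err_meas[OF that]
    by (intro borel_measurable_add borel_measurable_times borel_measurable_const)
  then show ?thesis by (intro S_measurable)
qed

text \<open>If the variance is finite, \<open>l\<close> is the standard deviation, so that its positivity excludes a
  degenerate regressor.\<close>

lemma score_limits_exist:
  assumes l: "\<forall>n\<ge>1. l n > 0"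
    and clt: "tends_to_normal M
      (\<lambda>n \<omega>. ((\<Sum>i=1..n. X i \<omega>) - real n * expectation X0) / (sqrt (real n) * l n)) 1"
    and l_cases: "if integrable M (\<lambda>\<omega>. (X0 \<omega>)\<^sup>2) then \<forall>n\<ge>1. l n = sqrt (variance X0)
      else filterlim l at_top sequentially"
    and eta: "expectation (\<lambda>\<omega>. (resid0 \<beta> \<omega>)\<^sup>2) > 0"
    and a: "a \<noteq> 0" and c: "c = 0 \<or> c = 1"
  obtains r K k v d where "score_limits l \<beta> c a p q r K k v d"
proof (cases "integrable M (\<lambda>\<omega>. (X0 \<omega>)\<^sup>2)")
  case True
  then have l': "\<forall>n\<ge>1. l n = sqrt (variance X0)" using l_cases by simp
  have "variance X0 > 0" using l[rule_format, of 1] l'[rule_format, of 1] by simp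
  from score_limits_finite_variance[OF True l' this eta a c] show ?thesis using that by blast
next
  case False
  then have "filterlim l at_top sequentially" using l_cases by simp
  from score_limits_infinite_variance[OF False this clt eta a c] show ?thesis using that by blast
qed

theorem estimators_asymptotically_normal:
  assumes c: "(c = 0 \<and> \<alpha> = 0) \<or> c = 1"
    and l: "\<forall>n\<ge>1. l n > 0"
    and clt: "tends_to_normal M
      (\<lambda>n \<omega>. ((\<Sum>i=1..n. X i \<omega>) - real n * expectation X0) / (sqrt (real n) * l n)) 1"
    and l_cases: "if integrable M (\<lambda>\<omega>. (X0 \<omega>)\<^sup>2) then \<forall>n\<ge>1. l n = sqrt (variance X0)
      else filterlim l at_top sequentially"
    and eta: "expectation (\<lambda>\<omega>. (resid0 \<beta> \<omega>)\<^sup>2) > 0"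
    and dd: "dd = err_cov 1 0 1 0" and de: "de = err_cov 1 0 0 1" and ee: "ee = err_cov 0 1 0 1"
  shows "\<beta> \<noteq> 0 \<Longrightarrow> \<exists>c1>0. \<exists>d1>0.
      tends_to_normal M (\<lambda>n \<omega>. sqrt (real n) * l n *
        (beta_hat1 c dd de (\<lambda>i. obs_x i \<omega>) (\<lambda>i. obs_y \<beta> \<alpha> i \<omega>) n - \<beta>)) c1 \<and>
      tends_to_normal M (\<lambda>n \<omega>. sqrt (real n) *
        (alpha_hat1 c dd de (\<lambda>i. obs_x i \<omega>) (\<lambda>i. obs_y \<beta> \<alpha> i \<omega>) n - \<alpha>)) d1" (is "_ \<Longrightarrow> ?first")
    and "\<exists>c2>0. \<exists>d2>0.
      tends_to_normal M (\<lambda>n \<omega>. sqrt (real n) * l n *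
        (beta_hat2 c ee de (\<lambda>i. obs_x i \<omega>) (\<lambda>i. obs_y \<beta> \<alpha> i \<omega>) n - \<beta>)) c2 \<and>
      tends_to_normal M (\<lambda>n \<omega>. sqrt (real n) *
        (alpha_hat2 c ee de (\<lambda>i. obs_x i \<omega>) (\<lambda>i. obs_y \<beta> \<alpha> i \<omega>) n - \<alpha>)) d2" (is ?second)
proof -
  have c': "c = 0 \<or> c = 1" and c00: "(c = 0 \<and> (0::real) = 0 \<and> (0::real) = 0) \<or> c = 1"
    and c0\<alpha>: "(c = 0 \<and> (0::real) = 0 \<and> \<alpha> = 0) \<or> c = 1"
    and c\<alpha>\<alpha>: "(c = 0 \<and> \<alpha> = 0 \<and> \<alpha> = 0) \<or> c = 1" using c by blast+
  have ed: "de = err_cov 0 1 1 0" unfolding de by (simp only: mult.commute)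
  have scaled_pos: "z > 0" if "z / (l n)\<^sup>2 > 0" for z n
    using that by (simp add: zero_less_divide_iff)
  note [measurable] = S_obs_measurable
  show ?first if \<beta>: "\<beta> \<noteq> 0"
  proof -
    obtain r K k v d where lims: "score_limits l \<beta> c \<beta> 1 0 r K k v d"
      using score_limits_exist[OF l clt l_cases eta \<beta> c'] by blast
    then have inv: "(\<lambda>n. 1 / l n) \<longlonglongrightarrow> r" and K: "K > 0" and v: "v > 0" and d: "d > 0"
      and SXX: "prob_null M (\<lambda>n \<omega>. S_of c X X n \<omega> / (l n)\<^sup>2 - K)"
      unfolding score_limits_def by blast+
    have num: "whp M (\<lambda>n \<omega>. S_of c (obs_y \<beta> \<alpha>) (obs_y \<beta> \<alpha>) n \<omega> - dd > 0)"
    proof (rule whp_mono[OF whp_pos[OF S_obs_tendsto[OF c\<alpha>\<alpha> inv SXX, of \<beta> 1 0 \<beta> 1 0]]])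
      have "0 < \<beta>\<^sup>2" using \<beta> by simp
      then show "0 < \<beta> * \<beta> * K" using K unfolding power2_eq_square by (rule mult_pos_pos)
    qed (auto simp: dd intro!: always_eventually dest!: scaled_pos)
    have den: "whp M (\<lambda>n \<omega>. S_of c obs_x (obs_y \<beta> \<alpha>) n \<omega> - de \<noteq> 0)"
    proof (rule whp_mono[OF whp_nonzero[OF S_obs_tendsto[OF c0\<alpha> inv SXX, of 1 0 1 \<beta> 1 0]]])
      show "1 * \<beta> * K \<noteq> 0" using \<beta> K by simp
    qed (auto simp: ed intro!: always_eventually)
    let ?bh = "\<lambda>n \<omega>. beta_hat1 c dd de (\<lambda>i. obs_x i \<omega>) (\<lambda>i. obs_y \<beta> \<alpha> i \<omega>) n"
    have est: "whp M (\<lambda>n \<omega>. ?bh n \<omega> = (S_of c (obs_y \<beta> \<alpha>) (obs_y \<beta> \<alpha>) n \<omega> - err_cov 1 0 1 0)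
      / (S_of c (obs_y \<beta> \<alpha>) obs_x n \<omega> - err_cov 1 0 0 1))"
      unfolding dd[symmetric] de[symmetric]
    proof (rule whp_mono[OF whp_conj[OF num den]], intro always_eventually allI ballI impI)
      fix n \<omega>
      assume "S_of c (obs_y \<beta> \<alpha>) (obs_y \<beta> \<alpha>) n \<omega> - dd > 0 \<and> S_of c obs_x (obs_y \<beta> \<alpha>) n \<omega> - de \<noteq> 0"
      then show "?bh n \<omega> = (S_of c (obs_y \<beta> \<alpha>) (obs_y \<beta> \<alpha>) n \<omega> - dd) / (S_of c (obs_y \<beta> \<alpha>) obs_x n \<omega> - de)"
        unfolding S_commute[of c "\<lambda>i. obs_y \<beta> \<alpha> i \<omega>" "\<lambda>i. obs_x i \<omega>"] beta_hat1_def by simp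
    qed
    have bh_meas: "?bh n \<in> borel_measurable M" for n
      unfolding beta_hat1_def by measurable
    note lim = quotient_estimator_limits[OF c\<alpha>\<alpha> l \<beta> lims est bh_meas]
    have "(1 / (\<beta> * K))\<^sup>2 * v > 0" using \<beta> K v by (intro mult_pos_pos) (simp_all add: zero_less_power2)
    then show ?thesis using d lim unfolding alpha_hat1_def by blast
  qed
  obtain r K k v d where lims: "score_limits l \<beta> c 1 0 1 r K k v d"
    using score_limits_exist[OF l clt l_cases eta one_neq_zero c'] by blast
  then have inv: "(\<lambda>n. 1 / l n) \<longlonglongrightarrow> r" and K: "K > 0" and v: "v > 0" and d: "d > 0"
    and SXX: "prob_null M (\<lambda>n \<omega>. S_of c X X n \<omega> / (l n)\<^sup>2 - K)"
    unfolding score_limits_def by blast+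
  have den: "whp M (\<lambda>n \<omega>. S_of c obs_x obs_x n \<omega> - ee > 0)"
  proof (rule whp_mono[OF whp_pos[OF S_obs_tendsto[OF c00 inv SXX, of 1 0 1 1 0 1]]])
    show "0 < 1 * 1 * K" using K by simp
  qed (auto simp: ee intro!: always_eventually dest!: scaled_pos)
  let ?bh = "\<lambda>n \<omega>. beta_hat2 c ee de (\<lambda>i. obs_x i \<omega>) (\<lambda>i. obs_y \<beta> \<alpha> i \<omega>) n"
  have est: "whp M (\<lambda>n \<omega>. ?bh n \<omega> = (S_of c obs_x (obs_y \<beta> \<alpha>) n \<omega> - err_cov 0 1 1 0)
    / (S_of c obs_x obs_x n \<omega> - err_cov 0 1 0 1))"
    unfolding ee[symmetric] ed[symmetric]
    by (rule whp_mono[OF den]) (simp add: beta_hat2_def always_eventually)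
  have bh_meas: "?bh n \<in> borel_measurable M" for n
    unfolding beta_hat2_def by measurable
  note lim = quotient_estimator_limits[OF c0\<alpha> l one_neq_zero lims est bh_meas]
  have "(1 / (1 * K))\<^sup>2 * v > 0" using K v by (intro mult_pos_pos) (simp_all add: zero_less_power2)
  then show ?second using d lim unfolding alpha_hat2_def by blast
qed

end

theorem corollary1:
  fixes M :: "'a measure"
    and \<xi> \<delta> \<epsilon> :: "'a \<Rightarrow> real"
    and \<xi>s \<delta>s \<epsilon>s x y :: "nat \<Rightarrow> 'a \<Rightarrow> real"
    and \<alpha> \<beta> lam \<theta> \<mu> c :: real
    and l :: "real \<Rightarrow> real"
  assumes "prob_space M"
    \<comment> \<open>the model\<close>
    and "\<And>i \<omega>. 1 \<le> i \<Longrightarrow> \<omega> \<in> space M \<Longrightarrow> y i \<omega> = \<beta> * \<xi>s i \<omega> + \<alpha> + \<delta>s i \<omega>"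
    and "\<And>i \<omega>. 1 \<le> i \<Longrightarrow> \<omega> \<in> space M \<Longrightarrow> x i \<omega> = \<xi>s i \<omega> + \<epsilon>s i \<omega>"
    \<comment> \<open>\<open>c = 0\<close>: the intercept is known to be zero; \<open>c = 1\<close>: it is unknown\<close>
    and "(c = 0 \<and> \<alpha> = 0) \<or> c = 1"
    \<comment> \<open>(A)\<close>
    and "iid_copies M borel (\<lambda>\<omega>. (\<delta> \<omega>, \<epsilon> \<omega>)) (\<lambda>i \<omega>. (\<delta>s i \<omega>, \<epsilon>s i \<omega>))"
    and "integrable M (\<lambda>\<omega>. \<delta> \<omega> ^ 4)" and "integrable M (\<lambda>\<omega>. \<epsilon> \<omega> ^ 4)"
    and "prob_space.expectation M \<delta> = 0" and "prob_space.expectation M \<epsilon> = 0"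
    and "prob_space.variance M \<delta> = lam * \<theta>" and "prob_space.variance M \<epsilon> = \<theta>"
    and "covariance M \<delta> \<epsilon> = \<mu>"
    and "pos_definite (vector [vector [lam * \<theta>, \<mu>], vector [\<mu>, \<theta>]] :: real^2^2)"
    \<comment> \<open>(B)\<close>
    and "iid_copies M borel \<xi> \<xi>s"
    and "DAN M \<xi>s"
    \<comment> \<open>(C)\<close>
    and "indep_rvs M borel (\<lambda>\<omega>. (\<delta> \<omega>, \<epsilon> \<omega>)) borel \<xi>"
    and "indep_rvs M
           (Pi\<^sub>M {1..} (\<lambda>_. borel)) (\<lambda>\<omega>. \<lambda>i\<in>{1..}. (\<delta>s i \<omega>, \<epsilon>s i \<omega>))
           (Pi\<^sub>M {1..} (\<lambda>_. borel)) (\<lambda>\<omega>. \<lambda>i\<in>{1..}. \<xi>s i \<omega>)"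
    \<comment> \<open>\<open>l\<close> is the function \<open>\<ell>\<^sub>\<xi>\<close>\<close>
    and "DAN_norming M \<xi> \<xi>s l"
  shows
    \<comment> \<open>\<open>j = 1\<close>; the condition under which this estimator is defined holds with probability
      tending to 1 only if \<open>\<beta> \<noteq> 0\<close>\<close>
    "(\<beta> \<noteq> 0 \<longrightarrow>
       (\<exists>c1>0. \<exists>d1>0.
          tends_to_normal M
            (\<lambda>n \<omega>. sqrt (real n) * l (real n) *
               (beta_hat1 c (lam * \<theta>) \<mu> (\<lambda>i. x i \<omega>) (\<lambda>i. y i \<omega>) n - \<beta>)) c1 \<and>
          tends_to_normal M
            (\<lambda>n \<omega>. sqrt (real n) *
               (alpha_hat1 c (lam * \<theta>) \<mu> (\<lambda>i. x i \<omega>) (\<lambda>i. y i \<omega>) n - \<alpha>)) d1)) \<and>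
     \<comment> \<open>\<open>j = 2\<close>\<close>
     (\<exists>c2>0. \<exists>d2>0.
        tends_to_normal M
          (\<lambda>n \<omega>. sqrt (real n) * l (real n) *
             (beta_hat2 c \<theta> \<mu> (\<lambda>i. x i \<omega>) (\<lambda>i. y i \<omega>) n - \<beta>)) c2 \<and>
        tends_to_normal M
          (\<lambda>n \<omega>. sqrt (real n) *
             (alpha_hat2 c \<theta> \<mu> (\<lambda>i. x i \<omega>) (\<lambda>i. y i \<omega>) n - \<alpha>)) d2)"
proof -
  interpret prob_space M by (rule assms(1))
  note model = assms(2,3) and c = assms(4) and moments = assms(6-13)
  have l: "\<forall>n\<ge>1. l (real n) > 0" "integrable M \<xi>"
    "tends_to_normal M (\<lambda>n \<omega>. ((\<Sum>i=1..n. \<xi>s i \<omega>) - real n * expectation \<xi>) / (sqrt (real n) * l (real n))) 1"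
    "if integrable M (\<lambda>\<omega>. (\<xi> \<omega>)\<^sup>2) then \<forall>n\<ge>1. l (real n) = sqrt (variance \<xi>)
      else filterlim (\<lambda>n. l (real n)) at_top sequentially"
    using assms(18) unfolding DAN_norming_def by (blast, blast, blast, presburger)
  have iid: "iid_copies M borel (\<lambda>\<omega>. (\<xi> \<omega>, \<delta> \<omega>, \<epsilon> \<omega>)) (\<lambda>i \<omega>. (\<xi>s i \<omega>, \<delta>s i \<omega>, \<epsilon>s i \<omega>))"
    using iid_copies_Pair[OF assms(14,5,16,17)] by (simp only: borel_prod)
  have indep: "indep_var borel \<xi> borel (\<lambda>\<omega>. f (\<delta> \<omega>, \<epsilon> \<omega>))" if "f \<in> borel_measurable borel" for f :: "real \<times> real \<Rightarrow> real"
    by (rule indep_rvs_imp_indep_var[OF assms(16) that])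
  interpret structural_errors M \<xi> \<delta> \<epsilon> \<xi>s \<delta>s \<epsilon>s
    by unfold_locales (rule iid, rule indep, assumption, rule l(2), rule moments(1), rule moments(2), rule moments(3), rule moments(4))
  have e0: "err0 1 0 = \<delta>" "err0 0 1 = \<epsilon>" by (auto simp: err0_def)
  have dd: "lam * \<theta> = err_cov 1 0 1 0"
    using moments(3,5) by (simp add: e0 power2_eq_square)
  have ee: "\<theta> = err_cov 0 1 0 1"
    using moments(4,6) by (simp add: e0 power2_eq_square)
  have de: "\<mu> = err_cov 1 0 0 1"
    using moments(3,4,7) by (simp add: e0 covariance_def)
  \<comment> \<open>the covariance matrix is applied to the vector \<open>(1, - \<beta>)\<close>\<close>
  have eta: "expectation (\<lambda>\<omega>. (resid0 \<beta> \<omega>)\<^sup>2) > 0"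
  proof -
    have "(resid0 \<beta> \<omega>)\<^sup>2 = 1\<^sup>2 * (err0 1 0 \<omega> * err0 1 0 \<omega>) + 2 * (1 * - \<beta>) * (err0 1 0 \<omega> * err0 0 1 \<omega>)
        + (- \<beta>)\<^sup>2 * (err0 0 1 \<omega> * err0 0 1 \<omega>)" for \<omega>
      by (simp add: err0_def power2_eq_square algebra_simps)
    then have "expectation (\<lambda>\<omega>. (resid0 \<beta> \<omega>)\<^sup>2)
        = 1\<^sup>2 * err_cov 1 0 1 0 + 2 * (1 * - \<beta>) * err_cov 1 0 0 1 + (- \<beta>)\<^sup>2 * err_cov 0 1 0 1"
      by (simp add: err0_mult_int)
    also have "\<dots> = 1\<^sup>2 * (lam * \<theta>) + 2 * (1 * - \<beta>) * \<mu> + (- \<beta>)\<^sup>2 * \<theta>"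
      by (simp only: dd[symmetric] ee[symmetric] de[symmetric])
    also have "\<dots> > 0" by (rule pos_definite_2[OF moments(8)]) simp
    finally show ?thesis .
  qed
  note est = estimators_asymptotically_normal[where l="\<lambda>n. l (real n)", OF c l(1,3,4) eta dd de ee]
  have "x i \<omega> = obs_x i \<omega>" "y i \<omega> = obs_y \<beta> \<alpha> i \<omega>" if "\<omega> \<in> space M" "1 \<le> i" for i \<omega>
    using model that by (simp_all add: obs_def err_def)
  note eqs = estimators_cong[of "\<lambda>i. x i _" "\<lambda>i. obs_x i _" "\<lambda>i. y i _" "\<lambda>i. obs_y \<beta> \<alpha> i _", OF this]
  show ?thesis
    using est by (simp only: eqs cong: tends_to_normal_cong) blast
qed

end
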